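(* Let $M$ be a contact manifold of dimension $2\ell+1$, $\ell\ge1$, with contact tensor field $\Theta$, and let $g$ be a metric on $M$ of constant sectional curvature. Suppose that the contact structure is defined by a contact 1-form $\theta$ which is a Killing form with respect to some metric $g'$ from the projective class $[g]$ of $g$. Then $A_{g,\Theta}=0$.
   Context: All objects are smooth; metrics may be pseudo-Riemannian; summation over repeated indices is understood. A contact manifold is a manifold $M$ of dimension $2\ell+1$ with a completely non-integrable hyperplane distribution $\mathcal D\subset TM$, locally $\mathcal D=\ker\theta$ for a 1-form $\theta$ (a contact form) such that $\mathrm{vol}:=\theta\wedge(d\theta)^\ell$ is nowhere zero. For real $\lambda$, a weighted density of weight $\lambda$ is a section of $(\Lambda^{n}T^*M)^{\otimes\lambda}$, $n=\dim M$; locally it is written $\phi\,\omega^\lambda$, where $\phi$ is a function and $\omega$ is the coordinate volume form. The contact tensor field is the weighted 1-form $\Theta:=\theta\otimes \mathrm{vol}^{-\frac{1}{\ell+1}}$; $\Theta_j$ denotes its components. For the Levi-Civita connection $\nabla$ of $g$ with Christoffel symbols $\Gamma_{ij}^k$, the covariant derivative acts by $\nabla_i\beta_j=\partial_i\beta_j-\Gamma_{ij}^k\beta_k$ on 1-forms and by $\nabla_i(\phi\,\omega^\lambda)=(\partial_i\phi-\lambda\Gamma_{ij}^j\phi)\,\omega^\lambda$ on $\lambda$-densities, and is extended to weighted tensor fields by the Leibniz rule. One defines the weighted density of weight $-\frac{1}{\ell+1}$ $$A_{g,\Theta}:=\langle g,\nabla\Theta\rangle=g^{ij}\nabla_i\Theta_j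 .$$ The projective class $[g]$ is the set of metrics $g'$ geodesically equivalent to $g$, i.e. whose Levi-Civita connections have the same non-parametrized geodesics as that of $g$. A 1-form $\beta$ is a Killing form with respect to a metric $g'$ if $\nabla'_i\beta_j+\nabla'_j\beta_i=0$, where $\nabla'$ is the Levi-Civita connection of $g'$. *)

theory Defs
  imports "HOL-Analysis.Analysis"
begin

text \<open>On an open set, \<open>Ck_on k\<close> is k-fold continuous differentiability, expressed through
  iterated directional derivatives. It is only used on open sets.\<close>

primrec Ck_on ::
  "nat \<Rightarrow> 'a::real_normed_vector set \<Rightarrow> ('a \<Rightarrow> 'b::real_normed_vector) \<Rightarrow> bool" where
  "Ck_on 0 S f = continuous_on S f"
| "Ck_on (Suc k) S f =
     ((\<forall>x\<in>S. f differentiable (at x)) \<and>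
      (\<forall>v. Ck_on k S (\<lambda>x. frechet_derivative f (at x) v)))"

definition smooth_on :: "'a::real_normed_vector set \<Rightarrow> ('a \<Rightarrow> 'b::real_normed_vector) \<Rightarrow> bool" where
  "smooth_on S f \<longleftrightarrow> (\<forall>k. Ck_on k S f)"

definition partial :: "'n::finite \<Rightarrow> (real^'n \<Rightarrow> real) \<Rightarrow> real^'n \<Rightarrow> real" where
  "partial i f x = frechet_derivative f (at x) (axis i 1)"

type_synonym ('a, 'n) chart = "'a set \<times> ('a \<Rightarrow> real^'n)"

abbreviation chart_dom :: "('a, 'n::finite) chart \<Rightarrow> 'a set" where
  "chart_dom c \<equiv> fst c"

abbreviation chart_map :: "('a, 'n::finite) chart \<Rightarrow> 'a \<Rightarrow> real^'n" where
  "chart_map c \<equiv> snd c"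

definition chart_img :: "('a, 'n::finite) chart \<Rightarrow> (real^'n) set" where
  "chart_img c = chart_map c ` chart_dom c"

definition chart_inv :: "('a, 'n::finite) chart \<Rightarrow> real^'n \<Rightarrow> 'a" where
  "chart_inv c = inv_into (chart_dom c) (chart_map c)"

definition is_chart :: "'a topology \<Rightarrow> ('a, 'n::finite) chart \<Rightarrow> bool" where
  "is_chart X c \<longleftrightarrow> openin X (chart_dom c) \<and> open (chart_img c) \<and>
     homeomorphic_map (subtopology X (chart_dom c)) (top_of_set (chart_img c)) (chart_map c)"

definition overlap :: "('a, 'n::finite) chart \<Rightarrow> ('a, 'n) chart \<Rightarrow> (real^'n) set" where
  "overlap c d = chart_map c ` (chart_dom c \<inter> chart_dom d)"

definition transition :: "('a, 'n::finite) chart \<Rightarrow> ('a, 'n) chart \<Rightarrow> real^'n \<Rightarrow> real^'n" where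
  "transition c d = chart_map d \<circ> chart_inv c"

definition transition_jacobian ::
  "('a, 'n::finite) chart \<Rightarrow> ('a, 'n) chart \<Rightarrow> real^'n \<Rightarrow> real^'n^'n" where
  "transition_jacobian c d x = jacobian (transition c d) (at x)"

definition smooth_manifold :: "'a topology \<Rightarrow> ('a, 'n::finite) chart set \<Rightarrow> bool" where
  "smooth_manifold X \<A> \<longleftrightarrow>
     Hausdorff_space X \<and> second_countable X \<and>
     (\<forall>c\<in>\<A>. is_chart X c) \<and> (\<Union>c\<in>\<A>. chart_dom c) = topspace X \<and>
     (\<forall>c\<in>\<A>. \<forall>d\<in>\<A>. smooth_on (overlap c d) (transition c d))"

text \<open>A tensor field is given by its components in every chart of the atlas, as functions of the
  coordinates, subject to the transformation law on overlaps. The values for pairs that are not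
  charts of the atlas, and outside the image of a chart, are irrelevant.\<close>

type_synonym ('a, 'n) covector_field = "('a, 'n) chart \<Rightarrow> real^'n \<Rightarrow> real^'n"
type_synonym ('a, 'n) bilinear_field = "('a, 'n) chart \<Rightarrow> real^'n \<Rightarrow> real^'n^'n"
type_synonym ('a, 'n) distribution = "('a, 'n) chart \<Rightarrow> real^'n \<Rightarrow> (real^'n) set"

text \<open>In the coordinates of a chart \<open>c\<close>, a 1-form of weight \<open>w\<close> is written
  \<open>\<Theta>\<^sub>j dx\<^sup>j \<otimes> \<omega>\<^sup>w\<close> with \<open>\<omega>\<close> the coordinate volume form;
  \<open>\<omega>\<^sup>w\<close> changes by \<open>\<bar>det J\<bar>\<^sup>w\<close>.\<close>

definition weighted_one_form ::
  "('a, 'n::finite) chart set \<Rightarrow> real \<Rightarrow> ('a, 'n) covector_field \<Rightarrow> bool" where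
  "weighted_one_form \<A> w \<Theta> \<longleftrightarrow>
     (\<forall>c\<in>\<A>. smooth_on (chart_img c) (\<Theta> c)) \<and>
     (\<forall>c\<in>\<A>. \<forall>d\<in>\<A>. \<forall>x\<in>overlap c d.
        \<Theta> c x = (\<bar>det (transition_jacobian c d x)\<bar> powr w) *\<^sub>R
                  (transpose (transition_jacobian c d x) *v \<Theta> d (transition c d x)))"

definition one_form :: "('a, 'n::finite) chart set \<Rightarrow> ('a, 'n) covector_field \<Rightarrow> bool" where
  "one_form \<A> \<beta> \<longleftrightarrow>
     (\<forall>c\<in>\<A>. smooth_on (chart_img c) (\<beta> c)) \<and>
     (\<forall>c\<in>\<A>. \<forall>d\<in>\<A>. \<forall>x\<in>overlap c d.
        \<beta> c x = transpose (transition_jacobian c d x) *v \<beta> d (transition c d x))"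

definition pseudo_riemannian_metric ::
  "('a, 'n::finite) chart set \<Rightarrow> ('a, 'n) bilinear_field \<Rightarrow> bool" where
  "pseudo_riemannian_metric \<A> g \<longleftrightarrow>
     (\<forall>c\<in>\<A>. smooth_on (chart_img c) (g c)) \<and>
     (\<forall>c\<in>\<A>. \<forall>x\<in>chart_img c. transpose (g c x) = g c x \<and> invertible (g c x)) \<and>
     (\<forall>c\<in>\<A>. \<forall>d\<in>\<A>. \<forall>x\<in>overlap c d.
        g c x = transpose (transition_jacobian c d x) ** g d (transition c d x)
                  ** transition_jacobian c d x)"

text \<open>\<open>christoffel g k i j\<close> is \<open>\<Gamma>\<close> with upper index \<open>k\<close> and lower indices \<open>i\<close>, \<open>j\<close>.\<close>

definition christoffel ::
  "(real^'n \<Rightarrow> real^'n^'n) \<Rightarrow> 'n::finite \<Rightarrow> 'n \<Rightarrow> 'n \<Rightarrow> real^'n \<Rightarrow> real" where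
  "christoffel g k i j x =
     (\<Sum>l\<in>UNIV. matrix_inv (g x) $ k $ l *
        (partial i (\<lambda>y. g y $ j $ l) x + partial j (\<lambda>y. g y $ i $ l) x
         - partial l (\<lambda>y. g y $ i $ j) x)) / 2"

definition nabla_form ::
  "(real^'n \<Rightarrow> real^'n^'n) \<Rightarrow> (real^'n \<Rightarrow> real^'n) \<Rightarrow> 'n::finite \<Rightarrow> 'n \<Rightarrow> real^'n \<Rightarrow> real" where
  "nabla_form g \<beta> i j x =
     partial i (\<lambda>y. \<beta> y $ j) x - (\<Sum>k\<in>UNIV. christoffel g k i j x * \<beta> x $ k)"

definition nabla_density ::
  "(real^'n \<Rightarrow> real^'n^'n) \<Rightarrow> real \<Rightarrow> (real^'n \<Rightarrow> real) \<Rightarrow> 'n::finite \<Rightarrow> real^'n \<Rightarrow> real" where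
  "nabla_density g w \<phi> i x =
     partial i \<phi> x - w * (\<Sum>j\<in>UNIV. christoffel g j i j x) * \<phi> x"

text \<open>Leibniz rule for \<open>\<Theta>\<^sub>j dx\<^sup>j \<otimes> \<omega>\<^sup>w\<close>.\<close>

definition nabla_weighted_form ::
  "(real^'n \<Rightarrow> real^'n^'n) \<Rightarrow> real \<Rightarrow> (real^'n \<Rightarrow> real^'n) \<Rightarrow> 'n::finite \<Rightarrow> 'n \<Rightarrow> real^'n \<Rightarrow> real" where
  "nabla_weighted_form g w \<Theta> i j x =
     nabla_form g \<Theta> i j x + \<Theta> x $ j * nabla_density g w (\<lambda>_. 1) i x"

text \<open>\<open>R(\<partial>\<^sub>i, \<partial>\<^sub>j)\<partial>\<^sub>k = R\<^sup>l \<partial>\<^sub>l\<close> with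
  \<open>R(X,Y) = [\<nabla>\<^sub>X, \<nabla>\<^sub>Y] - \<nabla>\<close> along \<open>[X,Y]\<close>.\<close>

definition riemann ::
  "(real^'n \<Rightarrow> real^'n^'n) \<Rightarrow> 'n::finite \<Rightarrow> 'n \<Rightarrow> 'n \<Rightarrow> 'n \<Rightarrow> real^'n \<Rightarrow> real" where
  "riemann g l k i j x =
     partial i (christoffel g l j k) x - partial j (christoffel g l i k) x
     + (\<Sum>m\<in>UNIV. christoffel g l i m x * christoffel g m j k x
                 - christoffel g l j m x * christoffel g m i k x)"

definition curvature_op ::
  "(real^'n \<Rightarrow> real^'n^'n) \<Rightarrow> real^'n \<Rightarrow> real^'n \<Rightarrow> real^'n \<Rightarrow> real^'n \<Rightarrow> real^'n::finite" where
  "curvature_op g x X Y Z =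
     (\<chi> l. \<Sum>i\<in>UNIV. \<Sum>j\<in>UNIV. \<Sum>k\<in>UNIV. riemann g l k i j x * X $ i * Y $ j * Z $ k)"

definition gprod :: "real^'n^'n \<Rightarrow> real^'n \<Rightarrow> real^'n::finite \<Rightarrow> real" where
  "gprod G u v = u \<bullet> (G *v v)"

definition gram2 :: "real^'n^'n \<Rightarrow> real^'n \<Rightarrow> real^'n::finite \<Rightarrow> real" where
  "gram2 G X Y = gprod G X X * gprod G Y Y - (gprod G X Y)\<^sup>2"

definition sectional_curvature ::
  "(real^'n \<Rightarrow> real^'n^'n) \<Rightarrow> real^'n \<Rightarrow> real^'n \<Rightarrow> real^'n::finite \<Rightarrow> real" where
  "sectional_curvature g x X Y = gprod (g x) (curvature_op g x X Y Y) X / gram2 (g x) X Y"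

text \<open>For an indefinite metric the sectional curvature is only defined on nondegenerate planes,
  i.e. for \<open>gram2 \<noteq> 0\<close>.\<close>

definition constant_sectional_curvature ::
  "('a, 'n::finite) chart set \<Rightarrow> ('a, 'n) bilinear_field \<Rightarrow> bool" where
  "constant_sectional_curvature \<A> g \<longleftrightarrow>
     (\<exists>\<kappa>. \<forall>c\<in>\<A>. \<forall>x\<in>chart_img c. \<forall>X Y. gram2 (g c x) X Y \<noteq> 0 \<longrightarrow>
        sectional_curvature (g c) x X Y = \<kappa>)"

definition killing_form ::
  "('a, 'n::finite) chart set \<Rightarrow> ('a, 'n) bilinear_field \<Rightarrow> ('a, 'n) covector_field \<Rightarrow> bool" where
  "killing_form \<A> g \<beta> \<longleftrightarrow> one_form \<A> \<beta> \<and>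
     (\<forall>c\<in>\<A>. \<forall>x\<in>chart_img c. \<forall>i j.
        nabla_form (g c) (\<beta> c) i j x + nabla_form (g c) (\<beta> c) j i x = 0)"

definition open_interval :: "real set \<Rightarrow> bool" where
  "open_interval I \<longleftrightarrow> open I \<and> is_interval I \<and> I \<noteq> {}"

definition smooth_curve ::
  "'a topology \<Rightarrow> ('a, 'n::finite) chart set \<Rightarrow> real set \<Rightarrow> (real \<Rightarrow> 'a) \<Rightarrow> bool" where
  "smooth_curve X \<A> I \<gamma> \<longleftrightarrow> open_interval I \<and> continuous_map (top_of_set I) X \<gamma> \<and>
     (\<forall>c\<in>\<A>. smooth_on {t\<in>I. \<gamma> t \<in> chart_dom c} (chart_map c \<circ> \<gamma>))"

definition geodesic ::
  "'a topology \<Rightarrow> ('a, 'n::finite) chart set \<Rightarrow> ('a, 'n) bilinear_field \<Rightarrow>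
   real set \<Rightarrow> (real \<Rightarrow> 'a) \<Rightarrow> bool" where
  "geodesic X \<A> g I \<gamma> \<longleftrightarrow> smooth_curve X \<A> I \<gamma> \<and>
     (\<forall>c\<in>\<A>. \<forall>t\<in>I. \<gamma> t \<in> chart_dom c \<longrightarrow>
        (let x = chart_map c \<circ> \<gamma>; v = (\<lambda>s. vector_derivative x (at s)) in
         \<forall>k. vector_derivative v (at t) $ k
             + (\<Sum>i\<in>UNIV. \<Sum>j\<in>UNIV. christoffel (g c) k i j (x t) * v t $ i * v t $ j) = 0))"

text \<open>A non-parametrized geodesic is a curve that becomes a geodesic after a smooth change of
  parameter \<open>s\<close> with nowhere vanishing derivative.\<close>

definition nonparametrized_geodesic ::
  "'a topology \<Rightarrow> ('a, 'n::finite) chart set \<Rightarrow> ('a, 'n) bilinear_field \<Rightarrow>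
   real set \<Rightarrow> (real \<Rightarrow> 'a) \<Rightarrow> bool" where
  "nonparametrized_geodesic X \<A> g I \<gamma> \<longleftrightarrow> open_interval I \<and>
     (\<exists>J s. open_interval J \<and> bij_betw s J I \<and> smooth_on J s \<and>
        (\<forall>t\<in>J. vector_derivative s (at t) \<noteq> (0::real)) \<and> geodesic X \<A> g J (\<gamma> \<circ> s))"

definition projective_class ::
  "'a topology \<Rightarrow> ('a, 'n::finite) chart set \<Rightarrow> ('a, 'n) bilinear_field \<Rightarrow>
   ('a, 'n) bilinear_field set" where
  "projective_class X \<A> g = {g'. pseudo_riemannian_metric \<A> g' \<and>
     (\<forall>I \<gamma>. nonparametrized_geodesic X \<A> g' I \<gamma> \<longleftrightarrow> nonparametrized_geodesic X \<A> g I \<gamma>)}"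

text \<open>A p-form on a vector space, as a function of the list of its p arguments; the wedge product
  is normalised so that \<open>dx\<^sup>1 \<and> \<dots> \<and> dx\<^sup>n\<close> is 1 on the standard basis.\<close>

definition wedge ::
  "nat \<Rightarrow> nat \<Rightarrow> ('v list \<Rightarrow> real) \<Rightarrow> ('v list \<Rightarrow> real) \<Rightarrow> 'v list \<Rightarrow> real" where
  "wedge p q \<alpha> \<beta> vs =
     (\<Sum>\<sigma> | \<sigma> permutes {..<p + q}. of_int (sign \<sigma>) *
        \<alpha> (map (\<lambda>i. vs ! \<sigma> i) [0..<p]) * \<beta> (map (\<lambda>i. vs ! \<sigma> i) [p..<p + q]))
     / (fact p * fact q)"

primrec wedge_power :: "nat \<Rightarrow> ('v list \<Rightarrow> real) \<Rightarrow> nat \<Rightarrow> 'v list \<Rightarrow> real" where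
  "wedge_power q \<alpha> 0 = (\<lambda>vs. 1)"
| "wedge_power q \<alpha> (Suc k) = wedge q (k * q) \<alpha> (wedge_power q \<alpha> k)"

definition form1 :: "(real^'n \<Rightarrow> real^'n) \<Rightarrow> real^'n \<Rightarrow> (real^'n::finite) list \<Rightarrow> real" where
  "form1 \<theta> x vs = \<theta> x \<bullet> (vs ! 0)"

definition ext_deriv1 :: "(real^'n \<Rightarrow> real^'n) \<Rightarrow> real^'n \<Rightarrow> (real^'n::finite) list \<Rightarrow> real" where
  "ext_deriv1 \<theta> x vs =
     frechet_derivative \<theta> (at x) (vs ! 0) \<bullet> (vs ! 1)
     - frechet_derivative \<theta> (at x) (vs ! 1) \<bullet> (vs ! 0)"

text \<open>The function \<open>h\<close> with \<open>\<theta> \<and> (d\<theta>)\<^sup>l = h \<omega>\<close>, in the dimension \<open>2 l + 1\<close>.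
  The order on the index type is the order of the coordinates in \<open>\<omega>\<close>.\<close>

definition contact_vol ::
  "nat \<Rightarrow> (real^'n::{finite,linorder} \<Rightarrow> real^'n::{finite,linorder}) \<Rightarrow> real^'n::{finite,linorder} \<Rightarrow> real" where
  "contact_vol l \<theta> x =
     wedge 1 (2 * l) (form1 \<theta> x) (wedge_power 2 (ext_deriv1 \<theta> x) l)
       (map (\<lambda>i. axis i 1) (sorted_list_of_set (UNIV :: 'n set)))"

definition defining_contact_form_on ::
  "nat \<Rightarrow> (real^'n::{finite,linorder}) set \<Rightarrow> (real^'n::{finite,linorder} \<Rightarrow> (real^'n::{finite,linorder}) set) \<Rightarrow>
   (real^'n::{finite,linorder} \<Rightarrow> real^'n::{finite,linorder}) \<Rightarrow> bool" where
  "defining_contact_form_on l W D \<theta> \<longleftrightarrow> open W \<and> smooth_on W \<theta> \<and>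
     (\<forall>x\<in>W. contact_vol l \<theta> x \<noteq> 0 \<and> D x = {v. \<theta> x \<bullet> v = 0})"

definition contact_structure ::
  "('a, 'n::{finite,linorder}) chart set \<Rightarrow> nat \<Rightarrow> ('a, 'n) distribution \<Rightarrow> bool" where
  "contact_structure \<A> l D \<longleftrightarrow>
     (\<forall>c\<in>\<A>. \<forall>d\<in>\<A>. \<forall>x\<in>overlap c d. \<forall>v.
        v \<in> D c x \<longleftrightarrow> transition_jacobian c d x *v v \<in> D d (transition c d x)) \<and>
     (\<forall>c\<in>\<A>. \<forall>x\<in>chart_img c. \<exists>W \<theta>. x \<in> W \<and> W \<subseteq> chart_img c \<and>
        defining_contact_form_on l W (D c) \<theta>)"

definition contact_manifold ::
  "'a topology \<Rightarrow> ('a, 'n::{finite,linorder}) chart set \<Rightarrow> nat \<Rightarrow> ('a, 'n) distribution \<Rightarrow> bool" where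
  "contact_manifold X \<A> l D \<longleftrightarrow>
     smooth_manifold X \<A> \<and> CARD('n) = 2 * l + 1 \<and> contact_structure \<A> l D"

definition contact_form_of ::
  "('a, 'n::{finite,linorder}) chart set \<Rightarrow> nat \<Rightarrow> ('a, 'n) distribution \<Rightarrow>
   ('a, 'n) covector_field \<Rightarrow> bool" where
  "contact_form_of \<A> l D \<theta> \<longleftrightarrow> one_form \<A> \<theta> \<and>
     (\<forall>c\<in>\<A>. defining_contact_form_on l (chart_img c) (D c) (\<theta> c))"

definition contact_weight :: "nat \<Rightarrow> real" where
  "contact_weight l = - 1 / (real l + 1)"

text \<open>\<open>\<Theta> = \<theta> \<otimes> vol\<close> to the power \<open>-1/(l+1)\<close>, for any local contact form \<open>\<theta>\<close> defining
  \<open>D\<close>; by homogeneity the choice of \<open>\<theta>\<close> only affects the sign of \<open>\<Theta>\<close>.\<close>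

definition contact_tensor_field ::
  "('a, 'n::{finite,linorder}) chart set \<Rightarrow> nat \<Rightarrow> ('a, 'n) distribution \<Rightarrow>
   ('a, 'n) covector_field \<Rightarrow> bool" where
  "contact_tensor_field \<A> l D \<Theta> \<longleftrightarrow>
     weighted_one_form \<A> (contact_weight l) \<Theta> \<and>
     (\<forall>c\<in>\<A>. \<forall>x\<in>chart_img c. \<exists>W \<theta>. x \<in> W \<and> W \<subseteq> chart_img c \<and>
        defining_contact_form_on l W (D c) \<theta> \<and>
        (\<forall>y\<in>W. \<Theta> c y = (\<bar>contact_vol l \<theta> y\<bar> powr contact_weight l) *\<^sub>R \<theta> y))"

text \<open>The coefficient, in the chart \<open>c\<close>, of the density \<open>A = g\<^sup>i\<^sup>j \<nabla>\<^sub>i \<Theta>\<^sub>j\<close> of weight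
  \<open>contact_weight l\<close>.\<close>

definition A_density ::
  "nat \<Rightarrow> ('a, 'n::finite) bilinear_field \<Rightarrow> ('a, 'n) covector_field \<Rightarrow>
   ('a, 'n) chart \<Rightarrow> real^'n \<Rightarrow> real" where
  "A_density l g \<Theta> c x =
     (\<Sum>i\<in>UNIV. \<Sum>j\<in>UNIV. matrix_inv (g c x) $ i $ j *
        nabla_weighted_form (g c) (contact_weight l) (\<Theta> c) i j x)"

end

theory Submission
  imports Defs
begin

text \<open>Two metrics with the same non-parametrized geodesics have connections related by
  \<open>\<Gamma>' = \<Gamma> + \<delta> \<psi> + \<delta> \<psi>\<close> for a covector \<open>\<psi>\<close>; taking the trace of both curvatures shows that
  \<open>\<psi>\<close> is closed. As \<open>g\<close> has constant curvature, the curvature of \<open>\<nabla>'\<close> applied to \<open>\<theta>\<close> is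
  \<open>\<theta>\<^sub>i P\<^sub>j\<^sub>k - \<theta>\<^sub>j P\<^sub>i\<^sub>k\<close>. For a Killing form, \<open>\<nabla>'\<^sub>k \<theta>\<close> is half the contraction of \<open>d\<theta>\<close> with \<open>\<partial>\<^sub>k\<close>, and
  \<open>\<nabla>'\<^sub>k d\<theta>\<close> is \<open>\<theta> \<and> 2 P\<^sub>k\<close>. Hence \<open>\<nabla>' vol = 0\<close>: the first contribution is a contraction
  of \<open>(d\<theta>)\<close> to the power \<open>l + 1\<close>, which vanishes in dimension \<open>2 l + 1\<close>, and the second one contains
  \<open>\<theta> \<and> \<theta>\<close>. So \<open>\<nabla>' \<Theta>\<close> is antisymmetric. The weight of \<open>\<Theta>\<close> is precisely the one for which the
  symmetric part of \<open>\<nabla> \<Theta>\<close> is projectively invariant, so \<open>\<nabla> \<Theta>\<close> is antisymmetric too and its contraction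
  with the symmetric \<open>g\<close> is zero.\<close>

section \<open>Iterated differentiability\<close>

text \<open>Why the weight fits: in dimension 2l+1 the trace of the difference tensor is
  (2l+2)\<psi>, so a density of weight -1/(l+1) contributes -2 \<psi>_i \<Theta>_j to
  \<nabla>\<Theta>, while the 1-form contributes \<psi>_i \<Theta>_j + \<psi>_j \<Theta>_i; the sum
  \<psi>_j \<Theta>_i - \<psi>_i \<Theta>_j is antisymmetric. Four obstacles shape the proof. The
  projective class is given by curves and not by connections, so finding \<psi> requires a geodesic
  of \<open>g\<close> through each point in each direction; and a geodesic is tested in every chart,
  so the equation has to be carried across transition maps. Sectional curvature says nothing about
  degenerate planes, so the curvature tensor is recovered by a limit argument. \<Theta> is defined
  through arbitrary local contact forms and only up to sign, so it has to be compared near each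
  point with the Killing form. Finally \<open>vol\<close> is an iterated wedge product, that is, a
  sum over permutations; it is reduced to one alternating sum over slots in which every cancellation
  is a transposition of two slots.\<close>

lemma Ck_on_cong:
  assumes "open S" "Ck_on k S f" "\<And>x. x \<in> S \<Longrightarrow> f x = g x"
  shows "Ck_on k S g"
  using assms(2,3)
proof (induction k arbitrary: f g)
  case 0
  then show ?case by (metis Ck_on.simps(1) continuous_on_cong)
next
  case (Suc k)
  have d: "(g has_derivative frechet_derivative f (at x)) (at x)" if "x \<in> S" for x
  proof (rule has_derivative_transform_within_open[OF _ \<open>open S\<close> that])
    show "(f has_derivative frechet_derivative f (at x)) (at x)"
      using Suc.prems(1) that by (simp add: frechet_derivative_works[symmetric])
  qed (rule Suc.prems(2))
  have e: "frechet_derivative g (at x) = frechet_derivative f (at x)" if "x \<in> S" for x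
    using frechet_derivative_at[OF d[OF that]] by simp
  show ?case
  proof (simp, intro conjI ballI allI)
    show "g differentiable at x" if "x \<in> S" for x
      using d[OF that] unfolding differentiable_def by blast
    show "Ck_on k S (\<lambda>x. frechet_derivative g (at x) v)" for v
      by (rule Suc.IH[of "\<lambda>x. frechet_derivative f (at x) v"]) (use Suc.prems(1) in \<open>simp_all add: e\<close>)
  qed
qed

text \<open>Lets derivative rules be applied directly: the derivative may be any explicit
  \<open>f'\<close>, not literally \<open>frechet_derivative\<close>.\<close>

lemma Ck_on_SucI:
  assumes "open S" "\<And>x. x \<in> S \<Longrightarrow> (f has_derivative f' x) (at x)"
    and "\<And>v. Ck_on k S (\<lambda>x. f' x v)"
  shows "Ck_on (Suc k) S f"
proof (simp, intro conjI ballI allI)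
  show "f differentiable at x" if "x \<in> S" for x
    using assms(2)[OF that] unfolding differentiable_def by blast
  show "Ck_on k S (\<lambda>x. frechet_derivative f (at x) v)" for v
    by (rule Ck_on_cong[OF assms(1) assms(3)[of v]]) (simp add: frechet_derivative_at[OF assms(2), symmetric])
qed

lemma Ck_on_SucD:
  assumes "Ck_on (Suc k) S f" "x \<in> S"
  shows "(f has_derivative frechet_derivative f (at x)) (at x)"
  using assms by (simp add: frechet_derivative_works[symmetric])

lemma Ck_on_Suc_lower: "Ck_on (Suc k) S f \<Longrightarrow> Ck_on k S f"
proof (induction k arbitrary: f)
  case 0
  then show ?case
    by (simp add: continuous_at_imp_continuous_on differentiable_imp_continuous_within)
next
  case (Suc k)
  then show ?case by auto
qed

lemma Ck_on_subset: "Ck_on k S f \<Longrightarrow> T \<subseteq> S \<Longrightarrow> Ck_on k T f"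
  by (induction k arbitrary: f) (auto intro: continuous_on_subset)

lemma Ck_on_const: "Ck_on k S (\<lambda>x. c)"
  by (induction k arbitrary: c) auto

lemma Ck_on_add:
  assumes "open S" "Ck_on k S f" "Ck_on k S g"
  shows "Ck_on k S (\<lambda>x. f x + g x)"
  using assms(2,3)
proof (induction k arbitrary: f g)
  case 0
  then show ?case by (auto intro: continuous_intros)
next
  case (Suc k)
  show ?case
    by (rule Ck_on_SucI[OF \<open>open S\<close>
          has_derivative_add[OF Ck_on_SucD[OF Suc.prems(1)] Ck_on_SucD[OF Suc.prems(2)]]])
      (use Suc in auto)
qed

text \<open>Each summand of the product rule keeps one undifferentiated factor, whose order is
  lowered by \<open>Ck_on_Suc_lower\<close>; hence the induction runs over all pairs
  \<open>f\<close>, \<open>g\<close>.\<close>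

lemma Ck_on_bilinear:
  assumes "bounded_bilinear B" "open S" "Ck_on k S f" "Ck_on k S g"
  shows "Ck_on k S (\<lambda>x. B (f x) (g x))"
  using assms(3,4)
proof (induction k arbitrary: f g)
  case 0
  then show ?case using bounded_bilinear.continuous_on[OF assms(1)] by auto
next
  case (Suc k)
  show ?case
    by (rule Ck_on_SucI[OF \<open>open S\<close>
          bounded_bilinear.FDERIV[OF assms(1) Ck_on_SucD[OF Suc.prems(1)] Ck_on_SucD[OF Suc.prems(2)]]])
      (use Suc Ck_on_Suc_lower[OF Suc.prems(1)] Ck_on_Suc_lower[OF Suc.prems(2)]
        in \<open>auto intro!: Ck_on_add \<open>open S\<close>\<close>)
qed

lemma Ck_on_linear:
  assumes "bounded_linear L" "open S" "Ck_on k S f"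
  shows "Ck_on k S (\<lambda>x. L (f x))"
  using assms(3)
proof (induction k arbitrary: f)
  case 0
  then show ?case using bounded_linear.continuous_on[OF assms(1)] by auto
next
  case (Suc k)
  show ?case
    by (rule Ck_on_SucI[OF \<open>open S\<close> bounded_linear.has_derivative[OF assms(1) Ck_on_SucD[OF Suc.prems]]])
      (use Suc in auto)
qed

lemma Ck_on_sum:
  assumes "open S" "\<And>i. i \<in> I \<Longrightarrow> Ck_on k S (f i)"
  shows "Ck_on k S (\<lambda>x. \<Sum>i\<in>I. f i x)"
  using assms(2)
  by (induction I rule: infinite_finite_induct) (auto intro: Ck_on_const Ck_on_add assms(1))

lemma Ck_on_mult:
  fixes f g :: "'a::real_normed_vector \<Rightarrow> real"
  shows "open S \<Longrightarrow> Ck_on k S f \<Longrightarrow> Ck_on k S g \<Longrightarrow> Ck_on k S (\<lambda>x. f x * g x)"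
  by (rule Ck_on_bilinear[OF bounded_bilinear_mult])

lemma Ck_on_prod:
  fixes f :: "'i \<Rightarrow> 'a::real_normed_vector \<Rightarrow> real"
  assumes "open S" "\<And>i. i \<in> I \<Longrightarrow> Ck_on k S (f i)"
  shows "Ck_on k S (\<lambda>x. \<Prod>i\<in>I. f i x)"
  using assms(2)
  by (induction I rule: infinite_finite_induct) (auto intro: Ck_on_const Ck_on_mult assms(1))

lemma Ck_on_minus:
  assumes "open S" "Ck_on k S f" "Ck_on k S g"
  shows "Ck_on k S (\<lambda>x. f x - g x)"
  using Ck_on_add[OF assms(1,2) Ck_on_linear[OF bounded_linear_minus[OF bounded_linear_ident] assms(1,3)]]
  by simp

text \<open>The derivative of 1/f is expressed by 1/f itself, so the induction hypothesis is applied
  to the same function at the lower order.\<close>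

lemma Ck_on_inverse:
  fixes f :: "'a::real_normed_vector \<Rightarrow> real"
  assumes "open S" "Ck_on k S f" "\<And>x. x \<in> S \<Longrightarrow> f x \<noteq> 0"
  shows "Ck_on k S (\<lambda>x. inverse (f x))"
  using assms(2)
proof (induction k)
  case 0
  then show ?case using assms(3) by (auto intro!: continuous_intros)
next
  case (Suc k)
  have "Ck_on k S (\<lambda>x. inverse (f x))"
    using Suc Ck_on_Suc_lower by blast
  then have "Ck_on k S (\<lambda>x. - (inverse (f x) * frechet_derivative f (at x) v * inverse (f x)))" for v
    using Suc.prems
    by (intro Ck_on_linear[OF bounded_linear_minus[OF bounded_linear_ident]] Ck_on_mult) (auto simp: assms)
  then show ?case
    by (intro Ck_on_SucI[OF \<open>open S\<close> Deriv.has_derivative_inverse[OF _ Ck_on_SucD[OF Suc.prems]]])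
      (auto simp: assms)
qed

lemma Ck_on_vec:
  fixes f :: "'a::real_normed_vector \<Rightarrow> real^'n::finite"
  assumes "open S"
  shows "Ck_on k S f \<longleftrightarrow> (\<forall>i. Ck_on k S (\<lambda>x. f x $ i))"
proof
  assume "Ck_on k S f"
  then show "\<forall>i. Ck_on k S (\<lambda>x. f x $ i)"
    by (auto intro: Ck_on_linear[OF bounded_linear_vec_nth assms])
next
  assume *: "\<forall>i. Ck_on k S (\<lambda>x. f x $ i)"
  have "Ck_on k S (\<lambda>x. \<Sum>i\<in>UNIV. f x $ i *\<^sub>R axis i (1::real))"
    by (intro Ck_on_sum assms Ck_on_bilinear[OF bounded_bilinear_scaleR] *[rule_format] Ck_on_const)
  then show "Ck_on k S f"
    by (rule Ck_on_cong[OF assms])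
      (metis (no_types, lifting) basis_expansion scalar_mult_eq_scaleR sum.cong)
qed

lemma Ck_on_compose:
  fixes y :: "'a::real_normed_vector \<Rightarrow> 'b::euclidean_space"
  assumes "open S" "open T" "Ck_on k T y" "Ck_on k S f" "\<And>t. t \<in> T \<Longrightarrow> y t \<in> S"
  shows "Ck_on k T (\<lambda>t. f (y t))"
  using assms(3,4)
proof (induction k arbitrary: f)
  case 0
  then show ?case using assms(5) by (auto intro: continuous_on_compose2)
next
  case (Suc k)
  have d: "((\<lambda>t. f (y t)) has_derivative
      (\<lambda>v. frechet_derivative f (at (y t)) (frechet_derivative y (at t) v))) (at t)" if "t \<in> T" for t
    using diff_chain_at[OF Ck_on_SucD[OF Suc.prems(1) that] Ck_on_SucD[OF Suc.prems(2) assms(5)[OF that]]]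
    by (simp add: o_def)
  \<comment> \<open>The direction \<open>frechet_derivative y (at t) v\<close> moves with
    \<open>t\<close>, while \<open>Ck_on\<close> controls fixed directions; expanding it in
    \<open>Basis\<close> separates the two.\<close>
  have eq: "frechet_derivative f (at (y t)) (frechet_derivative y (at t) v) =
      (\<Sum>b\<in>Basis. (frechet_derivative y (at t) v \<bullet> b) *\<^sub>R frechet_derivative f (at (y t)) b)"
    if "t \<in> T" for t v
  proof -
    have lin: "linear (frechet_derivative f (at (y t)))"
      using Ck_on_SucD[OF Suc.prems(2) assms(5)[OF that]] by (rule has_derivative_linear)
    show ?thesis
      by (subst (1) euclidean_representation[symmetric])
        (simp only: linear_sum[OF lin] linear_scale[OF lin])
  qed
  have "Ck_on k T (\<lambda>t. \<Sum>b\<in>Basis. (frechet_derivative y (at t) v \<bullet> b) *\<^sub>R frechet_derivative f (at (y t)) b)" for v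
    using Suc.prems Ck_on_Suc_lower[OF Suc.prems(1)]
    by (intro Ck_on_sum assms Ck_on_bilinear[OF bounded_bilinear_scaleR] Suc.IH
          Ck_on_linear[OF bounded_linear_inner_left]) auto
  then have "Ck_on k T (\<lambda>t. frechet_derivative f (at (y t)) (frechet_derivative y (at t) v))" for v
    by (rule Ck_on_cong[OF \<open>open T\<close> _ eq[symmetric]])
  with d show ?case
    by (rule Ck_on_SucI[OF \<open>open T\<close>])
qed

section \<open>Smooth dependence of determinants and inverse matrices\<close>

lemma Ck_on_det:
  fixes A :: "'a::real_normed_vector \<Rightarrow> real^'n^'n::finite"
  assumes "open S" "\<And>i j. Ck_on k S (\<lambda>x. A x $ i $ j)"
  shows "Ck_on k S (\<lambda>x. det (A x))"
  unfolding det_def by (intro Ck_on_sum Ck_on_mult Ck_on_prod Ck_on_const assms)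

lemma
  fixes A :: "'a::semiring_1^'n^'m"
  assumes "invertible A"
  shows matrix_mul_matrix_inv: "A ** matrix_inv A = mat 1"
    and matrix_inv_mul_matrix: "matrix_inv A ** A = mat 1"
  using someI_ex[OF assms[unfolded invertible_def]] by (simp_all add: matrix_inv_def)

text \<open>Cramer's rule for column \<open>j\<close> of the inverse; it reduces smoothness of the
  inverse to smoothness of determinants.\<close>

lemma matrix_inv_nth_det:
  fixes A :: "real^'n^'n::finite"
  assumes "invertible A"
  shows "matrix_inv A $ i $ j =
    det (\<chi> p q. if q = i then axis j 1 $ p else A $ p $ q) * inverse (det A)"
proof -
  have "A *v (matrix_inv A *v axis j 1) = axis j 1"
    using matrix_mul_matrix_inv[OF assms] by (simp add: matrix_vector_mul_assoc)
  then have "matrix_inv A *v axis j 1 = (\<chi> k. det (\<chi> p q. if q = k then axis j 1 $ p else A $ p $ q) / det A)"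
    using cramer[of A "matrix_inv A *v axis j 1" "axis j 1"] assms by (simp add: invertible_det_nz)
  then show ?thesis
    by (metis (no_types, lifting) column_def divide_inverse matrix_vector_mult_basis vec_lambda_beta)
qed

lemma Ck_on_matrix_inv:
  fixes A :: "'a::real_normed_vector \<Rightarrow> real^'n^'n::finite"
  assumes "open S" "\<And>i j. Ck_on k S (\<lambda>x. A x $ i $ j)" "\<And>x. x \<in> S \<Longrightarrow> invertible (A x)"
  shows "Ck_on k S (\<lambda>x. matrix_inv (A x) $ i $ j)"
proof -
  have "Ck_on k S (\<lambda>x. det (\<chi> p q. if q = i then axis j 1 $ p else A x $ p $ q) * inverse (det (A x)))"
  proof (intro Ck_on_mult Ck_on_det Ck_on_inverse assms)
    show "Ck_on k S (\<lambda>x. (\<chi> p q. if q = i then axis j 1 $ p else A x $ p $ q) $ p $ q)" for p q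
      by (cases "q = i") (simp_all add: Ck_on_const assms)
    show "det (A x) \<noteq> 0" if "x \<in> S" for x
      using assms(3)[OF that] by (simp add: invertible_det_nz)
  qed
  then show ?thesis
    by (rule Ck_on_cong[OF assms(1)]) (simp add: matrix_inv_nth_det assms(3))
qed

section \<open>Symmetry of second derivatives\<close>

lemma mixed_difference_mvt:
  fixes f :: "'a::real_normed_vector \<Rightarrow> real"
  assumes "t > 0"
    and f: "\<And>y. y \<in> S \<Longrightarrow> (f has_derivative f' y) (at y)"
    and f': "\<And>y. y \<in> S \<Longrightarrow> ((\<lambda>y. f' y u) has_derivative f'' y) (at y)"
    and S: "\<And>a b. 0 \<le> a \<Longrightarrow> a \<le> t \<Longrightarrow> 0 \<le> b \<Longrightarrow> b \<le> t \<Longrightarrow> x + a *\<^sub>R u + b *\<^sub>R v \<in> S"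
  shows "\<exists>a b. 0 \<le> a \<and> a \<le> t \<and> 0 \<le> b \<and> b \<le> t \<and>
    f (x + t *\<^sub>R u + t *\<^sub>R v) - f (x + t *\<^sub>R u) - f (x + t *\<^sub>R v) + f x =
    t * t * f'' (x + a *\<^sub>R u + b *\<^sub>R v) v"
proof -
  have path: "((\<lambda>r. h (z + r *\<^sub>R w)) has_real_derivative h' (z + r *\<^sub>R w) w) (at r)"
    if "(h has_derivative h' (z + r *\<^sub>R w)) (at (z + r *\<^sub>R w))" for h :: "'a \<Rightarrow> real" and h' z w r
  proof -
    have "((\<lambda>r. h (z + r *\<^sub>R w)) has_derivative (\<lambda>d. h' (z + r *\<^sub>R w) (d *\<^sub>R w))) (at r)"
      by (rule has_derivative_compose[where g = h and f = "\<lambda>r. z + r *\<^sub>R w", OF _ that])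
        (auto intro!: derivative_eq_intros)
    moreover have "(\<lambda>d. h' (z + r *\<^sub>R w) (d *\<^sub>R w)) = (*) (h' (z + r *\<^sub>R w) w)"
      by (rule ext) (simp add: linear_scale[OF has_derivative_linear[OF that]])
    ultimately show ?thesis
      by (simp add: has_field_derivative_def)
  qed
  \<comment> \<open>\<open>\<phi>\<close> is the difference across the parallelogram in direction
    \<open>v\<close>, run along \<open>u\<close>. The mean value theorem is applied to it first,
    then to the derivative along \<open>u\<close> in direction \<open>v\<close>.\<close>
  define \<phi> where "\<phi> r = f (x + t *\<^sub>R v + r *\<^sub>R u) - f (x + r *\<^sub>R u)" for r
  define \<phi>' where "\<phi>' r = f' (x + t *\<^sub>R v + r *\<^sub>R u) u - f' (x + r *\<^sub>R u) u" for r
  have S': "x + t *\<^sub>R v + r *\<^sub>R u \<in> S" "x + r *\<^sub>R u \<in> S" if "0 \<le> r" "r \<le> t" for r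
    using S[of r t] S[of r 0] that \<open>t > 0\<close> by (simp_all add: algebra_simps)
  have "(\<phi> has_real_derivative \<phi>' r) (at r)" if "0 \<le> r" "r \<le> t" for r
    unfolding \<phi>_def \<phi>'_def using S'[OF that] by (intro DERIV_diff path f) auto
  then have "\<exists>a. 0 < a \<and> a < t \<and> \<phi> t - \<phi> 0 = (t - 0) * \<phi>' a"
    by (intro MVT2[OF \<open>t > 0\<close>])
  then obtain a where a: "0 < a" "a < t" "\<phi> t - \<phi> 0 = (t - 0) * \<phi>' a"
    by blast
  have "((\<lambda>r. f' (x + a *\<^sub>R u + r *\<^sub>R v) u) has_real_derivative f'' (x + a *\<^sub>R u + r *\<^sub>R v) v) (at r)"
    if "0 \<le> r" "r \<le> t" for r
    by (rule path[of "\<lambda>y. f' y u"]) (use f' S a that in auto)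
  then have "\<exists>b. 0 < b \<and> b < t \<and>
    f' (x + a *\<^sub>R u + t *\<^sub>R v) u - f' (x + a *\<^sub>R u + 0 *\<^sub>R v) u = (t - 0) * f'' (x + a *\<^sub>R u + b *\<^sub>R v) v"
    by (intro MVT2[OF \<open>t > 0\<close>])
  then obtain b where b: "0 < b" "b < t"
    "f' (x + a *\<^sub>R u + t *\<^sub>R v) u - f' (x + a *\<^sub>R u + 0 *\<^sub>R v) u = (t - 0) * f'' (x + a *\<^sub>R u + b *\<^sub>R v) v"
    by blast
  have "\<phi> t - \<phi> 0 = t * (t * f'' (x + a *\<^sub>R u + b *\<^sub>R v) v)"
    using a(3) b(3) by (simp add: \<phi>'_def algebra_simps)
  then show ?thesis
    using a b by (intro exI[of _ a] exI[of _ b]) (simp add: \<phi>_def algebra_simps)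
qed

text \<open>The second difference over a small parallelogram is symmetric in \<open>u\<close> and
  \<open>v\<close>. Divided by \<open>t * t\<close> it is a value of either mixed derivative near
  \<open>x\<close>, and both are continuous.\<close>

lemma second_derivative_symmetric:
  fixes f :: "'a::real_normed_vector \<Rightarrow> real"
  assumes "open S" "x \<in> S" "Ck_on 2 S f"
  shows "frechet_derivative (\<lambda>y. frechet_derivative f (at y) u) (at x) v =
    frechet_derivative (\<lambda>y. frechet_derivative f (at y) v) (at x) u" (is "?L x = ?R x")
proof -
  let ?D = "\<lambda>u y. frechet_derivative f (at y) u"
  let ?DD = "\<lambda>u v y. frechet_derivative (?D u) (at y) v"
  have C: "Ck_on (Suc (Suc 0)) S f"
    using assms(3) by (simp add: numeral_2_eq_2)
  have f: "(f has_derivative (\<lambda>u. ?D u y)) (at y)" if "y \<in> S" for y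
    using Ck_on_SucD[OF C that] by simp
  have C1: "Ck_on (Suc 0) S (?D u)" for u
    using C by auto
  have f': "(?D u has_derivative (\<lambda>v. ?DD u v y)) (at y)" if "y \<in> S" for u y
    using Ck_on_SucD[OF C1 that] by simp
  have cont: "continuous_on S (?DD u v)" for u v
    using C1[of u] by auto
  have lim: "\<exists>\<delta>>0. \<forall>y. dist y x < \<delta> \<longrightarrow> y \<in> S \<and> \<bar>?DD u v y - ?DD u v x\<bar> < e" if "e > 0" for e u v
  proof -
    have "isCont (?DD u v) x"
      using cont[of u v] assms(1,2) by (simp add: continuous_on_eq_continuous_at)
    then obtain d1 where d1: "d1 > 0" "\<forall>y. dist y x < d1 \<longrightarrow> dist (?DD u v y) (?DD u v x) < e"
      using \<open>e > 0\<close> unfolding continuous_within_eps_delta by blast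
    obtain d2 where d2: "d2 > 0" "\<forall>y. dist y x < d2 \<longrightarrow> y \<in> S"
      using assms(1,2) unfolding open_dist by blast
    show ?thesis
      using d1 d2 by (intro exI[of _ "min d1 d2"]) (simp add: dist_real_def)
  qed
  have "\<bar>?DD u v x - ?DD v u x\<bar> < 2 * e" if "e > 0" for e
  proof -
    obtain \<delta>1 where d1: "\<delta>1 > 0" "\<And>y. dist y x < \<delta>1 \<Longrightarrow> y \<in> S \<and> \<bar>?DD u v y - ?DD u v x\<bar> < e"
      using lim[OF \<open>e > 0\<close>] by blast
    obtain \<delta>2 where d2: "\<delta>2 > 0" "\<And>y. dist y x < \<delta>2 \<Longrightarrow> y \<in> S \<and> \<bar>?DD v u y - ?DD v u x\<bar> < e"
      using lim[OF \<open>e > 0\<close>] by blast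
    define \<delta> where "\<delta> = min \<delta>1 \<delta>2"
    \<comment> \<open>The summand 1 keeps \<open>K\<close> positive when \<open>u\<close> and
      \<open>v\<close> vanish; \<open>t\<close> is then small enough for the parallelogram to stay
      within \<open>\<delta>\<close> of \<open>x\<close>.\<close>
    define K where "K = norm u + norm v + 1"
    define t where "t = \<delta> / 2 / K"
    have pos: "K > 0"
      unfolding K_def by (smt (verit) norm_ge_zero)
    have dpos: "\<delta> > 0" using d1(1) d2(1) by (simp add: \<delta>_def)
    have t: "t > 0" using d1 d2 pos by (auto simp: t_def \<delta>_def)
    have tb: "t * (norm u + norm v) < \<delta>"
    proof -
      have "t * (norm u + norm v) \<le> t * K"
        using t by (intro mult_left_mono) (auto simp: K_def)
      also have "\<dots> = \<delta> / 2" using pos by (simp add: t_def)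
      also have "\<dots> < \<delta>" using dpos by simp
      finally show ?thesis .
    qed
    have near: "dist (x + a *\<^sub>R p + b *\<^sub>R q) x < \<delta>"
      if "0 \<le> a" "a \<le> t" "0 \<le> b" "b \<le> t" "norm p + norm q = norm u + norm v" for a b p q
    proof -
      have "dist (x + a *\<^sub>R p + b *\<^sub>R q) x \<le> norm (a *\<^sub>R p) + norm (b *\<^sub>R q)"
        using norm_triangle_ineq[of "a *\<^sub>R p" "b *\<^sub>R q"] by (simp add: dist_norm)
      also have "\<dots> \<le> t * norm p + t * norm q"
        using that by (intro add_mono) (auto intro: mult_right_mono)
      also have "\<dots> = t * (norm u + norm v)"
        by (simp only: that(5)[symmetric] distrib_left)
      finally show ?thesis using tb by simp
    qed
    have inS: "x + a *\<^sub>R p + b *\<^sub>R q \<in> S"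
      if "0 \<le> a" "a \<le> t" "0 \<le> b" "b \<le> t" "norm p + norm q = norm u + norm v" for a b p q
      using d1(2) near[OF that] by (simp add: \<delta>_def)
    obtain a b where ab: "0 \<le> a" "a \<le> t" "0 \<le> b" "b \<le> t"
      "f (x + t *\<^sub>R u + t *\<^sub>R v) - f (x + t *\<^sub>R u) - f (x + t *\<^sub>R v) + f x =
       t * t * ?DD u v (x + a *\<^sub>R u + b *\<^sub>R v)"
      using mixed_difference_mvt[OF t, of S f "\<lambda>y u. ?D u y" u "\<lambda>y v. ?DD u v y" x v] f f' inS
      by (auto simp: simp del: frechet_derivative_works)
    obtain c d where cd: "0 \<le> c" "c \<le> t" "0 \<le> d" "d \<le> t"
      "f (x + t *\<^sub>R v + t *\<^sub>R u) - f (x + t *\<^sub>R v) - f (x + t *\<^sub>R u) + f x =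
       t * t * ?DD v u (x + c *\<^sub>R v + d *\<^sub>R u)"
      using mixed_difference_mvt[OF t, of S f "\<lambda>y u. ?D u y" v "\<lambda>y v'. ?DD v v' y" x u] f f' inS
      by (auto simp: add.commute)
    have "t * t * ?DD u v (x + a *\<^sub>R u + b *\<^sub>R v) = t * t * ?DD v u (x + c *\<^sub>R v + d *\<^sub>R u)"
      using ab(5) cd(5) by (simp add: algebra_simps)
    then have "?DD u v (x + a *\<^sub>R u + b *\<^sub>R v) = ?DD v u (x + c *\<^sub>R v + d *\<^sub>R u)"
      using t by simp
    moreover have "\<bar>?DD u v (x + a *\<^sub>R u + b *\<^sub>R v) - ?DD u v x\<bar> < e"
      using d1(2) near[OF ab(1-4)] by (simp add: \<delta>_def)
    moreover have "\<bar>?DD v u (x + c *\<^sub>R v + d *\<^sub>R u) - ?DD v u x\<bar> < e"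
      using d2(2) near[OF cd(1-4)] by (simp add: \<delta>_def add.commute)
    ultimately show ?thesis by linarith
  qed
  \<comment> \<open>If the two sides differed, half their distance as \<open>e\<close> would give a
    number smaller than itself.\<close>
  from this[of "\<bar>?DD u v x - ?DD v u x\<bar> / 2"] show ?thesis by fastforce
qed

section \<open>Local solutions of ordinary differential equations\<close>

lemma Ck_on_ident: "Ck_on k S (\<lambda>x. x)"
  by (cases k) (auto simp: Ck_on_const)

lemma Ck_on_Pair:
  assumes "open S" "Ck_on k S f" "Ck_on k S g"
  shows "Ck_on k S (\<lambda>x. (f x, g x))"
proof -
  have "Ck_on k S (\<lambda>x. (f x, 0) + (0, g x))"
    by (intro Ck_on_add assms(1) Ck_on_linear[OF bounded_linear_Pair[OF bounded_linear_ident bounded_linear_zero] assms(1,2)]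
          Ck_on_linear[OF bounded_linear_Pair[OF bounded_linear_zero bounded_linear_ident] assms(1,3)])
  then show ?thesis by simp
qed

text \<open>By compactness the derivative along each basis vector is bounded on the ball; the sum of
  these bounds dominates the operator norm, and convexity of the ball permits the mean value
  inequality.\<close>

lemma Ck_on_1_lipschitz_cball:
  fixes f :: "'a::euclidean_space \<Rightarrow> 'b::real_normed_vector"
  assumes "Ck_on 1 U f" "cball y r \<subseteq> U"
  shows "\<exists>L\<ge>0. \<forall>p\<in>cball y r. \<forall>q\<in>cball y r. norm (f p - f q) \<le> L * norm (p - q)"
proof -
  let ?D = "\<lambda>x. frechet_derivative f (at x)"
  have C: "Ck_on (Suc 0) U f" using assms(1) by simp
  have "\<exists>M. \<forall>x\<in>cball y r. norm (?D x b) \<le> M" for b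
  proof -
    have "continuous_on (cball y r) (\<lambda>x. ?D x b)"
      using C assms(2) by (auto intro: continuous_on_subset)
    then have "bounded ((\<lambda>x. ?D x b) ` cball y r)"
      by (intro compact_imp_bounded compact_continuous_image compact_cball)
    then show ?thesis by (auto simp: bounded_iff)
  qed
  then obtain M where M: "\<And>b x. x \<in> cball y r \<Longrightarrow> norm (?D x b) \<le> M b"
    by metis
  define L where "L = (\<Sum>b\<in>Basis. \<bar>M b\<bar>)"
  have L: "L \<ge> 0" unfolding L_def by (intro sum_nonneg) simp
  have on: "onorm (?D x) \<le> L" if x: "x \<in> cball y r" for x
  proof (rule onorm_bound[OF L])
    fix h
    have lin: "linear (?D x)"
      using Ck_on_SucD[OF C, of x] x assms(2) has_derivative_linear by blast
    have "norm (?D x h) = norm (\<Sum>b\<in>Basis. (h \<bullet> b) *\<^sub>R ?D x b)"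
      by (subst (1) euclidean_representation[of h, symmetric]) (simp only: linear_sum[OF lin] linear_scale[OF lin])
    also have "\<dots> \<le> (\<Sum>b\<in>Basis. norm h * \<bar>M b\<bar>)"
    proof (rule sum_norm_le)
      fix b :: 'a assume "b \<in> Basis"
      then have "\<bar>h \<bullet> b\<bar> \<le> norm h" by (rule Basis_le_norm)
      moreover have "norm (?D x b) \<le> \<bar>M b\<bar>" using M[OF x, of b] by linarith
      ultimately show "norm ((h \<bullet> b) *\<^sub>R ?D x b) \<le> norm h * \<bar>M b\<bar>"
        by (simp add: mult_mono)
    qed
    also have "\<dots> = L * norm h" by (simp add: L_def sum_distrib_left[symmetric])
    finally show "norm (?D x h) \<le> L * norm h" .
  qed
  have "norm (f p - f q) \<le> L * norm (p - q)" if "p \<in> cball y r" "q \<in> cball y r" for p q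
  proof (rule differentiable_bound[OF convex_cball _ on that])
    fix x assume "x \<in> cball y r"
    then have "x \<in> U" using assms(2) by blast
    then show "(f has_derivative ?D x) (at x within cball y r)"
      by (rule has_derivative_at_withinI[OF Ck_on_SucD[OF C]])
  qed
  then show ?thesis using L by blast
qed

text \<open>The Picard map is a contraction with factor 3/4 of the complete space of bounded
  continuous functions on the real line.\<close>

lemma integral_curve_exists_lipschitz:
  fixes F :: "'a::euclidean_space \<Rightarrow> 'a"
  assumes L: "L \<ge> 0" "\<And>p q. norm (F p - F q) \<le> L * norm (p - q)"
    and M: "M \<ge> 0" "\<And>p. norm (F p) \<le> M"
    and \<tau>: "\<tau> > 0" "4 * (\<tau> * L) \<le> 1"
  shows "\<exists>y. y 0 = y0 \<and> (\<forall>t\<in>{-\<tau><..<\<tau>}. (y has_vector_derivative F (y t)) (at t) \<and>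
    norm (y t - y0) \<le> 3 * (M * \<tau>))"
proof -
  \<comment> \<open>Clamping time to [-\<tau>, \<tau>] makes the Picard map act on functions on all
    of the reals, the domain of \<open>bcontfun\<close>.\<close>
  define c where "c t = max (-\<tau>) (min \<tau> t)" for t
  have c: "c t \<in> {-\<tau>..\<tau>}" for t using \<tau> by (auto simp: c_def)
  have contF: "continuous_on S F" for S
  proof (rule continuous_on_subset[of UNIV])
    show "continuous_on UNIV F"
      by (rule lipschitz_on_continuous_on[of L])
        (use L in \<open>auto simp: lipschitz_on_def dist_norm\<close>)
  qed simp
  \<comment> \<open>Integrating from -\<tau> and subtracting the value at 0 replaces an oriented
    integral from 0, whose sign would depend on that of \<open>t\<close>.\<close>
  define I where "I h t = integral {-\<tau>..t} h" for h :: "real \<Rightarrow> 'a" and t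
  \<comment> \<open>3 = 2 + 1: an interval of length at most 2\<tau> up to \<open>c t\<close>, and
    one of length \<tau> up to 0. With \<open>4 * (\<tau> * L) \<le> 1\<close> this yields the
    contraction factor 3/4.\<close>
  have I_bound: "norm (I h (c t) - I h 0) \<le> 3 * (B * \<tau>)"
    if "continuous_on UNIV h" "\<And>s. norm (h s) \<le> B" for h B t
  proof -
    have B: "0 \<le> B" using that(2)[of 0] norm_ge_zero order_trans by blast
    have b: "norm (I h s) \<le> B * (s + \<tau>)" if "-\<tau> \<le> s" for s
      unfolding I_def using integral_bound[of "-\<tau>" s h B] \<open>continuous_on UNIV h\<close> that \<open>\<And>s. norm (h s) \<le> B\<close>
      by (auto intro: continuous_on_subset)
    have "norm (I h (c t)) \<le> B * (2 * \<tau>)"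
      using b[of "c t"] c[of t] B mult_left_mono[of "c t + \<tau>" "2 * \<tau>" B] by auto
    moreover have "norm (I h 0) \<le> B * \<tau>"
      using b[of 0] \<tau> by simp
    ultimately show ?thesis
      using norm_triangle_ineq4[of "I h (c t)" "I h 0"] by linarith
  qed
  define T where "T u t = y0 + (I (\<lambda>s. F (apply_bcontfun u s)) (c t) - I (\<lambda>s. F (apply_bcontfun u s)) 0)" for u t
  have contFu: "continuous_on S (\<lambda>s. F (apply_bcontfun u s))" for S :: "real set" and u
    by (rule continuous_on_compose2[OF contF[of UNIV]]) (auto intro: continuous_intros)
  have contT: "continuous_on UNIV (T u)" for u
  proof -
    have "continuous_on {-\<tau>..\<tau>} (I (\<lambda>s. F (apply_bcontfun u s)))"
      unfolding I_def by (intro indefinite_integral_continuous_1 integrable_continuous_real contFu)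
    moreover have "continuous_on UNIV c"
      unfolding c_def by (intro continuous_intros)
    ultimately have "continuous_on UNIV (\<lambda>t. I (\<lambda>s. F (apply_bcontfun u s)) (c t))"
      by (rule continuous_on_compose2) (use c in auto)
    then show ?thesis unfolding T_def by (intro continuous_intros)
  qed
  have "T u \<in> bcontfun" for u
  proof (rule bcontfun_normI[OF contT])
    fix t
    show "norm (T u t) \<le> norm y0 + 3 * (M * \<tau>)"
      using I_bound[OF contFu[of UNIV u] M(2), of t] norm_triangle_ineq[of y0] unfolding T_def
      by (meson add_left_mono order_trans)
  qed
  then have T: "apply_bcontfun (Bcontfun (T u)) = T u" for u
    by (rule Bcontfun_inverse)
  have "dist (Bcontfun (T u)) (Bcontfun (T v)) \<le> (3/4) * dist u v" for u v
  proof (rule dist_bound)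
    fix t
    let ?h = "\<lambda>s. F (apply_bcontfun u s) - F (apply_bcontfun v s)"
    have "norm (?h s) \<le> L * dist u v" for s
    proof -
      have "norm (?h s) \<le> L * norm (apply_bcontfun u s - apply_bcontfun v s)"
        by (rule L)
      also have "\<dots> \<le> L * dist u v"
        using dist_bounded[of u s v] L by (intro mult_left_mono) (auto simp: dist_norm)
      finally show ?thesis .
    qed
    then have "norm (I ?h (c t) - I ?h 0) \<le> 3 * (L * dist u v * \<tau>)"
      by (intro I_bound) (auto intro!: continuous_intros contFu)
    also have "\<dots> = (3 / 4) * ((4 * (\<tau> * L)) * dist u v)" by (simp add: mult_ac)
    also have "\<dots> \<le> (3 / 4) * (1 * dist u v)"
      using \<tau> by (intro mult_left_mono mult_right_mono) auto
    finally have "norm (I ?h (c t) - I ?h 0) \<le> (3/4) * dist u v" by simp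
    moreover have "I ?h s = I (\<lambda>s. F (apply_bcontfun u s)) s - I (\<lambda>s. F (apply_bcontfun v s)) s" for s
      unfolding I_def by (intro integral_diff integrable_continuous_real contFu)
    ultimately show "dist (apply_bcontfun (Bcontfun (T u)) t) (apply_bcontfun (Bcontfun (T v)) t) \<le> (3/4) * dist u v"
      unfolding T by (simp add: T_def dist_norm algebra_simps)
  qed
  then have "\<exists>!u. Bcontfun (T u) = u"
    by (intro banach_fix_type[of "3/4"]) auto
  then obtain u where "Bcontfun (T u) = u" by blast
  with T[of u] have u: "apply_bcontfun u = T u" by simp
  let ?y = "apply_bcontfun u"
  let ?I = "I (\<lambda>s. F (?y s))"
  have y: "?y t = y0 + (?I (c t) - ?I 0)" for t
    using fun_cong[OF u, of t] unfolding T_def .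
  have "(?y has_vector_derivative F (?y t)) (at t)" if t: "t \<in> {-\<tau><..<\<tau>}" for t
  proof -
    have "(?I has_vector_derivative F (?y t)) (at t within {-\<tau>..\<tau>})"
      unfolding I_def using t by (intro integral_has_vector_derivative contFu) auto
    moreover have "at t within {-\<tau>..\<tau>} = at t"
      using t by (intro at_within_Icc_at) auto
    ultimately have "((\<lambda>s. (y0 - ?I 0) + ?I s) has_vector_derivative 0 + F (?y t)) (at t)"
      by (intro has_vector_derivative_add has_vector_derivative_const) (simp only:)
    then have "((\<lambda>s. (y0 - ?I 0) + ?I s) has_vector_derivative F (?y t)) (at t)"
      by (simp only: add_0_left)
    then show ?thesis
    proof (rule has_vector_derivative_transform_within_open[OF _ open_greaterThanLessThan t])
      fix s assume "s \<in> {-\<tau><..<\<tau>}"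
      then have "c s = s" by (simp add: c_def)
      then show "(y0 - ?I 0) + ?I s = ?y s"
        using y[of s] by (simp only:) (simp add: algebra_simps)
    qed
  qed
  moreover have "norm (?y t - y0) \<le> 3 * (M * \<tau>)" for t
    using I_bound[OF contFu[of UNIV u] M(2), of t] unfolding y[of t] by (simp only: add_diff_cancel_left')
  moreover have "?y 0 = y0"
  proof -
    have "c 0 = 0" using \<tau> by (simp add: c_def)
    then show ?thesis using y[of 0] by (simp only:) simp
  qed
  ultimately show ?thesis by blast
qed

text \<open>The Lipschitz bound for \<open>f\<close> holds on a closed ball; composing with the
  nearest-point projection extends it to a globally Lipschitz \<open>F\<close>. For short times the
  solution stays in the ball, where \<open>F\<close> equals \<open>f\<close>.\<close>

lemma integral_curve_exists:
  fixes f :: "'a::euclidean_space \<Rightarrow> 'a"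
  assumes "open U" "y0 \<in> U" "Ck_on 1 U f"
  shows "\<exists>\<tau>>0. \<exists>y. y 0 = y0 \<and>
    (\<forall>t\<in>{-\<tau><..<\<tau>}. y t \<in> U \<and> (y has_vector_derivative f (y t)) (at t))"
proof -
  obtain r where r: "r > 0" "cball y0 r \<subseteq> U"
    using assms(1,2) open_contains_cball by blast
  obtain L where L: "L \<ge> 0" "\<And>p q. p \<in> cball y0 r \<Longrightarrow> q \<in> cball y0 r \<Longrightarrow> norm (f p - f q) \<le> L * norm (p - q)"
    using Ck_on_1_lipschitz_cball[OF assms(3) r(2)] by blast
  define F where "F p = f (closest_point (cball y0 r) p)" for p
  have ne: "cball y0 r \<noteq> {}" using r by auto
  have cp: "closest_point (cball y0 r) p \<in> cball y0 r" for p
    by (rule closest_point_in_set[OF closed_cball ne])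
  have LF: "norm (F p - F q) \<le> L * norm (p - q)" for p q
  proof -
    have "norm (F p - F q) \<le> L * dist (closest_point (cball y0 r) p) (closest_point (cball y0 r) q)"
      unfolding F_def using L(2)[OF cp cp] by (simp add: dist_norm)
    also have "\<dots> \<le> L * dist p q"
      by (rule mult_left_mono[OF closest_point_lipschitz[OF convex_cball closed_cball ne] L(1)])
    finally show ?thesis by (simp add: dist_norm)
  qed
  define M where "M = norm (f y0) + L * r"
  have M: "M \<ge> 0" using L r by (simp add: M_def)
  have MF: "norm (F p) \<le> M" for p
  proof -
    let ?q = "closest_point (cball y0 r) p"
    have "norm (f ?q - f y0) \<le> L * norm (?q - y0)"
      using r by (intro L(2) cp) auto
    also have "\<dots> \<le> L * r"
      using cp[of p] L by (intro mult_left_mono) (auto simp: dist_norm norm_minus_commute)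
    finally show ?thesis
      using norm_triangle_sub[of "f ?q" "f y0"] by (simp add: F_def M_def)
  qed
  \<comment> \<open>The first bound makes the Picard map contract, the second keeps the solution
    within distance \<open>r\<close> of \<open>y0\<close>; the added 1 keeps both denominators
    positive.\<close>
  define \<tau> where "\<tau> = min (1 / (4 * (L + 1))) (r / (3 * (M + 1)))"
  have \<tau>: "\<tau> > 0" using r L M by (simp add: \<tau>_def)
  have "4 * (\<tau> * L) \<le> 4 * ((1 / (4 * (L + 1))) * (L + 1))"
    using L \<tau> by (intro mult_left_mono mult_mono) (auto simp: \<tau>_def)
  then have \<tau>L: "4 * (\<tau> * L) \<le> 1" using L by (simp add: field_simps)
  have "3 * (M * \<tau>) \<le> 3 * ((M + 1) * (r / (3 * (M + 1))))"
    using M \<tau> r by (intro mult_left_mono mult_mono) (auto simp: \<tau>_def)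
  also have "\<dots> = r"
  proof -
    have "3 * (K * (r / (3 * K))) = r" if "K > 0" for K :: real using that by simp
    from this[of "M + 1"] show ?thesis using M by simp
  qed
  finally have \<tau>M: "3 * (M * \<tau>) \<le> r" .
  obtain y where y: "y 0 = y0" "\<And>t. t \<in> {-\<tau><..<\<tau>} \<Longrightarrow> (y has_vector_derivative F (y t)) (at t)"
    "\<And>t. t \<in> {-\<tau><..<\<tau>} \<Longrightarrow> norm (y t - y0) \<le> 3 * (M * \<tau>)"
    using integral_curve_exists_lipschitz[OF L(1) LF M MF \<tau> \<tau>L, of y0] by blast
  have "y t \<in> cball y0 r" if "t \<in> {-\<tau><..<\<tau>}" for t
    using y(3)[OF that] \<tau>M by (simp add: dist_norm norm_minus_commute)
  moreover from this have "F (y t) = f (y t)" if "t \<in> {-\<tau><..<\<tau>}" for t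
    using that by (simp add: F_def closest_point_self)
  ultimately show ?thesis
    using y(1,2) r(2) \<tau> by (metis subsetD)
qed

text \<open>Bootstrapping: if \<open>y\<close> is of class \<open>k\<close>, then so is its
  derivative, the composition of \<open>f\<close> with \<open>y\<close>.\<close>

lemma integral_curve_smooth:
  fixes f :: "'a::euclidean_space \<Rightarrow> 'a"
  assumes "open U" "open J" "smooth_on U f"
    and "\<And>t. t \<in> J \<Longrightarrow> y t \<in> U \<and> (y has_vector_derivative f (y t)) (at t)"
  shows "smooth_on J y"
proof -
  have "Ck_on k J y" for k
  proof (induction k)
    case 0
    have "continuous_on J y"
      using assms(4) by (intro continuous_at_imp_continuous_on ballI) (blast intro: has_vector_derivative_continuous)
    then show ?case by simp
  next
    case (Suc k)
    have "Ck_on k J (\<lambda>t. f (y t))"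
      using assms by (intro Ck_on_compose[OF assms(1,2) Suc]) (auto simp: smooth_on_def)
    then have "Ck_on k J (\<lambda>t. v *\<^sub>R f (y t))" for v
      by (rule Ck_on_linear[OF bounded_linear_scaleR_right assms(2)])
    then show ?case
      using assms(4) by (intro Ck_on_SucI[OF assms(2)]) (auto simp: has_vector_derivative_def)
  qed
  then show ?thesis by (simp add: smooth_on_def)
qed

text \<open>The second-order equation becomes the first-order field \<open>f\<close> of position and
  velocity, on \<open>U\<close> times the whole space of velocities.\<close>

lemma geodesic_ode_solution:
  fixes \<Gamma> :: "'n::finite \<Rightarrow> 'n \<Rightarrow> 'n \<Rightarrow> real^'n \<Rightarrow> real"
  assumes "open U" "x0 \<in> U" "\<And>k i j. smooth_on U (\<Gamma> k i j)"
  shows "\<exists>\<tau>>0. \<exists>x v. x 0 = x0 \<and> v 0 = v0 \<and> smooth_on {-\<tau><..<\<tau>} x \<and>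
    (\<forall>t\<in>{-\<tau><..<\<tau>}. x t \<in> U \<and> (x has_vector_derivative v t) (at t) \<and>
      (v has_vector_derivative (\<chi> k. - (\<Sum>i\<in>UNIV. \<Sum>j\<in>UNIV. \<Gamma> k i j (x t) * v t $ i * v t $ j))) (at t))"
proof -
  define f where "f p = (snd p, \<chi> k. - (\<Sum>i\<in>UNIV. \<Sum>j\<in>UNIV. \<Gamma> k i j (fst p) * snd p $ i * snd p $ j))"
    for p :: "(real^'n) \<times> (real^'n)"
  let ?U = "U \<times> (UNIV :: (real^'n) set)"
  have oU: "open ?U" using assms(1) by (intro open_Times) auto
  have "Ck_on k ?U f" for k
  proof -
    have fs: "Ck_on k ?U fst" "Ck_on k ?U snd"
      by (rule Ck_on_linear[OF bounded_linear_fst oU Ck_on_ident], rule Ck_on_linear[OF bounded_linear_snd oU Ck_on_ident])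
    have vi: "Ck_on k ?U (\<lambda>p. snd p $ i)" for i
      by (rule Ck_on_linear[OF bounded_linear_vec_nth oU fs(2)])
    have G: "Ck_on k ?U (\<lambda>p. \<Gamma> m i j (fst p))" for m i j
      by (rule Ck_on_compose[OF assms(1) oU fs(1)]) (use assms(3) in \<open>auto simp: smooth_on_def\<close>)
    have "Ck_on k ?U (\<lambda>p. - (\<Sum>i\<in>UNIV. \<Sum>j\<in>UNIV. \<Gamma> m i j (fst p) * snd p $ i * snd p $ j))" for m
      by (intro Ck_on_linear[OF bounded_linear_minus[OF bounded_linear_ident] oU] Ck_on_sum Ck_on_mult oU vi G)
    then show ?thesis unfolding f_def[abs_def]
      by (intro Ck_on_Pair oU fs) (simp add: Ck_on_vec[OF oU])
  qed
  note smooth = this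
  obtain \<tau> y where \<tau>: "\<tau> > 0" and y0: "y 0 = (x0, v0)"
    and y: "\<And>t. t \<in> {-\<tau><..<\<tau>} \<Longrightarrow> y t \<in> ?U \<and> (y has_vector_derivative f (y t)) (at t)"
    using integral_curve_exists[OF oU _ smooth, of "(x0, v0)"] assms(2) by auto
  have "smooth_on {-\<tau><..<\<tau>} y"
    by (rule integral_curve_smooth[OF oU _ _ y]) (auto simp: smooth_on_def smooth)
  then have sx: "smooth_on {-\<tau><..<\<tau>} (\<lambda>t. fst (y t))"
    unfolding smooth_on_def by (blast intro: Ck_on_linear[OF bounded_linear_fst open_greaterThanLessThan])
  have "fst (y t) \<in> U \<and> ((\<lambda>t. fst (y t)) has_vector_derivative snd (y t)) (at t) \<and>
      ((\<lambda>t. snd (y t)) has_vector_derivative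
        (\<chi> k. - (\<Sum>i\<in>UNIV. \<Sum>j\<in>UNIV. \<Gamma> k i j (fst (y t)) * snd (y t) $ i * snd (y t) $ j))) (at t)"
    if "t \<in> {-\<tau><..<\<tau>}" for t
    using y[OF that] bounded_linear.has_vector_derivative[OF bounded_linear_fst, of y "f (y t)" "at t"]
      bounded_linear.has_vector_derivative[OF bounded_linear_snd, of y "f (y t)" "at t"]
    by (auto simp: f_def mem_Times_iff)
  then show ?thesis
    using \<tau> sx y0 by (intro exI[of _ \<tau>] conjI exI[of _ "\<lambda>t. fst (y t)"] exI[of _ "\<lambda>t. snd (y t)"]) auto
qed

section \<open>Alternating sums and the contact volume\<close>

text \<open>Unnormalised alternation of a covariant tensor, evaluated on the basis indices
  \<open>e 0\<close>, ..., \<open>e (n - 1)\<close>. \<open>T\<close> sees the whole assignment of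
  indices to slots, so that slots can be permuted or overwritten.\<close>

definition alt_sum :: "nat \<Rightarrow> (nat \<Rightarrow> 'i) \<Rightarrow> ((nat \<Rightarrow> 'i) \<Rightarrow> real) \<Rightarrow> real" where
  "alt_sum n e T = (\<Sum>\<sigma> | \<sigma> permutes {..<n}. of_int (sign \<sigma>) * T (\<lambda>i. e (\<sigma> i)))"

lemma alt_sum_add: "alt_sum n e (\<lambda>f. T f + U f) = alt_sum n e T + alt_sum n e U"
  by (simp add: alt_sum_def distrib_left sum.distrib)

lemma alt_sum_diff: "alt_sum n e (\<lambda>f. T f - U f) = alt_sum n e T - alt_sum n e U"
  by (simp add: alt_sum_def right_diff_distrib sum_subtractf)

lemma alt_sum_scale: "alt_sum n e (\<lambda>f. c * T f) = c * alt_sum n e T"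
  by (simp add: alt_sum_def sum_distrib_left mult_ac)

lemma alt_sum_sum: "alt_sum n e (\<lambda>f. \<Sum>i\<in>I. T i f) = (\<Sum>i\<in>I. alt_sum n e (T i))"
  unfolding alt_sum_def sum_distrib_left by (rule sum.swap)

lemma alt_sum_cong:
  assumes "\<And>\<sigma>. \<sigma> permutes {..<n} \<Longrightarrow> T (\<lambda>i. e (\<sigma> i)) = U (\<lambda>i. e (\<sigma> i))"
  shows "alt_sum n e T = alt_sum n e U"
  using assms by (simp add: alt_sum_def)

text \<open>Exchanging two slots multiplies every \<sigma> on the right by a transposition, which
  flips the sign.\<close>

lemma alt_sum_transpose:
  assumes "p < n" "q < n" "p \<noteq> q"
  shows "alt_sum n e (\<lambda>f. T (\<lambda>i. f (Transposition.transpose p q i))) = - alt_sum n e T"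
proof -
  let ?t = "Transposition.transpose p q"
  have t: "?t permutes {..<n}"
    using assms by (intro permutes_swap_id) auto
  have sgn: "sign (\<sigma> \<circ> ?t) = - sign \<sigma>" if "\<sigma> permutes {..<n}" for \<sigma>
    using sign_compose[of \<sigma> ?t] permutes_imp_permutation[OF _ that] permutes_imp_permutation[OF _ t] assms
    by (simp add: sign_swap_id)
  have "alt_sum n e T = (\<Sum>\<sigma> | \<sigma> permutes {..<n}. of_int (sign (\<sigma> \<circ> ?t)) * T (\<lambda>i. e ((\<sigma> \<circ> ?t) i)))"
    unfolding alt_sum_def by (rule sum_permutations_compose_right[OF t])
  also have "\<dots> = (\<Sum>\<sigma> | \<sigma> permutes {..<n}. - (of_int (sign \<sigma>) * T (\<lambda>i. e (\<sigma> (?t i)))))"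
    using sgn by (intro sum.cong) simp_all
  also have "\<dots> = - alt_sum n e (\<lambda>f. T (\<lambda>i. f (?t i)))"
    by (simp add: alt_sum_def sum_negf)
  finally show ?thesis by simp
qed

lemma alt_sum_symmetric_eq_0:
  assumes "p < n" "q < n" "p \<noteq> q"
    and "\<And>f. T (\<lambda>i. f (Transposition.transpose p q i)) = T f"
  shows "alt_sum n e T = 0"
  using alt_sum_transpose[OF assms(1-3), of e T] by (simp add: assms(4))

text \<open>A tensor product before alternation: slot 0 belongs to \<open>a\<close>, slots 2j+1 and
  2j+2 to the factor \<open>j\<close>. The factors may differ, so that a single one can be replaced
  in Leibniz sums and expansions.\<close>

definition contact_term ::
  "nat \<Rightarrow> ('i \<Rightarrow> real) \<Rightarrow> (nat \<Rightarrow> 'i \<Rightarrow> 'i \<Rightarrow> real) \<Rightarrow> (nat \<Rightarrow> 'i) \<Rightarrow> real" where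
  "contact_term l a B f = a (f 0) * (\<Prod>j<l. B j (f (2 * j + 1)) (f (2 * j + 2)))"

lemma contact_term_upd:
  assumes "i < l"
  shows "contact_term l a (B(i := b)) f =
    a (f 0) * b (f (2 * i + 1)) (f (2 * i + 2)) *
    (\<Prod>j\<in>{..<l} - {i}. B j (f (2 * j + 1)) (f (2 * j + 2)))"
proof -
  have "(\<Prod>j<l. (B(i := b)) j (f (2 * j + 1)) (f (2 * j + 2))) =
      b (f (2 * i + 1)) (f (2 * i + 2)) *
      (\<Prod>j\<in>{..<l} - {i}. (B(i := b)) j (f (2 * j + 1)) (f (2 * j + 2)))"
    using assms by (subst prod.remove[of _ i]) auto
  also have "(\<Prod>j\<in>{..<l} - {i}. (B(i := b)) j (f (2 * j + 1)) (f (2 * j + 2))) =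
      (\<Prod>j\<in>{..<l} - {i}. B j (f (2 * j + 1)) (f (2 * j + 2)))"
    by (intro prod.cong) auto
  finally show ?thesis by (simp add: contact_term_def mult.assoc)
qed

lemma contact_term_nth:
  assumes "i < l"
  shows "contact_term l a B f =
    a (f 0) * B i (f (2 * i + 1)) (f (2 * i + 2)) *
    (\<Prod>j\<in>{..<l} - {i}. B j (f (2 * j + 1)) (f (2 * j + 2)))"
  using contact_term_upd[OF assms, of a B "B i" f] by simp

text \<open>The other factors occupy slots disjoint from 0 and from the two slots of factor
  \<open>i\<close>; symmetries under such transpositions need then be checked on \<open>a\<close>
  and \<open>B i\<close> only.\<close>

lemma prod_rest_transpose:
  fixes p q :: nat
  assumes "p \<in> {0, 2 * i + 1, 2 * i + 2}" "q \<in> {0, 2 * i + 1, 2 * i + 2}"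
  shows "(\<Prod>j\<in>{..<l} - {i}. B j (f (Transposition.transpose p q (2 * j + 1))) (f (Transposition.transpose p q (2 * j + 2)))) =
    (\<Prod>j\<in>{..<l} - {i}. B j (f (2 * j + 1)) (f (2 * j + 2)))"
proof (rule prod.cong[OF refl])
  fix j assume "j \<in> {..<l} - {i}"
  then have "2 * j + 1 \<noteq> r \<and> 2 * j + 2 \<noteq> r" if "r \<in> {0, 2 * i + 1, 2 * i + 2}" for r
    using that by simp presburger
  from this[OF assms(1)] this[OF assms(2)] show "B j (f (Transposition.transpose p q (2 * j + 1))) (f (Transposition.transpose p q (2 * j + 2))) =
      B j (f (2 * j + 1)) (f (2 * j + 2))"
    by (simp only: transpose_apply_other not_False_eq_True)
qed

text \<open>This is a \<and> (a \<and> p) = 0: in each of the two products \<open>a\<close> fills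
  slot 0 and one slot of factor \<open>i\<close>, and exchanging these two slots changes
  nothing.\<close>

lemma alt_sum_contact_term_wedge:
  assumes "i < l"
  shows "alt_sum (2 * l + 1) e (contact_term l a (B(i := \<lambda>u v. a u * p v - a v * p u))) = 0"
proof -
  let ?R = "\<lambda>f. \<Prod>j\<in>{..<l} - {i}. B j (f (2 * j + 1)) (f (2 * j + 2))"
  have 1: "alt_sum (2 * l + 1) e (\<lambda>f. a (f 0) * (a (f (2 * i + 1)) * p (f (2 * i + 2))) * ?R f) = 0"
    by (rule alt_sum_symmetric_eq_0[of 0 _ "2 * i + 1"])
      (use assms in \<open>simp_all add: prod_rest_transpose del: One_nat_def add_2_eq_Suc' Suc_eq_plus1\<close>)
  have 2: "alt_sum (2 * l + 1) e (\<lambda>f. a (f 0) * (a (f (2 * i + 2)) * p (f (2 * i + 1))) * ?R f) = 0"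
    by (rule alt_sum_symmetric_eq_0[of 0 _ "2 * i + 2"])
      (use assms in \<open>simp_all add: prod_rest_transpose del: One_nat_def add_2_eq_Suc' Suc_eq_plus1\<close>)
  have "alt_sum (2 * l + 1) e (contact_term l a (B(i := \<lambda>u v. a u * p v - a v * p u))) =
      alt_sum (2 * l + 1) e (\<lambda>f. a (f 0) * (a (f (2 * i + 1)) * p (f (2 * i + 2))) * ?R f
        - a (f 0) * (a (f (2 * i + 2)) * p (f (2 * i + 1))) * ?R f)"
    by (rule alt_sum_cong) (simp only: contact_term_upd[OF assms] right_diff_distrib left_diff_distrib)
  also have "\<dots> = 0"
    by (simp only: alt_sum_diff 1 2)
  finally show ?thesis .
qed

lemma sum_slots:
  fixes g :: "nat \<Rightarrow> 'a::comm_monoid_add"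
  shows "(\<Sum>m<2 * l + 1. g m) = g 0 + (\<Sum>i<l. g (2 * i + 1) + g (2 * i + 2))"
  by (induction l) (simp_all add: add_ac)

lemma sum_slots_reindex:
  assumes "bij_betw e {..<n} (UNIV :: 'i::finite set)" "\<sigma> permutes {..<n}"
  shows "(\<Sum>x\<in>UNIV. g x) = (\<Sum>m<n. g (e (\<sigma> m)))"
  using sum.reindex_bij_betw[OF bij_betw_trans[OF permutes_imp_bij[OF assms(2)] assms(1)], of g]
  by (simp add: o_def)

text \<open>If \<open>k\<close> sits at position \<open>m > 0\<close>, the summand is invariant under the transposition of \<open>0\<close> and the
  position paired with \<open>m\<close>. This replaces the vanishing of \<open>(d\<theta>)\<close> to the power \<open>l + 1\<close>.\<close>

lemma alt_sum_contact_term_contraction: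
  fixes B :: "'i::finite \<Rightarrow> 'i \<Rightarrow> real"
  assumes "bij_betw e {..<2 * l + 1} UNIV" "\<And>u v. B v u = - B u v"
  shows "alt_sum (2 * l + 1) e (contact_term l (B k) (\<lambda>_. B)) = 0"
proof -
  \<comment> \<open>The assignment is a bijection onto all 2l+1 indices, so \<open>k\<close> sits in
    exactly one slot: the indicators of \<open>f m = k\<close> add up to 1, and under each of them
    \<open>k\<close> may be written as \<open>f m\<close>.\<close>
  let ?T = "\<lambda>m f. (if f m = k then 1 else 0) * contact_term l (B (f m)) (\<lambda>_. B) f"
  have "alt_sum (2 * l + 1) e (contact_term l (B k) (\<lambda>_. B)) = alt_sum (2 * l + 1) e (\<lambda>f. \<Sum>m<2 * l + 1. ?T m f)"
  proof (rule alt_sum_cong)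
    fix \<sigma> :: "nat \<Rightarrow> nat" assume \<sigma>: "\<sigma> permutes {..<2 * l + 1}"
    let ?f = "\<lambda>i. e (\<sigma> i)"
    have "(\<Sum>m<2 * l + 1. ?T m ?f) = (\<Sum>x\<in>UNIV. (if x = k then 1 else 0) * contact_term l (B x) (\<lambda>_. B) ?f)"
      by (rule sum_slots_reindex[OF assms(1) \<sigma>, symmetric])
    also have "\<dots> = (\<Sum>x\<in>UNIV. if x = k then contact_term l (B x) (\<lambda>_. B) ?f else 0)"
      by (rule sum.cong) auto
    finally show "contact_term l (B k) (\<lambda>_. B) ?f = (\<Sum>m<2 * l + 1. ?T m ?f)"
      by simp
  qed
  also have "\<dots> = (\<Sum>m<2 * l + 1. alt_sum (2 * l + 1) e (?T m))"
    by (rule alt_sum_sum)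
  also have "\<dots> = 0"
  proof (rule sum.neutral, rule ballI)
    fix m assume m: "m \<in> {..<2 * l + 1}"
    consider "m = 0" | i where "m = 2 * i + 1" | i where "m = 2 * i + 2"
      by (metis add_2_eq_Suc' bot_nat_0.not_eq_extremum evenE mult_Suc_right oddE Suc_pred add.commute mult_0_right Suc_1 not0_implies_Suc)
    then show "alt_sum (2 * l + 1) e (?T m) = 0"
    proof cases
      case 1
      have "B u u = 0" for u
        using assms(2)[of u u] by simp
      then have "?T m = (\<lambda>_. 0)"
        by (simp add: 1 contact_term_def fun_eq_iff)
      then show ?thesis by (simp add: alt_sum_def)
    next
      case (2 i)
      then have i: "i < l" using m by simp
      show ?thesis
        by (rule alt_sum_symmetric_eq_0[of 0 _ "2 * i + 2"])
          (use i in \<open>simp_all add: 2 contact_term_nth[OF i] prod_rest_transpose del: One_nat_def add_2_eq_Suc' Suc_eq_plus1\<close>)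
    next
      case (3 i)
      then have i: "i < l" using m by simp
      show ?thesis
      proof (rule alt_sum_symmetric_eq_0[of 0 _ "2 * i + 1"])
        fix f :: "nat \<Rightarrow> 'i"
        show "?T m (\<lambda>j. f (Transposition.transpose 0 (2 * i + 1) j)) = ?T m f"
          using i assms(2)[of "f (2 * i + 1)" "f (2 * i + 2)"] assms(2)[of "f 0" "f (2 * i + 2)"]
          by (simp add: 3 contact_term_nth[OF i] prod_rest_transpose del: One_nat_def add_2_eq_Suc' Suc_eq_plus1)
      qed (use i in simp_all)
    qed
  qed
  finally show ?thesis .
qed

text \<open>The infinitesimal version of \<open>M\<close> acting on a top form by \<open>det M\<close>.\<close>

lemma alt_sum_trace:
  fixes G :: "'i::finite \<Rightarrow> 'i \<Rightarrow> real"
  assumes e: "bij_betw e {..<n} UNIV"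
  shows "alt_sum n e (\<lambda>f. \<Sum>m<n. \<Sum>x\<in>UNIV. G (f m) x * T (f(m := x))) =
    (\<Sum>x\<in>UNIV. G x x) * alt_sum n e T"
proof -
  let ?U = "\<lambda>m m' f. G (f m) (f m') * T (f(m := f m'))"
  let ?s = "\<lambda>m m'. alt_sum n e (?U m m')"
  \<comment> \<open>Slots \<open>m\<close> and \<open>m'\<close> of \<open>f(m := f m')\<close> both
    hold \<open>f m'\<close>, so transposing them turns \<open>?U m' m\<close> into
    \<open>?U m m'\<close>. The off-diagonal terms cancel in pairs and the diagonal leaves the
    trace.\<close>
  have anti: "?s m m' = - ?s m' m" if "m < n" "m' < n" "m \<noteq> m'" for m m'
  proof -
    let ?t = "Transposition.transpose m' m"
    have "alt_sum n e (\<lambda>f. ?U m' m (\<lambda>i. f (?t i))) = - ?s m' m"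
      using that by (intro alt_sum_transpose) auto
    moreover have "(\<lambda>i. f (?t i))(m' := f (?t m)) = f(m := f m')" for f :: "nat \<Rightarrow> 'i"
      by (auto simp: fun_eq_iff Transposition.transpose_def)
    then have "(\<lambda>f. ?U m' m (\<lambda>i. f (?t i))) = ?U m m'"
      by (intro ext) (simp only: transpose_apply_first transpose_apply_second)
    ultimately show ?thesis by simp
  qed
  have "alt_sum n e (\<lambda>f. \<Sum>m<n. \<Sum>x\<in>UNIV. G (f m) x * T (f(m := x))) =
      alt_sum n e (\<lambda>f. \<Sum>m<n. \<Sum>m'<n. ?U m m' f)"
    by (rule alt_sum_cong, rule sum.cong[OF refl], rule sum_slots_reindex[OF e])
  also have "\<dots> = (\<Sum>m<n. \<Sum>m'<n. ?s m m')"
    by (simp add: alt_sum_sum)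
  also have "\<dots> = (\<Sum>m<n. ?s m m) + (\<Sum>m<n. \<Sum>m'<n. if m' = m then 0 else ?s m m')"
  proof -
    have "(\<Sum>m'<n. ?s m m') = ?s m m + (\<Sum>m'<n. if m' = m then 0 else ?s m m')" if "m < n" for m
      using that by (simp add: sum.remove[of "{..<n}" m])
    then show ?thesis by (simp add: sum.distrib)
  qed
  also have "(\<Sum>m<n. \<Sum>m'<n. if m' = m then 0 else ?s m m') = 0"
  proof -
    let ?S = "\<Sum>m<n. \<Sum>m'<n. if m' = m then 0 else ?s m m'"
    have "?S = (\<Sum>m<n. \<Sum>m'<n. - (if m = m' then 0 else ?s m' m))"
    proof (intro sum.cong refl)
      fix m m' assume "m \<in> {..<n}" "m' \<in> {..<n}"
      then show "(if m' = m then 0 else ?s m m') = - (if m = m' then 0 else ?s m' m)"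
        using anti[of m m'] by (cases "m = m'") simp_all
    qed
    also have "\<dots> = - (\<Sum>m<n. \<Sum>m'<n. if m = m' then 0 else ?s m' m)"
      by (simp only: sum_negf)
    also have "(\<Sum>m<n. \<Sum>m'<n. if m = m' then 0 else ?s m' m) = ?S"
      by (rule sum.swap)
    finally show ?thesis by simp
  qed
  also have "(\<Sum>m<n. ?s m m) = alt_sum n e (\<lambda>f. \<Sum>m<n. G (f m) (f m) * T f)"
    by (simp add: alt_sum_sum)
  also have "\<dots> = alt_sum n e (\<lambda>f. (\<Sum>x\<in>UNIV. G x x) * T f)"
    by (rule alt_sum_cong) (simp add: sum_slots_reindex[OF e] sum_distrib_right)
  finally show ?thesis by (simp only: alt_sum_scale add_0_right)
qed

text \<open>Leibniz rule that brings the connection terms into the form evaluated by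
  \<open>alt_sum_trace\<close>: each slot carries exactly one argument, so acting on the factors is
  acting on the slots one by one.\<close>

lemma contact_term_derivation:
  fixes G :: "'i::finite \<Rightarrow> 'i \<Rightarrow> real"
  shows "contact_term l (\<lambda>u. \<Sum>x\<in>UNIV. G u x * a x) (\<lambda>_. B) f +
      (\<Sum>i<l. contact_term l a ((\<lambda>_. B)(i := \<lambda>u v. \<Sum>x\<in>UNIV. G u x * B x v + G v x * B u x)) f) =
    (\<Sum>m<2 * l + 1. \<Sum>x\<in>UNIV. G (f m) x * contact_term l a (\<lambda>_. B) (f(m := x)))"
proof -
  have 0: "contact_term l a (\<lambda>_. B) (f(0 := x)) = a x * (\<Prod>j<l. B (f (2 * j + 1)) (f (2 * j + 2)))" for x
    by (simp add: contact_term_def)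
  have "contact_term l a (\<lambda>_. B) (f(2 * i + 1 := x)) = contact_term l a ((\<lambda>_. B)(i := \<lambda>u v. B x v)) f"
    if "i < l" for i x
  proof -
    have "(\<Prod>j\<in>{..<l} - {i}. B ((f(2 * i + 1 := x)) (2 * j + 1)) ((f(2 * i + 1 := x)) (2 * j + 2))) =
        (\<Prod>j\<in>{..<l} - {i}. B (f (2 * j + 1)) (f (2 * j + 2)))"
      by (intro prod.cong refl) (simp; presburger)
    then show ?thesis
      unfolding contact_term_nth[OF that, of _ "\<lambda>_. B"] contact_term_upd[OF that] by simp
  qed
  moreover have "contact_term l a (\<lambda>_. B) (f(2 * i + 2 := x)) = contact_term l a ((\<lambda>_. B)(i := \<lambda>u v. B u x)) f"
    if "i < l" for i x
  proof -
    have "(\<Prod>j\<in>{..<l} - {i}. B ((f(2 * i + 2 := x)) (2 * j + 1)) ((f(2 * i + 2 := x)) (2 * j + 2))) =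
        (\<Prod>j\<in>{..<l} - {i}. B (f (2 * j + 1)) (f (2 * j + 2)))"
      by (intro prod.cong refl) (simp; presburger)
    then show ?thesis
      unfolding contact_term_nth[OF that, of _ "\<lambda>_. B"] contact_term_upd[OF that] by simp
  qed
  ultimately have "contact_term l a ((\<lambda>_. B)(i := \<lambda>u v. \<Sum>x\<in>UNIV. G u x * B x v + G v x * B u x)) f =
      (\<Sum>x\<in>UNIV. G (f (2 * i + 1)) x * contact_term l a (\<lambda>_. B) (f(2 * i + 1 := x))) +
      (\<Sum>x\<in>UNIV. G (f (2 * i + 2)) x * contact_term l a (\<lambda>_. B) (f(2 * i + 2 := x)))"
    if "i < l" for i
    using that
    by (simp add: contact_term_upd[OF that] sum_distrib_left sum_distrib_right sum.distrib
        distrib_left distrib_right mult_ac)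
  moreover have "contact_term l (\<lambda>u. \<Sum>x\<in>UNIV. G u x * a x) (\<lambda>_. B) f =
      (\<Sum>x\<in>UNIV. G (f 0) x * contact_term l a (\<lambda>_. B) (f(0 := x)))"
    unfolding 0 by (simp add: contact_term_def sum_distrib_right mult.assoc)
  ultimately show ?thesis
    by (simp only: sum_slots) simp
qed

text \<open>Algebraic form of c\<theta> \<and> (c d\<theta> + \<theta> \<and> p)^l = c^(l+1)
  \<theta> \<and> (d\<theta>)^l: every correction \<theta> \<and> p dies against the leading
  \<theta>.\<close>

lemma alt_sum_contact_term_scale:
  "alt_sum (2 * l + 1) e (contact_term l (\<lambda>u. c * a u) (\<lambda>_ u v. c * B u v + (a u * p v - a v * p u))) =
    c ^ (l + 1) * alt_sum (2 * l + 1) e (contact_term l a (\<lambda>_. B))"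
proof -
  let ?A = "alt_sum (2 * l + 1) e"
  let ?W = "\<lambda>u v. a u * p v - a v * p u"
  \<comment> \<open>The correction is present in the first \<open>k\<close> factors; it is removed
    one factor at a time.\<close>
  let ?B = "\<lambda>k j. if j < k then (\<lambda>u v. c * B u v + ?W u v) else (\<lambda>u v. c * B u v)"
  have "?A (contact_term l a (?B k)) = ?A (contact_term l a (?B 0))" if "k \<le> l" for k
    using that
  proof (induction k)
    case (Suc k)
    then have k: "k < l" by simp
    have "?B (Suc k) = (?B k)(k := \<lambda>u v. c * B u v + ?W u v)"
      by (auto simp: fun_eq_iff less_Suc_eq)
    then have "contact_term l a (?B (Suc k)) f =
        contact_term l a (?B k) f + contact_term l a ((?B k)(k := ?W)) f" for f
      by (simp only: contact_term_upd[OF k] contact_term_nth[OF k, of a "?B k"])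
        (simp add: algebra_simps)
    then have "?A (contact_term l a (?B (Suc k))) =
        ?A (\<lambda>f. contact_term l a (?B k) f + contact_term l a ((?B k)(k := ?W)) f)"
      by (intro alt_sum_cong)
    also have "\<dots> = ?A (contact_term l a (?B k))"
      by (simp only: alt_sum_add alt_sum_contact_term_wedge[OF k] add_0_right)
    finally show ?case using Suc by simp
  qed simp
  from this[of l] have *: "?A (contact_term l a (?B l)) = ?A (contact_term l a (\<lambda>_ u v. c * B u v))"
    by simp
  have "contact_term l (\<lambda>u. c * a u) (\<lambda>_ u v. c * B u v + ?W u v) f = c * contact_term l a (?B l) f" for f
    by (simp add: contact_term_def)
  then have "?A (contact_term l (\<lambda>u. c * a u) (\<lambda>_ u v. c * B u v + ?W u v)) = ?A (\<lambda>f. c * contact_term l a (?B l) f)"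
    by (intro alt_sum_cong)
  also have "\<dots> = c * ?A (contact_term l a (\<lambda>_ u v. c * B u v))"
    by (simp only: alt_sum_scale *)
  also have "\<dots> = c * ?A (\<lambda>f. c ^ l * contact_term l a (\<lambda>_. B) f)"
    by (rule arg_cong[where f = "(*) c"], rule alt_sum_cong) (simp add: contact_term_def prod.distrib)
  finally show ?thesis by (simp add: alt_sum_scale)
qed

lemma has_derivative_alt_sum_contact_term:
  fixes a :: "'x::real_normed_vector \<Rightarrow> 'i \<Rightarrow> real"
  assumes "\<And>u. ((\<lambda>x. a x u) has_derivative a' u) (at x)"
    and "\<And>u v. ((\<lambda>x. B x u v) has_derivative B' u v) (at x)"
  shows "((\<lambda>x. alt_sum n e (contact_term l (a x) (\<lambda>_. B x))) has_derivative
    (\<lambda>h. alt_sum n e (\<lambda>f. contact_term l (\<lambda>u. a' u h) (\<lambda>_. B x) f +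
      (\<Sum>i<l. contact_term l (a x) ((\<lambda>_. B x)(i := \<lambda>u v. B' u v h)) f)))) (at x)"
  unfolding alt_sum_def
proof (intro has_derivative_sum has_derivative_mult_right)
  fix f :: "nat \<Rightarrow> 'i"
  have "((\<lambda>x. a x (f 0) * (\<Prod>j<l. B x (f (2 * j + 1)) (f (2 * j + 2)))) has_derivative
      (\<lambda>h. a x (f 0) * (\<Sum>i<l. B' (f (2 * i + 1)) (f (2 * i + 2)) h *
          (\<Prod>j\<in>{..<l} - {i}. B x (f (2 * j + 1)) (f (2 * j + 2)))) +
        a' (f 0) h * (\<Prod>j<l. B x (f (2 * j + 1)) (f (2 * j + 2))))) (at x)"
    by (intro has_derivative_mult assms has_derivative_prod)
  moreover have "(\<Sum>i<l. contact_term l (a x) ((\<lambda>_. B x)(i := \<lambda>u v. B' u v h)) f) =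
      a x (f 0) * (\<Sum>i<l. B' (f (2 * i + 1)) (f (2 * i + 2)) h *
          (\<Prod>j\<in>{..<l} - {i}. B x (f (2 * j + 1)) (f (2 * j + 2))))" for h
    unfolding sum_distrib_left by (rule sum.cong) (simp_all only: contact_term_upd lessThan_iff mult.assoc)
  ultimately show "((\<lambda>x. contact_term l (a x) (\<lambda>_. B x) f) has_derivative
      (\<lambda>h. contact_term l (\<lambda>u. a' u h) (\<lambda>_. B x) f +
      (\<Sum>i<l. contact_term l (a x) ((\<lambda>_. B x)(i := \<lambda>u v. B' u v h)) f))) (at x)"
    by (simp add: contact_term_def add.commute)
qed

text \<open>A permutation \<tau> of the last \<open>q\<close> slots can be absorbed into \<sigma>.
  All q! choices of \<tau> then give the same sum and cancel the factor \<open>fact q\<close> in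
  \<open>wedge\<close>.\<close>

lemma wedge_of_alternation:
  assumes \<beta>: "\<And>ws. \<beta> ws = c * (\<Sum>\<tau> | \<tau> permutes {..<q}. of_int (sign \<tau>) * b (\<lambda>j. ws ! \<tau> j))"
    and b: "\<And>h h'. (\<And>j. j < q \<Longrightarrow> h j = h' j) \<Longrightarrow> b h = b h'"
  shows "wedge p q \<alpha> \<beta> vs = c / fact p *
    (\<Sum>\<sigma> | \<sigma> permutes {..<p + q}. of_int (sign \<sigma>) * \<alpha> (map (\<lambda>i. vs ! \<sigma> i) [0..<p]) * b (\<lambda>j. vs ! \<sigma> (p + j)))"
proof -
  let ?S = "{\<sigma>. \<sigma> permutes {..<p + q}}"
  let ?P = "{\<tau>. \<tau> permutes {..<q}}"
  let ?g = "\<lambda>\<sigma>. of_int (sign \<sigma>) * \<alpha> (map (\<lambda>i. vs ! \<sigma> i) [0..<p])"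
  let ?G = "\<Sum>\<sigma>\<in>?S. ?g \<sigma> * b (\<lambda>j. vs ! \<sigma> (p + j))"
  have G: "(\<Sum>\<sigma>\<in>?S. ?g \<sigma> * (of_int (sign \<tau>) * b (\<lambda>j. vs ! \<sigma> (p + \<tau> j)))) = ?G"
    if \<tau>: "\<tau> permutes {..<q}" for \<tau>
  proof -
    \<comment> \<open>\<tau> moved to the slots p, ..., p+q-1, and the identity on the first
      \<open>p\<close>.\<close>
    define t where "t = map_permutation {..<q} ((+) p) \<tau>"
    have inj: "inj_on ((+) p) {..<q}" by simp
    have im: "(+) p ` {..<q} = {p..<p + q}"
      by (simp add: lessThan_atLeast0 add.commute)
    have tp: "t permutes {p..<p + q}"
      unfolding t_def by (rule map_permutation_permutes[OF _ \<tau>]) (simp add: bij_betw_def im)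
    then have t: "t permutes {..<p + q}"
      by (rule permutes_subset) auto
    have sgn: "sign t = sign \<tau>"
      unfolding t_def by (rule sign_map_permutation[OF inj \<tau>]) simp
    have app: "t (p + j) = p + \<tau> j" if "j < q" for j
      unfolding t_def using map_permutation_apply[OF inj, of j \<tau>] that by simp
    have fixp: "t i = i" if "i < p" for i
      using tp that by (intro permutes_not_in[OF tp]) auto
    have "?G = (\<Sum>\<sigma>\<in>?S. ?g (\<sigma> \<circ> t) * b (\<lambda>j. vs ! (\<sigma> \<circ> t) (p + j)))"
      by (rule sum_permutations_compose_right[OF t])
    also have "\<dots> = (\<Sum>\<sigma>\<in>?S. ?g \<sigma> * (of_int (sign \<tau>) * b (\<lambda>j. vs ! \<sigma> (p + \<tau> j))))"
    proof (rule sum.cong[OF refl])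
      fix \<sigma> assume "\<sigma> \<in> ?S"
      then have \<sigma>: "\<sigma> permutes {..<p + q}" by simp
      have "sign (\<sigma> \<circ> t) = sign \<sigma> * sign \<tau>"
        using sign_compose[of \<sigma> t] permutes_imp_permutation[OF _ \<sigma>] permutes_imp_permutation[OF _ t] sgn by simp
      moreover have "map (\<lambda>i. vs ! (\<sigma> \<circ> t) i) [0..<p] = map (\<lambda>i. vs ! \<sigma> i) [0..<p]"
        by (rule map_cong) (simp_all add: fixp)
      moreover have "b (\<lambda>j. vs ! (\<sigma> \<circ> t) (p + j)) = b (\<lambda>j. vs ! \<sigma> (p + \<tau> j))"
        by (rule b) (simp add: app)
      ultimately show "?g (\<sigma> \<circ> t) * b (\<lambda>j. vs ! (\<sigma> \<circ> t) (p + j)) =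
          ?g \<sigma> * (of_int (sign \<tau>) * b (\<lambda>j. vs ! \<sigma> (p + \<tau> j)))"
        by (simp only: of_int_mult mult_ac)
    qed
    finally show ?thesis by simp
  qed
  have "\<beta> (map (\<lambda>i. vs ! \<sigma> i) [p..<p + q]) =
      c * (\<Sum>\<tau>\<in>?P. of_int (sign \<tau>) * b (\<lambda>j. vs ! \<sigma> (p + \<tau> j)))" for \<sigma>
  proof -
    have "b (\<lambda>j. map (\<lambda>i. vs ! \<sigma> i) [p..<p + q] ! \<tau> j) = b (\<lambda>j. vs ! \<sigma> (p + \<tau> j))" if "\<tau> \<in> ?P" for \<tau>
    proof (rule b)
      fix j assume "j < q"
      then have "\<tau> j < q" using that permutes_in_image[of \<tau> "{..<q}" j] by simp
      then show "map (\<lambda>i. vs ! \<sigma> i) [p..<p + q] ! \<tau> j = vs ! \<sigma> (p + \<tau> j)" by simp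
    qed
    then show ?thesis unfolding \<beta> by simp
  qed
  then have "wedge p q \<alpha> \<beta> vs =
      (\<Sum>\<sigma>\<in>?S. ?g \<sigma> * (c * (\<Sum>\<tau>\<in>?P. of_int (sign \<tau>) * b (\<lambda>j. vs ! \<sigma> (p + \<tau> j))))) / (fact p * fact q)"
    by (simp add: wedge_def)
  also have "(\<Sum>\<sigma>\<in>?S. ?g \<sigma> * (c * (\<Sum>\<tau>\<in>?P. of_int (sign \<tau>) * b (\<lambda>j. vs ! \<sigma> (p + \<tau> j))))) =
      c * (\<Sum>\<sigma>\<in>?S. \<Sum>\<tau>\<in>?P. ?g \<sigma> * (of_int (sign \<tau>) * b (\<lambda>j. vs ! \<sigma> (p + \<tau> j))))"
    by (simp add: sum_distrib_left mult_ac)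
  also have "(\<Sum>\<sigma>\<in>?S. \<Sum>\<tau>\<in>?P. ?g \<sigma> * (of_int (sign \<tau>) * b (\<lambda>j. vs ! \<sigma> (p + \<tau> j)))) =
      (\<Sum>\<tau>\<in>?P. \<Sum>\<sigma>\<in>?S. ?g \<sigma> * (of_int (sign \<tau>) * b (\<lambda>j. vs ! \<sigma> (p + \<tau> j))))"
    by (rule sum.swap)
  also have "\<dots> = (\<Sum>\<tau>\<in>?P. ?G)"
    by (rule sum.cong[OF refl]) (use G in simp)
  also have "\<dots> = fact q * ?G"
    using card_permutations[of "{..<q}" q] by simp
  finally show ?thesis by simp
qed

text \<open>Each wedge contributes 1/2!, so \<open>c\<close> is 2^-k; what is used is its
  independence of \<beta> and of the arguments.\<close>

lemma wedge_power_2: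
  "\<exists>c. \<forall>\<beta> vs. wedge_power 2 \<beta> k (vs :: 'v list) = c * (\<Sum>\<sigma> | \<sigma> permutes {..<2 * k}.
     of_int (sign \<sigma>) * (\<Prod>i<k. \<beta> [vs ! \<sigma> (2 * i), vs ! \<sigma> (2 * i + 1)]))"
proof (induction k)
  case 0
  have "{\<sigma>. \<sigma> permutes {..<0::nat}} = {id}" by auto
  then show ?case by (intro exI[of _ 1]) simp
next
  case (Suc k)
  then obtain c where c: "\<And>\<beta> (vs :: 'v list). wedge_power 2 \<beta> k vs = c * (\<Sum>\<sigma> | \<sigma> permutes {..<k * 2}.
     of_int (sign \<sigma>) * (\<Prod>i<k. \<beta> [vs ! \<sigma> (2 * i), vs ! \<sigma> (2 * i + 1)]))"
    by (auto simp: mult.commute)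
  have "wedge 2 (k * 2) \<beta> (wedge_power 2 \<beta> k) vs = c / fact 2 * (\<Sum>\<sigma> | \<sigma> permutes {..<2 + k * 2}.
      of_int (sign \<sigma>) * \<beta> (map (\<lambda>i. vs ! \<sigma> i) [0..<2]) *
      (\<Prod>i<k. \<beta> [vs ! \<sigma> (2 + 2 * i), vs ! \<sigma> (2 + (2 * i + 1))]))" for \<beta> and vs :: "'v list"
    by (rule wedge_of_alternation[where b = "\<lambda>h. \<Prod>i<k. \<beta> [h (2 * i), h (2 * i + 1)]", OF c])
      (auto intro!: prod.cong)
  then have "wedge_power 2 \<beta> (Suc k) vs = c / fact 2 * (\<Sum>\<sigma> | \<sigma> permutes {..<2 * Suc k}.
      of_int (sign \<sigma>) * (\<Prod>i<Suc k. \<beta> [vs ! \<sigma> (2 * i), vs ! \<sigma> (2 * i + 1)]))" for \<beta> and vs :: "'v list"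
    by (simp only: prod.lessThan_Suc_shift) (simp add: upt_rec mult.commute mult.assoc numeral_2_eq_2)
  then show ?case by blast
qed

definition form_coeffs :: "(real^'n \<Rightarrow> real^'n) \<Rightarrow> real^'n \<Rightarrow> 'n::finite \<Rightarrow> real" where
  "form_coeffs \<theta> x u = \<theta> x $ u"

definition ext_deriv_coeffs :: "(real^'n \<Rightarrow> real^'n) \<Rightarrow> real^'n \<Rightarrow> 'n::finite \<Rightarrow> 'n \<Rightarrow> real" where
  "ext_deriv_coeffs \<theta> x u v = partial u (\<lambda>y. \<theta> y $ v) x - partial v (\<lambda>y. \<theta> y $ u) x"

text \<open>The coefficient of \<theta> \<and> (d\<theta>)^l up to a universal factor, when
  \<open>a\<close> and \<open>B\<close> are the components of \<theta> and d\<theta>.\<close>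

definition contact_sum ::
  "nat \<Rightarrow> ('n::{finite,linorder} \<Rightarrow> real) \<Rightarrow> ('n \<Rightarrow> 'n \<Rightarrow> real) \<Rightarrow> real" where
  "contact_sum l a B =
     alt_sum (2 * l + 1) (\<lambda>i. sorted_list_of_set (UNIV :: 'n set) ! i) (contact_term l a (\<lambda>_. B))"

lemma bij_betw_sorted_list_of_UNIV:
  "bij_betw (\<lambda>i. sorted_list_of_set (UNIV :: 'n::{finite,linorder} set) ! i) {..<CARD('n)} UNIV"
  by (rule bij_betw_nth) auto

lemma partial_vec_nth:
  fixes \<theta> :: "real^'n \<Rightarrow> real^'n::finite"
  assumes "\<theta> differentiable (at x)"
  shows "partial u (\<lambda>y. \<theta> y $ v) x = frechet_derivative \<theta> (at x) (axis u 1) $ v"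
proof -
  have "((\<lambda>y. \<theta> y $ v) has_derivative (\<lambda>h. frechet_derivative \<theta> (at x) h $ v)) (at x)"
    using assms by (intro bounded_linear.has_derivative[OF bounded_linear_vec_nth])
      (simp add: frechet_derivative_works[symmetric])
  then show ?thesis
    unfolding partial_def by (simp add: frechet_derivative_at[symmetric])
qed

text \<open>The factor \<open>C\<close> is the same for all forms and points, so it disappears from
  logarithmic derivatives and from the comparison of two contact forms.\<close>

lemma contact_vol_eq:
  assumes "CARD('n::{finite,linorder}) = 2 * l + 1"
  shows "\<exists>C. \<forall>\<theta> x. \<theta> differentiable (at x) \<longrightarrow>
    contact_vol l \<theta> (x :: (real, 'n) vec) = C * contact_sum l (form_coeffs \<theta> x) (ext_deriv_coeffs \<theta> x)"
proof -
  let ?L = "sorted_list_of_set (UNIV :: 'n set)"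
  let ?vs = "map (\<lambda>i. axis i (1::real)) ?L"
  have len: "length ?L = 2 * l + 1" using assms by simp
  obtain c where c: "\<And>\<beta> (vs :: ((real, 'n) vec) list). wedge_power 2 \<beta> l vs = c * (\<Sum>\<sigma> | \<sigma> permutes {..<2 * l}.
     of_int (sign \<sigma>) * (\<Prod>i<l. \<beta> [vs ! \<sigma> (2 * i), vs ! \<sigma> (2 * i + 1)]))"
    using wedge_power_2 by blast
  have "contact_vol l \<theta> x = c * contact_sum l (form_coeffs \<theta> x) (ext_deriv_coeffs \<theta> x)"
    if d: "\<theta> differentiable (at x)" for \<theta> and x :: "(real, 'n) vec"
  proof -
    have "contact_vol l \<theta> x = c / fact 1 * (\<Sum>\<sigma> | \<sigma> permutes {..<1 + 2 * l}.
      of_int (sign \<sigma>) * form1 \<theta> x (map (\<lambda>i. ?vs ! \<sigma> i) [0..<1]) *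
      (\<Prod>i<l. ext_deriv1 \<theta> x [?vs ! \<sigma> (1 + 2 * i), ?vs ! \<sigma> (1 + (2 * i + 1))]))"
      unfolding contact_vol_def
      by (rule wedge_of_alternation[where b = "\<lambda>h. \<Prod>i<l. ext_deriv1 \<theta> x [h (2 * i), h (2 * i + 1)]", OF c])
        (auto intro!: prod.cong)
    also have "\<dots> = c * (\<Sum>\<sigma> | \<sigma> permutes {..<2 * l + 1}.
      of_int (sign \<sigma>) * contact_term l (form_coeffs \<theta> x) (\<lambda>_. ext_deriv_coeffs \<theta> x) (\<lambda>i. ?L ! \<sigma> i))"
    proof -
      have "form1 \<theta> x (map (\<lambda>i. ?vs ! \<sigma> i) [0..<1]) *
          (\<Prod>i<l. ext_deriv1 \<theta> x [?vs ! \<sigma> (1 + 2 * i), ?vs ! \<sigma> (1 + (2 * i + 1))]) =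
          contact_term l (form_coeffs \<theta> x) (\<lambda>_. ext_deriv_coeffs \<theta> x) (\<lambda>i. ?L ! \<sigma> i)"
        if \<sigma>: "\<sigma> permutes {..<2 * l + 1}" for \<sigma>
      proof -
        have nth: "?vs ! \<sigma> k = axis (?L ! \<sigma> k) 1" if "k < 2 * l + 1" for k
        proof -
          have "\<sigma> k < 2 * l + 1" using permutes_in_image[OF \<sigma>, of k] that by simp
          then show ?thesis using len by simp
        qed
        have "form1 \<theta> x (map (\<lambda>i. ?vs ! \<sigma> i) [0..<1]) = form_coeffs \<theta> x (?L ! \<sigma> 0)"
          using nth[of 0] by (simp add: form1_def form_coeffs_def inner_axis)
        moreover have "ext_deriv1 \<theta> x [?vs ! \<sigma> (1 + 2 * i), ?vs ! \<sigma> (1 + (2 * i + 1))] =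
            ext_deriv_coeffs \<theta> x (?L ! \<sigma> (2 * i + 1)) (?L ! \<sigma> (2 * i + 2))" if "i < l" for i
          using nth[of "2 * i + 1"] nth[of "2 * i + 2"] that
          by (simp add: ext_deriv1_def ext_deriv_coeffs_def partial_vec_nth[OF d] inner_axis)
        ultimately show ?thesis by (simp add: contact_term_def)
      qed
      then show ?thesis
        by (simp add: add.commute mult.assoc del: upt_Suc)
    qed
    finally show ?thesis by (simp add: contact_sum_def alt_sum_def)
  qed
  then show ?thesis by blast
qed

section \<open>Linear connections and Killing forms in coordinates\<close>

lemma smooth_on_vec_nth:
  fixes f :: "'a::real_normed_vector \<Rightarrow> 'b::real_normed_vector^'n::finite"
  assumes "open S" "smooth_on S f"
  shows "smooth_on S (\<lambda>x. f x $ i)"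
  using assms(2) Ck_on_linear[OF bounded_linear_vec_nth assms(1)] unfolding smooth_on_def by blast

lemma Ck_on_partial: "Ck_on (Suc k) S f \<Longrightarrow> Ck_on k S (partial i f)"
  unfolding partial_def[abs_def] by simp

lemma partial_cong:
  assumes "open S" "x \<in> S" "f differentiable (at x)" "\<And>y. y \<in> S \<Longrightarrow> f y = g y"
  shows "partial i f x = partial i g x"
  unfolding partial_def using frechet_derivative_transform_within_open[OF assms(3,1,2,4)] by simp

lemma has_derivative_partial:
  "(f has_derivative f') (at x) \<Longrightarrow> partial i f x = f' (axis i 1)"
  unfolding partial_def by (simp add: frechet_derivative_at[symmetric])

lemma differentiable_has_derivative:
  "f differentiable (at x) \<Longrightarrow> (f has_derivative frechet_derivative f (at x)) (at x)"
  by (simp add: frechet_derivative_works[symmetric])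

lemma partial_add:
  assumes "f differentiable (at x)" "g differentiable (at x)"
  shows "partial i (\<lambda>y. f y + g y) x = partial i f x + partial i g x"
  using has_derivative_partial[OF has_derivative_add[OF assms[THEN differentiable_has_derivative]]]
  by (simp add: partial_def)

lemma partial_diff:
  assumes "f differentiable (at x)" "g differentiable (at x)"
  shows "partial i (\<lambda>y. f y - g y) x = partial i f x - partial i g x"
  using has_derivative_partial[OF has_derivative_diff[OF assms[THEN differentiable_has_derivative]]]
  by (simp add: partial_def)

lemma partial_mult:
  assumes "f differentiable (at x)" "g differentiable (at x)"
  shows "partial i (\<lambda>y. f y * g y) x = partial i f x * g x + f x * partial i g x"
  using has_derivative_partial[OF has_derivative_mult[OF assms[THEN differentiable_has_derivative]]]
  by (simp add: partial_def)

lemma partial_cmult: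
  assumes "f differentiable (at x)"
  shows "partial i (\<lambda>y. c * f y) x = c * partial i f x"
  using has_derivative_partial[OF has_derivative_mult_right[OF assms[THEN differentiable_has_derivative]]]
  by (simp add: partial_def)

lemma partial_sum:
  assumes "\<And>j. j \<in> J \<Longrightarrow> f j differentiable (at x)"
  shows "partial i (\<lambda>y. \<Sum>j\<in>J. f j y) x = (\<Sum>j\<in>J. partial i (f j) x)"
  using has_derivative_partial[OF has_derivative_sum[OF assms[THEN differentiable_has_derivative]]]
  by (simp add: partial_def)

lemma Ck_on_differentiable: "Ck_on (Suc k) S f \<Longrightarrow> x \<in> S \<Longrightarrow> f differentiable (at x)"
  by simp

lemma smooth_on_differentiable: "smooth_on S f \<Longrightarrow> x \<in> S \<Longrightarrow> f differentiable (at x)"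
  using Ck_on_differentiable unfolding smooth_on_def by blast

lemma smooth_on_partial: "smooth_on S f \<Longrightarrow> smooth_on S (partial i f)"
  unfolding smooth_on_def using Ck_on_partial by blast

lemma partial_commute:
  assumes "open S" "x \<in> S" "smooth_on S f"
  shows "partial i (partial j f) x = partial j (partial i f) x"
  using second_derivative_symmetric[OF assms(1,2), of f "axis j 1" "axis i 1"] assms(3)
  unfolding partial_def[abs_def] smooth_on_def by blast

definition kron :: "'n \<Rightarrow> 'n \<Rightarrow> real" where
  "kron i j = (if i = j then 1 else 0)"

lemma sum_kron:
  fixes l :: "'n::finite"
  shows "(\<Sum>m\<in>UNIV. kron l m * f m) = f l" "(\<Sum>m\<in>UNIV. kron m l * f m) = f l"
    "(\<Sum>m\<in>UNIV. f m * kron l m) = f l" "(\<Sum>m\<in>UNIV. f m * kron m l) = f l"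
  by (simp_all add: kron_def if_distrib[of "\<lambda>c. c * _"] if_distrib[of "\<lambda>c. _ * c"] cong: if_cong)

lemma kron_diag [simp]: "kron i i = 1"
  by (simp add: kron_def)

text \<open>The first index of \<open>G\<close> is the upper one; index conventions as for \<^const>\<open>riemann\<close>.\<close>

definition curvature_coeff ::
  "('n::finite \<Rightarrow> 'n \<Rightarrow> 'n \<Rightarrow> real^'n \<Rightarrow> real) \<Rightarrow> 'n \<Rightarrow> 'n \<Rightarrow> 'n \<Rightarrow> 'n \<Rightarrow> real^'n \<Rightarrow> real" where
  "curvature_coeff G l k i j x =
     partial i (G l j k) x - partial j (G l i k) x
     + (\<Sum>m\<in>UNIV. G l i m x * G m j k x - G l j m x * G m i k x)"

lemma riemann_eq_curvature_coeff: "riemann g = curvature_coeff (christoffel g)"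
  by (intro ext) (simp add: riemann_def curvature_coeff_def)

lemma curvature_coeff_antisym: "curvature_coeff G l k j i x = - curvature_coeff G l k i j x"
  by (simp add: curvature_coeff_def sum_subtractf)

lemma curvature_coeff_bianchi:
  assumes "open U" "x \<in> U"
    and G: "\<And>k i j. G k i j differentiable (at x)" "\<And>k i j y. y \<in> U \<Longrightarrow> G k i j y = G k j i y"
  shows "curvature_coeff G l k i j x + curvature_coeff G l i j k x + curvature_coeff G l j k i x = 0"
proof -
  have "G m j i x = G m i j x" "G m k i x = G m i k x" "G m k j x = G m j k x" for m
    by (rule G(2)[OF assms(2)])+
  moreover have "partial p (G m j i) x = partial p (G m i j) x" "partial p (G m k i) x = partial p (G m i k) x"
    "partial p (G m k j) x = partial p (G m j k) x" for m p
    by (rule partial_cong[OF assms(1,2) G(1)], erule G(2))+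
  ultimately show ?thesis
    unfolding curvature_coeff_def sum_subtractf by simp
qed

text \<open>\<open>Q\<close> is \<nabla>\<psi> - \<psi>\<otimes>\<psi>. For closed \<psi> the whole
  change consists of deltas between the upper index and \<open>i\<close> or \<open>j\<close>, the
  shape that constant curvature has as well.\<close>

lemma curvature_coeff_projective:
  fixes G G' :: "'n::finite \<Rightarrow> 'n \<Rightarrow> 'n \<Rightarrow> real^'n \<Rightarrow> real"
  assumes "open U" "x \<in> U"
    and G: "\<And>k i j. G k i j differentiable (at x)" "\<And>k i j y. y \<in> U \<Longrightarrow> G k i j y = G k j i y"
    and \<psi>: "\<And>i. \<psi> i differentiable (at x)"
    and G': "\<And>k i j y. y \<in> U \<Longrightarrow> G' k i j y = G k i j y + (kron k i * \<psi> j y + kron k j * \<psi> i y)"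
  defines "Q \<equiv> \<lambda>i k. partial i (\<psi> k) x - (\<Sum>m\<in>UNIV. G m i k x * \<psi> m x) - \<psi> i x * \<psi> k x"
  shows "curvature_coeff G' l k i j x = curvature_coeff G l k i j x
    + kron l j * Q i k - kron l i * Q j k + kron l k * (partial i (\<psi> j) x - partial j (\<psi> i) x)"
proof -
  have P: "partial i (G' k p q) x = partial i (G k p q) x + (kron k p * partial i (\<psi> q) x + kron k q * partial i (\<psi> p) x)"
    for i k p q
  proof -
    have "partial i (G' k p q) x = partial i (\<lambda>y. G k p q y + (kron k p * \<psi> q y + kron k q * \<psi> p y)) x"
      by (rule partial_cong[OF assms(1,2), symmetric]) (simp_all add: G \<psi> G')
    also have "\<dots> = partial i (G k p q) x + (partial i (\<lambda>y. kron k p * \<psi> q y) x + partial i (\<lambda>y. kron k q * \<psi> p y) x)"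
      by (simp add: partial_add G \<psi>)
    finally show ?thesis by (simp add: partial_cmult \<psi>)
  qed
  \<comment> \<open>All terms except the product of the two \<open>G\<close> and those with
    \<open>kron l i\<close> or \<open>kron l j\<close> are symmetric in \<open>i\<close> and
    \<open>j\<close>, and drop out of the curvature.\<close>
  have S: "(\<Sum>m\<in>UNIV. G' l i m x * G' m j k x) = (\<Sum>m\<in>UNIV. G l i m x * G m j k x)
      + \<psi> k x * G l i j x + \<psi> j x * G l i k x
      + kron l i * ((\<Sum>m\<in>UNIV. G m j k x * \<psi> m x) + 2 * \<psi> j x * \<psi> k x)
      + \<psi> i x * G l j k x + kron l j * \<psi> i x * \<psi> k x + kron l k * \<psi> i x * \<psi> j x" for i j
  proof -
    have "G' l i m x * G' m j k x = G l i m x * G m j k x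
        + kron m j * (\<psi> k x * G l i m x) + kron m k * (\<psi> j x * G l i m x)
        + kron l i * (G m j k x * \<psi> m x) + kron m j * (kron l i * \<psi> m x * \<psi> k x) + kron m k * (kron l i * \<psi> m x * \<psi> j x)
        + kron l m * (\<psi> i x * G m j k x) + kron l m * (kron m j * \<psi> i x * \<psi> k x) + kron l m * (kron m k * \<psi> i x * \<psi> j x)" for m
      by (simp add: G'[OF assms(2)] algebra_simps)
    then show ?thesis
      by (simp only: sum.distrib sum_kron sum_distrib_left[symmetric]) (simp add: algebra_simps)
  qed
  have sym: "G l j i x = G l i j x"
    by (rule G(2)[OF assms(2)])
  show ?thesis
    unfolding curvature_coeff_def sum_subtractf S P Q_def
    by (simp add: sym algebra_simps)
qed

text \<open>The traced delta terms give \<open>Q i j - Q j i\<close>, one more copy of the exterior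
  derivative of \<psi> besides the n copies from \<open>kron l k\<close>; hence n + 1.\<close>

lemma curvature_coeff_trace_projective:
  fixes G G' :: "'n::finite \<Rightarrow> 'n \<Rightarrow> 'n \<Rightarrow> real^'n \<Rightarrow> real"
  assumes "open U" "x \<in> U"
    and G: "\<And>k i j. G k i j differentiable (at x)" "\<And>k i j y. y \<in> U \<Longrightarrow> G k i j y = G k j i y"
    and \<psi>: "\<And>i. \<psi> i differentiable (at x)"
    and G': "\<And>k i j y. y \<in> U \<Longrightarrow> G' k i j y = G k i j y + (kron k i * \<psi> j y + kron k j * \<psi> i y)"
  shows "(\<Sum>l\<in>UNIV. curvature_coeff G' l l i j x) = (\<Sum>l\<in>UNIV. curvature_coeff G l l i j x)
    + (real CARD('n) + 1) * (partial i (\<psi> j) x - partial j (\<psi> i) x)"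
proof -
  have sym: "G m j i x = G m i j x" for m
    by (rule G(2)[OF assms(2)])
  show ?thesis
    by (simp only: curvature_coeff_projective[OF assms] sum.distrib sum_subtractf sum_kron kron_diag)
      (simp add: algebra_simps sym)
qed

definition antisym_deriv :: "('n::finite \<Rightarrow> real^'n \<Rightarrow> real) \<Rightarrow> 'n \<Rightarrow> 'n \<Rightarrow> real^'n \<Rightarrow> real" where
  "antisym_deriv a i j x = partial i (a j) x - partial j (a i) x"

lemma half_diff_half_sum: "a + b = 2 * s \<Longrightarrow> a = (a - b) / 2 + s" for a b s :: real
  by (simp add: field_simps)

text \<open>Obtained by differentiating the Killing equation and permuting the indices cyclically.\<close>

lemma killing_second_derivative:
  fixes G :: "'n::finite \<Rightarrow> 'n \<Rightarrow> 'n \<Rightarrow> real^'n \<Rightarrow> real"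
  assumes "open U" "x \<in> U"
    and G: "\<And>k i j. G k i j differentiable (at x)" "\<And>k i j y. y \<in> U \<Longrightarrow> G k i j y = G k j i y"
    and a: "\<And>i. smooth_on U (a i)"
    and K: "\<And>i j y. y \<in> U \<Longrightarrow> partial i (a j) y + partial j (a i) y = 2 * (\<Sum>l\<in>UNIV. G l i j y * a l y)"
  shows "partial k (antisym_deriv a i j) x = 2 * (\<Sum>l\<in>UNIV. curvature_coeff G l k i j x * a l x)
    + (\<Sum>l\<in>UNIV. G l k i x * antisym_deriv a l j x + G l k j x * antisym_deriv a i l x)"
proof -
  define D where "D p q r = partial p (partial q (a r)) x" for p q r
  define E where "E p q r = (\<Sum>l\<in>UNIV. partial p (G l q r) x * a l x + G l q r x * partial p (a l) x)" for p q r
  have da: "a i differentiable (at x)" for i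
    by (rule smooth_on_differentiable[OF a assms(2)])
  have dpa: "partial q (a r) differentiable (at x)" for q r
    by (rule smooth_on_differentiable[OF smooth_on_partial[OF a] assms(2)])
  have Dsym: "D p q r = D q p r" for p q r
    unfolding D_def by (rule partial_commute[OF assms(1,2) a])
  have DE: "D p q r + D p r q = 2 * E p q r" for p q r
  proof -
    have "D p q r + D p r q = partial p (\<lambda>y. partial q (a r) y + partial r (a q) y) x"
      unfolding D_def by (simp add: partial_add dpa)
    also have "\<dots> = partial p (\<lambda>y. 2 * (\<Sum>l\<in>UNIV. G l q r y * a l y)) x"
      by (rule partial_cong[OF assms(1,2)]) (simp_all add: K dpa)
    also have "\<dots> = 2 * (\<Sum>l\<in>UNIV. partial p (\<lambda>y. G l q r y * a l y) x)"
      by (subst partial_cmult, simp add: G da, subst partial_sum) (simp_all add: G da)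
    also have "\<dots> = 2 * E p q r"
      unfolding E_def by (simp add: partial_mult G da)
    finally show ?thesis .
  qed
  have pa: "partial p (a q) x = antisym_deriv a p q x / 2 + (\<Sum>m\<in>UNIV. G m p q x * a m x)" for p q
    using K[OF assms(2), of p q] unfolding antisym_deriv_def by (rule half_diff_half_sum)
  have "partial k (antisym_deriv a i j) x = D k i j - D k j i"
    unfolding antisym_deriv_def[abs_def] D_def by (rule partial_diff[OF dpa dpa])
  \<comment> \<open>The Killing equation for \<open>k\<close>, \<open>j\<close> differentiated along
    \<open>i\<close>, minus the one for \<open>k\<close>, \<open>i\<close> differentiated along
    \<open>j\<close>: the second derivative of \<open>a k\<close> along \<open>i\<close> and
    \<open>j\<close> cancels by symmetry.\<close>
  also have "\<dots> = 2 * E i k j - 2 * E j k i"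
    using DE[of i k j] DE[of j k i] Dsym[of k i j] Dsym[of k j i] Dsym[of i j k] by linarith
  finally have *: "partial k (antisym_deriv a i j) x = 2 * (E i k j - E j k i)" by simp
  \<comment> \<open>The Killing equation splits first derivatives of \<open>a\<close> into half the
    antisymmetric part and a \<open>G\<close> term; the resulting products of two \<open>G\<close>
    are the quadratic part of the curvature.\<close>
  have E2: "E p q r = (\<Sum>l\<in>UNIV. partial p (G l q r) x * a l x) + (\<Sum>l\<in>UNIV. G l q r x * antisym_deriv a p l x) / 2
      + (\<Sum>l\<in>UNIV. (\<Sum>m\<in>UNIV. G l p m x * G m q r x) * a l x)" for p q r
  proof -
    have "(\<Sum>l\<in>UNIV. G l q r x * (\<Sum>m\<in>UNIV. G m p l x * a m x)) =
        (\<Sum>m\<in>UNIV. \<Sum>l\<in>UNIV. G l q r x * (G m p l x * a m x))"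
      unfolding sum_distrib_left by (rule sum.swap)
    also have "\<dots> = (\<Sum>l\<in>UNIV. (\<Sum>m\<in>UNIV. G l p m x * G m q r x) * a l x)"
      unfolding sum_distrib_right by (simp add: mult_ac)
    finally show ?thesis
      unfolding E_def pa by (simp add: sum.distrib distrib_left sum_divide_distrib)
  qed
  have anti: "antisym_deriv a j l x = - antisym_deriv a l j x" for l
    by (simp add: antisym_deriv_def)
  have G_sym: "G l k i x = G l i k x" "G l k j x = G l j k x" for l
    by (rule G(2)[OF assms(2)])+
  have pG_sym: "partial p (G l k i) x = partial p (G l i k) x" "partial p (G l k j) x = partial p (G l j k) x" for l p
    by (rule partial_cong[OF assms(1,2) G(1)], erule G(2))+
  show ?thesis
    unfolding * E2 anti curvature_coeff_def sum_subtractf G_sym pG_sym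
    by (simp add: sum.distrib sum_subtractf sum_negf algebra_simps)
qed

text \<open>The second conclusion says that the top form is parallel for \<open>G\<close>: its
  derivative is the trace term alone. Hypothesis \<open>R\<close> says that the curvature applied to
  the form is the wedge of \<open>a\<close> and \<open>P\<close>.\<close>

lemma contact_sum_deriv:
  fixes G :: "'n::{finite,linorder} \<Rightarrow> 'n \<Rightarrow> 'n \<Rightarrow> (real, 'n) vec \<Rightarrow> real"
  assumes "CARD('n) = 2 * l + 1" "open U" "x \<in> U"
    and G: "\<And>k i j. G k i j differentiable (at x)" "\<And>k i j y. y \<in> U \<Longrightarrow> G k i j y = G k j i y"
    and a: "\<And>i. smooth_on U (a i)"
    and K: "\<And>i j y. y \<in> U \<Longrightarrow> partial i (a j) y + partial j (a i) y = 2 * (\<Sum>m\<in>UNIV. G m i j y * a m y)"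
    and R: "\<And>i j. (\<Sum>m\<in>UNIV. curvature_coeff G m k i j x * a m x) = a i x * P j - a j x * P i"
  defines "h \<equiv> \<lambda>y. contact_sum l (\<lambda>i. a i y) (\<lambda>i j. antisym_deriv a i j y)"
  shows "h differentiable (at x)" "partial k h x = (\<Sum>m\<in>UNIV. G m k m x) * h x"
proof -
  let ?n = "2 * l + 1"
  let ?e = "\<lambda>i. sorted_list_of_set (UNIV :: 'n set) ! i"
  let ?a = "\<lambda>i. a i x" and ?B = "\<lambda>i j. antisym_deriv a i j x"
  let ?D = "\<lambda>f. frechet_derivative f (at x)"
  let ?A = "alt_sum ?n ?e"
  have e: "bij_betw ?e {..<?n} UNIV"
    using bij_betw_sorted_list_of_UNIV assms(1) by metis
  have da: "a i differentiable (at x)" for i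
    by (rule smooth_on_differentiable[OF a assms(3)])
  have dpa: "partial q (a r) differentiable (at x)" for q r
    by (rule smooth_on_differentiable[OF smooth_on_partial[OF a] assms(3)])
  have dB: "antisym_deriv a i j differentiable (at x)" for i j
    unfolding antisym_deriv_def[abs_def] by (intro differentiable_diff dpa)
  have h: "(h has_derivative (\<lambda>v. ?A (\<lambda>f. contact_term l (\<lambda>u. ?D (a u) v) (\<lambda>_. ?B) f +
      (\<Sum>i<l. contact_term l ?a ((\<lambda>_. ?B)(i := \<lambda>u w. ?D (antisym_deriv a u w) v)) f)))) (at x)"
    unfolding h_def contact_sum_def
    by (rule has_derivative_alt_sum_contact_term) (intro differentiable_has_derivative da dB)+
  then show "h differentiable (at x)"
    unfolding differentiable_def by blast
  let ?G = "\<lambda>u m. G m k u x"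
  have 1: "?D (a u) (axis k 1) = ?B k u / 2 + (\<Sum>m\<in>UNIV. ?G u m * ?a m)" for u
    using K[OF assms(3), of k u] unfolding antisym_deriv_def partial_def by (rule half_diff_half_sum)
  have 2: "?D (antisym_deriv a u w) (axis k 1) =
      (?a u * (2 * P w) - ?a w * (2 * P u)) + (\<Sum>m\<in>UNIV. ?G u m * ?B m w + ?G w m * ?B u m)" for u w
    using killing_second_derivative[OF assms(2,3) G a K, of k u w]
    unfolding R by (simp add: partial_def algebra_simps)
  have "partial k h x = ?A (\<lambda>f. contact_term l (\<lambda>u. ?B k u / 2 + (\<Sum>m\<in>UNIV. ?G u m * ?a m)) (\<lambda>_. ?B) f +
      (\<Sum>i<l. contact_term l ?a ((\<lambda>_. ?B)(i := \<lambda>u w. (?a u * (2 * P w) - ?a w * (2 * P u))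
        + (\<Sum>m\<in>UNIV. ?G u m * ?B m w + ?G w m * ?B u m))) f))"
    unfolding has_derivative_partial[OF h] 1 2 ..
  \<comment> \<open>Regrouped for three algebraic facts: a contraction of d\<theta>, a wedge
    containing \<open>a\<close> twice, and the connection acting as a derivation. The first two
    vanish under alternation.\<close>
  also have "\<dots> = ?A (\<lambda>f. (1 / 2) * contact_term l (?B k) (\<lambda>_. ?B) f +
      ((\<Sum>i<l. contact_term l ?a ((\<lambda>_. ?B)(i := \<lambda>u w. ?a u * (2 * P w) - ?a w * (2 * P u))) f)
      + (contact_term l (\<lambda>u. \<Sum>m\<in>UNIV. ?G u m * ?a m) (\<lambda>_. ?B) f +
      (\<Sum>i<l. contact_term l ?a ((\<lambda>_. ?B)(i := \<lambda>u w. \<Sum>m\<in>UNIV. ?G u m * ?B m w + ?G w m * ?B u m)) f))))"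
  proof (rule alt_sum_cong)
    fix \<sigma> :: "nat \<Rightarrow> nat"
    let ?f = "\<lambda>i. ?e (\<sigma> i)"
    have p: "contact_term l (\<lambda>u. ?B k u / 2 + (\<Sum>m\<in>UNIV. ?G u m * ?a m)) (\<lambda>_. ?B) ?f =
        (1 / 2) * contact_term l (?B k) (\<lambda>_. ?B) ?f + contact_term l (\<lambda>u. \<Sum>m\<in>UNIV. ?G u m * ?a m) (\<lambda>_. ?B) ?f"
      by (simp add: contact_term_def distrib_right)
    have q: "contact_term l ?a ((\<lambda>_. ?B)(i := \<lambda>u w. U u w + V u w)) ?f =
        contact_term l ?a ((\<lambda>_. ?B)(i := U)) ?f + contact_term l ?a ((\<lambda>_. ?B)(i := V)) ?f" if "i < l" for i U V
      unfolding contact_term_upd[OF that] by (simp add: distrib_left distrib_right)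
    have "(\<Sum>i<l. contact_term l ?a ((\<lambda>_. ?B)(i := \<lambda>u w. U u w + V u w)) ?f) =
        (\<Sum>i<l. contact_term l ?a ((\<lambda>_. ?B)(i := U)) ?f) + (\<Sum>i<l. contact_term l ?a ((\<lambda>_. ?B)(i := V)) ?f)" for U V
      unfolding sum.distrib[symmetric] by (rule sum.cong[OF refl], rule q) simp
    from this[of "\<lambda>u w. ?a u * (2 * P w) - ?a w * (2 * P u)" "\<lambda>u w. \<Sum>m\<in>UNIV. ?G u m * ?B m w + ?G w m * ?B u m"] p
    show "contact_term l (\<lambda>u. ?B k u / 2 + (\<Sum>m\<in>UNIV. ?G u m * ?a m)) (\<lambda>_. ?B) ?f +
      (\<Sum>i<l. contact_term l ?a ((\<lambda>_. ?B)(i := \<lambda>u w. (?a u * (2 * P w) - ?a w * (2 * P u))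
        + (\<Sum>m\<in>UNIV. ?G u m * ?B m w + ?G w m * ?B u m))) ?f) =
      (1 / 2) * contact_term l (?B k) (\<lambda>_. ?B) ?f +
      ((\<Sum>i<l. contact_term l ?a ((\<lambda>_. ?B)(i := \<lambda>u w. ?a u * (2 * P w) - ?a w * (2 * P u))) ?f)
      + (contact_term l (\<lambda>u. \<Sum>m\<in>UNIV. ?G u m * ?a m) (\<lambda>_. ?B) ?f +
      (\<Sum>i<l. contact_term l ?a ((\<lambda>_. ?B)(i := \<lambda>u w. \<Sum>m\<in>UNIV. ?G u m * ?B m w + ?G w m * ?B u m)) ?f)))"
      by (simp only: add_ac)
  qed
  also have "\<dots> = (1 / 2) * ?A (contact_term l (?B k) (\<lambda>_. ?B)) +
      ((\<Sum>i<l. ?A (contact_term l ?a ((\<lambda>_. ?B)(i := \<lambda>u w. ?a u * (2 * P w) - ?a w * (2 * P u)))))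
      + ?A (\<lambda>f. \<Sum>m<?n. \<Sum>x\<in>UNIV. ?G (f m) x * contact_term l ?a (\<lambda>_. ?B) (f(m := x))))"
    unfolding alt_sum_add alt_sum_scale alt_sum_sum[symmetric] contact_term_derivation ..
  also have "\<dots> = (\<Sum>m\<in>UNIV. ?G m m) * h x"
  proof -
    have "?A (contact_term l (?B k) (\<lambda>_. ?B)) = 0"
      by (rule alt_sum_contact_term_contraction[OF e]) (simp add: antisym_deriv_def)
    moreover have "(\<Sum>i<l. ?A (contact_term l ?a ((\<lambda>_. ?B)(i := \<lambda>u w. ?a u * (2 * P w) - ?a w * (2 * P u))))) = 0"
      by (rule sum.neutral, rule ballI, rule alt_sum_contact_term_wedge) simp
    moreover have "?A (\<lambda>f. \<Sum>m<?n. \<Sum>y\<in>UNIV. ?G (f m) y * contact_term l ?a (\<lambda>_. ?B) (f(m := y))) =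
        (\<Sum>m\<in>UNIV. ?G m m) * ?A (contact_term l ?a (\<lambda>_. ?B))"
      by (rule alt_sum_trace[OF e])
    ultimately show ?thesis
      unfolding h_def contact_sum_def by (simp only: mult_zero_right add_0_left)
  qed
  finally show "partial k h x = (\<Sum>m\<in>UNIV. G m k m x) * h x" .
qed

section \<open>Levi-Civita connections\<close>

lemma matrix_inv_sums:
  fixes A :: "real^'n^'n::finite"
  assumes "invertible A"
  shows "(\<Sum>k\<in>UNIV. A $ i $ k * matrix_inv A $ k $ j) = kron i j"
    and "(\<Sum>k\<in>UNIV. matrix_inv A $ i $ k * A $ k $ j) = kron i j"
  using arg_cong[OF matrix_mul_matrix_inv[OF assms], of "\<lambda>M. M $ i $ j"]
    arg_cong[OF matrix_inv_mul_matrix[OF assms], of "\<lambda>M. M $ i $ j"]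
  by (simp_all add: matrix_matrix_mult_def mat_def kron_def)

lemma matrix_inv_symmetric:
  fixes A :: "real^'n^'n::finite"
  assumes "invertible A" "transpose A = A"
  shows "transpose (matrix_inv A) = matrix_inv A"
proof -
  let ?M = "matrix_inv A"
  have "transpose ?M ** A = transpose (transpose A ** ?M)"
    by (simp add: matrix_transpose_mul)
  also have "\<dots> = mat 1"
    using assms by (simp add: matrix_mul_matrix_inv transpose_mat)
  finally have "transpose ?M ** A = mat 1" .
  then have "transpose ?M ** (A ** ?M) = ?M"
    by (simp add: matrix_mul_assoc)
  then show ?thesis
    using assms by (simp add: matrix_mul_matrix_inv)
qed

text \<open>The components of a metric in one chart, so that tensor calculus takes place on an open
  set of coordinates without an atlas.\<close>

locale local_metric =
  fixes U :: "(real^'n::finite) set" and g :: "real^'n \<Rightarrow> real^'n^'n"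
  assumes open_U: "open U" and smooth_g: "smooth_on U g"
    and symmetric: "x \<in> U \<Longrightarrow> transpose (g x) = g x"
    and invertible: "x \<in> U \<Longrightarrow> invertible (g x)"
begin

lemma smooth_nth: "smooth_on U (\<lambda>x. g x $ i $ j)"
  by (rule smooth_on_vec_nth[OF open_U smooth_on_vec_nth[OF open_U smooth_g]])

lemma nth_commute: "x \<in> U \<Longrightarrow> g x $ j $ i = g x $ i $ j"
  using symmetric[of x] by (metis transpose_def vec_lambda_beta)

lemma differentiable_nth: "x \<in> U \<Longrightarrow> (\<lambda>y. g y $ i $ j) differentiable (at x)"
  by (rule smooth_on_differentiable[OF smooth_nth])

lemma partial_nth_commute: "x \<in> U \<Longrightarrow> partial p (\<lambda>y. g y $ j $ i) x = partial p (\<lambda>y. g y $ i $ j) x"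
  by (rule partial_cong[OF open_U _ differentiable_nth nth_commute])

lemma matrix_inv_nth_commute:
  assumes "x \<in> U"
  shows "matrix_inv (g x) $ j $ i = matrix_inv (g x) $ i $ j"
  using arg_cong[OF matrix_inv_symmetric[OF invertible[OF assms] symmetric[OF assms]], of "\<lambda>M. M $ i $ j"]
  by (simp add: transpose_def)

lemma christoffel_smooth: "smooth_on U (christoffel g k i j)"
proof -
  have "Ck_on q U (\<lambda>x. (\<Sum>l\<in>UNIV. matrix_inv (g x) $ k $ l *
        (partial i (\<lambda>y. g y $ j $ l) x + partial j (\<lambda>y. g y $ i $ l) x
         - partial l (\<lambda>y. g y $ i $ j) x)) * (1 / 2))" for q
    using smooth_nth smooth_on_partial[OF smooth_nth]
    by (intro Ck_on_mult Ck_on_sum Ck_on_add Ck_on_minus Ck_on_matrix_inv Ck_on_const open_U invertible)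
      (simp_all add: smooth_on_def)
  then show ?thesis
    unfolding smooth_on_def christoffel_def[abs_def] by simp
qed

lemma differentiable_christoffel: "x \<in> U \<Longrightarrow> christoffel g k i j differentiable (at x)"
  by (rule smooth_on_differentiable[OF christoffel_smooth])

lemma christoffel_commute: "x \<in> U \<Longrightarrow> christoffel g k i j x = christoffel g k j i x"
  unfolding christoffel_def by (simp add: partial_nth_commute[of x _ j i] add.commute)

lemma christoffel_lower:
  assumes "x \<in> U"
  shows "(\<Sum>k\<in>UNIV. g x $ l $ k * christoffel g k i j x) =
    (partial i (\<lambda>y. g y $ j $ l) x + partial j (\<lambda>y. g y $ i $ l) x - partial l (\<lambda>y. g y $ i $ j) x) / 2"
proof -
  let ?c = "\<lambda>m. partial i (\<lambda>y. g y $ j $ m) x + partial j (\<lambda>y. g y $ i $ m) x - partial m (\<lambda>y. g y $ i $ j) x"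
  have "(\<Sum>k\<in>UNIV. g x $ l $ k * christoffel g k i j x) =
      (\<Sum>k\<in>UNIV. \<Sum>m\<in>UNIV. g x $ l $ k * matrix_inv (g x) $ k $ m * ?c m) / 2"
    unfolding christoffel_def by (simp add: sum_distrib_left sum_divide_distrib mult.assoc)
  also have "(\<Sum>k\<in>UNIV. \<Sum>m\<in>UNIV. g x $ l $ k * matrix_inv (g x) $ k $ m * ?c m) =
      (\<Sum>m\<in>UNIV. \<Sum>k\<in>UNIV. g x $ l $ k * matrix_inv (g x) $ k $ m * ?c m)"
    by (rule sum.swap)
  also have "\<dots> = (\<Sum>m\<in>UNIV. kron l m * ?c m)"
    by (simp only: sum_distrib_right[symmetric] matrix_inv_sums[OF invertible[OF assms]])
  also have "\<dots> = ?c l"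
    by (rule sum_kron)
  finally show ?thesis .
qed

text \<open>Parallelism of \<open>g\<close> for its own connection, solved for the partial
  derivative so that it can be differentiated again.\<close>

lemma metric_compatible:
  assumes "x \<in> U"
  shows "partial p (\<lambda>y. g y $ q $ r) x =
    (\<Sum>m\<in>UNIV. g x $ q $ m * christoffel g m p r x) + (\<Sum>m\<in>UNIV. g x $ r $ m * christoffel g m p q x)"
  unfolding christoffel_lower[OF assms]
  using partial_nth_commute[OF assms, of p r q] by (simp add: field_simps)

text \<open>Second partial derivatives of \<open>g\<close> commute; expressed through
  \<open>metric_compatible\<close> this is the Ricci identity for the parallel tensor
  \<open>g\<close>.\<close>

lemma riemann_lower_antisym:
  assumes x: "x \<in> U"
  shows "(\<Sum>l\<in>UNIV. g x $ w $ l * riemann g l k i j x) = - (\<Sum>l\<in>UNIV. g x $ k $ l * riemann g l w i j x)"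
proof -
  let ?\<Gamma> = "christoffel g"
  define A where "A i j w k = (\<Sum>m\<in>UNIV. g x $ w $ m * partial i (?\<Gamma> m j k) x)" for i j w k
  define H where "H i j w k = (\<Sum>m\<in>UNIV. \<Sum>p\<in>UNIV. g x $ w $ p * ?\<Gamma> p i m x * ?\<Gamma> m j k x)" for i j w k
  define X where "X i j w k = (\<Sum>m\<in>UNIV. \<Sum>p\<in>UNIV. g x $ m $ p * ?\<Gamma> p i w x * ?\<Gamma> m j k x)" for i j w k
  note d = differentiable_nth[OF x] differentiable_christoffel[OF x]
  \<comment> \<open>In the difference of the two orders of differentiation, the terms
    \<open>X\<close> for \<open>w\<close>, \<open>k\<close> cancel against those for
    \<open>k\<close>, \<open>w\<close>.\<close>
  have X_swap: "X i j k w = X j i w k" for i j w k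
  proof -
    have "X i j k w = (\<Sum>p\<in>UNIV. \<Sum>m\<in>UNIV. g x $ m $ p * ?\<Gamma> p i k x * ?\<Gamma> m j w x)"
      unfolding X_def by (rule sum.swap)
    also have "\<dots> = X j i w k"
      unfolding X_def by (intro sum.cong refl) (simp add: nth_commute[OF x] mult_ac)
    finally show ?thesis .
  qed
  have half: "partial i (\<lambda>y. \<Sum>m\<in>UNIV. g y $ w $ m * ?\<Gamma> m j k y) x = A i j w k + H i j w k + X i j w k" for i j w k
  proof -
    have "partial i (\<lambda>y. \<Sum>m\<in>UNIV. g y $ w $ m * ?\<Gamma> m j k y) x =
        (\<Sum>m\<in>UNIV. partial i (\<lambda>y. g y $ w $ m) x * ?\<Gamma> m j k x + g x $ w $ m * partial i (?\<Gamma> m j k) x)"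
      by (subst partial_sum) (simp_all add: partial_mult d)
    also have "\<dots> = A i j w k + H i j w k + X i j w k"
      unfolding metric_compatible[OF x] A_def H_def X_def
      by (simp add: sum.distrib distrib_right sum_distrib_right)
    finally show ?thesis .
  qed
  have DD: "partial i (partial j (\<lambda>y. g y $ w $ k)) x =
      (A i j w k + H i j w k + X i j w k) + (A i j k w + H i j k w + X i j k w)" for i j
  proof -
    have "partial i (partial j (\<lambda>y. g y $ w $ k)) x = partial i (\<lambda>y.
        (\<Sum>m\<in>UNIV. g y $ w $ m * ?\<Gamma> m j k y) + (\<Sum>m\<in>UNIV. g y $ k $ m * ?\<Gamma> m j w y)) x"
      by (rule partial_cong[OF open_U x smooth_on_differentiable[OF smooth_on_partial[OF smooth_nth] x]])
        (rule metric_compatible)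
    also have "\<dots> = (A i j w k + H i j w k + X i j w k) + (A i j k w + H i j k w + X i j k w)"
      by (subst partial_add) (simp_all add: d half)
    finally show ?thesis .
  qed
  have R: "(\<Sum>l\<in>UNIV. g x $ w $ l * riemann g l k i j x) = A i j w k + H i j w k - (A j i w k + H j i w k)" for w k
  proof -
    have "(\<Sum>l\<in>UNIV. g x $ w $ l * (\<Sum>m\<in>UNIV. ?\<Gamma> l i m x * ?\<Gamma> m j k x)) = H i j w k" for i j
      unfolding H_def sum_distrib_left by (subst sum.swap) (simp add: mult.assoc)
    then show ?thesis
      unfolding riemann_def A_def by (simp add: sum_subtractf sum.distrib distrib_left right_diff_distrib)
  qed
  show ?thesis
    unfolding R using partial_commute[OF open_U x smooth_nth, of i j w k] DD[of i j] DD[of j i]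
      X_swap[of i j k w] X_swap[of j i k w] by linarith
qed

text \<open>An antisymmetric form contracted with the symmetric inverse metric vanishes.
  Geometrically, the metric volume is parallel, so the curvature induced on densities is zero; this
  is what forces \<psi> to be closed.\<close>

lemma riemann_trace_eq_0:
  assumes x: "x \<in> U"
  shows "(\<Sum>l\<in>UNIV. riemann g l l i j x) = 0"
proof -
  let ?M = "matrix_inv (g x)"
  let ?L = "\<lambda>w k. \<Sum>l\<in>UNIV. g x $ w $ l * riemann g l k i j x"
  have raise: "riemann g l k i j x = (\<Sum>w\<in>UNIV. ?M $ l $ w * ?L w k)" for l k
  proof -
    have "(\<Sum>w\<in>UNIV. ?M $ l $ w * ?L w k) = (\<Sum>w\<in>UNIV. \<Sum>m\<in>UNIV. (?M $ l $ w * g x $ w $ m) * riemann g m k i j x)"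
      by (simp add: sum_distrib_left mult.assoc)
    also have "\<dots> = (\<Sum>m\<in>UNIV. \<Sum>w\<in>UNIV. (?M $ l $ w * g x $ w $ m) * riemann g m k i j x)"
      by (rule sum.swap)
    also have "\<dots> = (\<Sum>m\<in>UNIV. kron l m * riemann g m k i j x)"
      by (simp only: sum_distrib_right[symmetric] matrix_inv_sums[OF invertible[OF x]])
    finally show ?thesis by (simp only: sum_kron)
  qed
  have "(\<Sum>l\<in>UNIV. riemann g l l i j x) = (\<Sum>l\<in>UNIV. \<Sum>w\<in>UNIV. ?M $ l $ w * ?L w l)"
    by (rule sum.cong[OF refl raise])
  also have "\<dots> = (\<Sum>w\<in>UNIV. \<Sum>l\<in>UNIV. ?M $ l $ w * ?L w l)"
    by (rule sum.swap)
  also have "\<dots> = (\<Sum>w\<in>UNIV. \<Sum>l\<in>UNIV. - (?M $ w $ l * ?L l w))"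
  proof (intro sum.cong refl)
    fix w l
    show "?M $ l $ w * ?L w l = - (?M $ w $ l * ?L l w)"
      using riemann_lower_antisym[OF x, of w l i j] matrix_inv_nth_commute[OF x, of l w] by simp
  qed
  also have "\<dots> = - (\<Sum>w\<in>UNIV. \<Sum>l\<in>UNIV. ?M $ w $ l * ?L l w)"
    by (simp only: sum_negf)
  also have "(\<Sum>w\<in>UNIV. \<Sum>l\<in>UNIV. ?M $ w $ l * ?L l w) = (\<Sum>l\<in>UNIV. riemann g l l i j x)"
    by (rule sum.cong[OF refl raise[symmetric]])
  finally show ?thesis by simp
qed

end

section \<open>Recovering the curvature tensor from sectional curvature\<close>

lemma gprod_add_left: "gprod G (u + v) w = gprod G u w + gprod G v w"
  by (simp add: gprod_def inner_add_left)

lemma gprod_add_right: "gprod G w (u + v) = gprod G w u + gprod G w v"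
  by (simp add: gprod_def inner_add_right matrix_vector_right_distrib)

lemma gprod_scaleR_left: "gprod G (c *\<^sub>R u) v = c * gprod G u v"
  by (simp add: gprod_def)

lemma gprod_scaleR_right: "gprod G u (c *\<^sub>R v) = c * gprod G u v"
  by (simp add: gprod_def matrix_vector_mult_scaleR)

lemma gprod_commute: "transpose G = G \<Longrightarrow> gprod G u v = gprod G v u"
  unfolding gprod_def by (metis dot_lmul_matrix inner_commute transpose_matrix_vector)

lemma gprod_axis: "gprod G (axis i 1) (axis j 1) = G $ i $ j"
  by (simp add: gprod_def matrix_vector_mul_component inner_axis' inner_axis matrix_vector_mult_basis column_def)

lemma curvature_op_add:
  "curvature_op g x (X + X') Y Z = curvature_op g x X Y Z + curvature_op g x X' Y Z"
  "curvature_op g x X (Y + Y') Z = curvature_op g x X Y Z + curvature_op g x X Y' Z"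
  "curvature_op g x X Y (Z + Z') = curvature_op g x X Y Z + curvature_op g x X Y Z'"
  by (simp_all add: curvature_op_def vec_eq_iff sum.distrib algebra_simps)

lemma curvature_op_axis: "curvature_op g x (axis a 1) (axis b 1) (axis c 1) = (\<chi> l. riemann g l c a b x)"
proof -
  have ax: "axis a (1::real) $ i = kron a i" for a i :: "'n::finite"
    by (simp add: axis_def kron_def eq_commute)
  show ?thesis
    unfolding curvature_op_def ax by (simp only: sum_kron)
qed

text \<open>An algebraic curvature tensor is determined by its sectional values, by polarisation.
  Additivity of \<open>F\<close> suffices, since the test vectors are basis vectors and sums of two
  of them.\<close>

lemma curvature_like_eq_0:
  fixes F :: "real^'n::finite \<Rightarrow> real^'n \<Rightarrow> real^'n \<Rightarrow> real^'n \<Rightarrow> real"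
  assumes add: "\<And>X X' Y Z W. F (X + X') Y Z W = F X Y Z W + F X' Y Z W"
    "\<And>X Y Y' Z W. F X (Y + Y') Z W = F X Y Z W + F X Y' Z W"
    "\<And>X Y Z Z' W. F X Y (Z + Z') W = F X Y Z W + F X Y Z' W"
    "\<And>X Y Z W W'. F X Y Z (W + W') = F X Y Z W + F X Y Z W'"
    and sec: "\<And>X Y. F X Y Y X = 0"
  defines "S \<equiv> \<lambda>a b c d. F (axis a 1) (axis b 1) (axis c 1) (axis d 1)"
  assumes anti1: "\<And>a b c d. S b a c d = - S a b c d"
    and anti2: "\<And>a b c d. S a b d c = - S a b c d"
    and bianchi: "\<And>a b c d. S a b c d + S b c a d + S c a b d = 0"
  shows "S a b c d = 0"
proof -
  \<comment> \<open>The octahedron argument: four Bianchi identities combined by means of the two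
    antisymmetries.\<close>
  have pair: "S a b c d = S c d a b" for a b c d
    using bianchi[of a b c d] bianchi[of b c d a] bianchi[of c d a b] bianchi[of d a b c]
      anti1[of a b c d] anti1[of b c a d] anti1[of c a b d] anti1[of c d b a] anti1[of d b c a]
      anti1[of a c d b] anti1[of d a c b] anti1[of b d a c] anti1[of d a b c] anti1[of a b d c]
      anti2[of a b c d] anti2[of b c a d] anti2[of c a b d] anti2[of b c d a] anti2[of c d b a] anti2[of d b c a]
      anti2[of c d a b] anti2[of d a c b] anti2[of a c d b] anti2[of d a b c] anti2[of a b d c] anti2[of b d a c]
    by linarith
  have aa: "S a b b a = 0" for a b
    unfolding S_def by (rule sec)
  have ad: "S a b b d = 0" for a b d
  proof -
    have "S a b b d + S d b b a = 0"
      using sec[of "axis a 1 + axis d 1" "axis b 1"] aa[of a b] aa[of d b]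
      unfolding add S_def by linarith
    moreover have "S d b b a = S a b b d"
      using pair[of d b b a] anti1[of a b d b] anti2[of a b b d] anti1[of b a d b] by linarith
    ultimately show ?thesis by linarith
  qed
  have bc: "S a b c d = - S a c b d" for a b c d
  proof -
    have 1: "S a b c a + S a c b a = 0" for a b c
      using sec[of "axis a 1" "axis b 1 + axis c 1"] aa[of a b] aa[of a c]
      unfolding add S_def by linarith
    have "S a b c d + S a c b d + S d b c a + S d c b a = 0"
      using sec[of "axis a 1 + axis d 1" "axis b 1 + axis c 1"] 1[of a b c] 1[of d b c]
        ad[of a b d] ad[of a c d] ad[of d b a] ad[of d c a] aa[of a b] aa[of a c] aa[of d b] aa[of d c]
      unfolding add S_def by linarith
    moreover have "S d b c a = S a c b d"
      using pair[of d b c a] anti1[of a c d b] anti2[of a c b d] by linarith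
    moreover have "S d c b a = S a b c d"
      using pair[of d c b a] anti1[of a b d c] anti2[of a b c d] by linarith
    ultimately show ?thesis by linarith
  qed
  \<comment> \<open>With \<open>bc\<close>, \<open>S\<close> is alternating in its first three
    indices, so the three Bianchi terms are equal and 3 S = 0.\<close>
  show ?thesis
    using bianchi[of a b c d] bc[of a b c d] bc[of a c b d] anti1[of b a c d] bc[of b c a d] anti1[of a c b d] anti1[of a b c d]
    by linarith
qed

text \<open>Otherwise the complement of a vector \<open>X\<close> with nonzero square would be
  totally isotropic, and a nonzero vector in it would be orthogonal to everything.\<close>

lemma gram2_nonzero_exists:
  fixes G :: "real^'n^'n::finite"
  assumes "transpose G = G" "invertible G" "CARD('n) \<ge> 2"
  shows "\<exists>X Y. gram2 G X Y \<noteq> 0"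
proof (rule ccontr)
  assume "\<not> ?thesis"
  then have zero: "gram2 G X Y = 0" for X Y by blast
  have nondeg: "Y = 0" if "\<And>Z. gprod G Z Y = 0" for Y
  proof -
    have "G *v Y = 0"
      using that[of "G *v Y"] by (simp add: gprod_def)
    then have "matrix_inv G *v (G *v Y) = 0" by simp
    then show ?thesis
      using matrix_inv_mul_matrix[OF assms(2)] by (simp add: matrix_vector_mul_assoc)
  qed
  note comm = gprod_commute[OF assms(1)]
  have "\<exists>X. gprod G X X \<noteq> 0"
  proof (rule ccontr)
    assume "\<not> ?thesis"
    then have "gprod G X X = 0" for X by blast
    then have "gprod G X Y = 0" for X Y
      using comm[of X Y] \<open>\<And>X. gprod G X X = 0\<close>[of "X + Y"]
      by (simp add: gprod_add_left gprod_add_right)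
    then have "axis undefined 1 = (0 :: real^'n)" using nondeg by blast
    then show False by (simp add: axis_eq_0_iff)
  qed
  then obtain X where X: "gprod G X X \<noteq> 0" by blast
  have perp0: "gprod G Y Y = 0" if "gprod G X Y = 0" for Y
    using zero[of X Y] X that by (simp add: gram2_def)
  \<comment> \<open>Euclidean orthogonality to \<open>G *v X\<close> is
    \<open>G\<close>-orthogonality to \<open>X\<close>; dimension at least 2 provides a nonzero such
    vector.\<close>
  obtain Y where Y: "Y \<noteq> 0" "orthogonal (G *v X) Y"
    using orthogonal_to_vector_exists[of "G *v X"] assms(3) by auto
  have XY: "gprod G X Y = 0"
    using Y(2) comm[of X Y] by (simp add: gprod_def orthogonal_def inner_commute)
  have "gprod G Z Y = 0" for Z
  proof -
    \<comment> \<open>\<open>Z\<close> is split into a multiple of \<open>X\<close> and a part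
      \<open>V\<close> orthogonal to \<open>X\<close>. As \<open>V\<close>, \<open>Y\<close> and
      \<open>V + Y\<close> are all null, polarisation makes \<open>V\<close> and \<open>Y\<close>
      orthogonal.\<close>
    define c where "c = gprod G X Z / gprod G X X"
    define V where "V = Z - c *\<^sub>R X"
    have Z: "Z = V + c *\<^sub>R X" by (simp add: V_def)
    have "gprod G X Z = gprod G X V + c * gprod G X X"
      by (subst Z) (simp add: gprod_add_right gprod_scaleR_right)
    then have XV: "gprod G X V = 0"
      using X by (simp add: c_def)
    then have "gprod G (V + Y) (V + Y) = 0"
      using XY by (intro perp0) (simp add: gprod_add_right)
    then have "gprod G V Y = 0"
      using perp0[OF XV] perp0[OF XY] comm[of V Y] by (simp add: gprod_add_left gprod_add_right)
    then show ?thesis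
      using XY by (subst Z) (simp add: gprod_add_left gprod_scaleR_left)
  qed
  then show False using nondeg Y(1) by blast
qed

lemma gprod_line_poly:
  "\<exists>p. \<forall>t. gprod G (X + t *\<^sub>R A) (Y + t *\<^sub>R B) = poly p t"
  by (rule exI[of _ "[: gprod G X Y, gprod G X B + gprod G A Y, gprod G A B :]"])
    (simp add: gprod_add_left gprod_add_right gprod_scaleR_left gprod_scaleR_right algebra_simps)

text \<open>The difference \<open>F\<close> between the curvature and its model has zero sectional
  values on nondegenerate planes, then by continuity on all pairs, and therefore vanishes as an
  algebraic curvature tensor.\<close>

lemma constant_curvature_riemann:
  fixes g :: "real^'n::finite \<Rightarrow> real^'n^'n"
  assumes "local_metric U g" and x: "x \<in> U" and n: "CARD('n) \<ge> 2"
    and sec: "\<And>X Y. gram2 (g x) X Y \<noteq> 0 \<Longrightarrow> sectional_curvature g x X Y = \<kappa>"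
  shows "riemann g l k i j x = \<kappa> * (kron l i * g x $ j $ k - kron l j * g x $ i $ k)"
proof -
  interpret local_metric U g by fact
  define F where "F X Y Z W = gprod (g x) (curvature_op g x X Y Z) W
    - \<kappa> * (gprod (g x) Y Z * gprod (g x) X W - gprod (g x) X Z * gprod (g x) Y W)" for X Y Z W
  note comm = gprod_commute[OF symmetric[OF x]]
  have F0: "F X Y Y X = 0" if "gram2 (g x) X Y \<noteq> 0" for X Y
    using sec[OF that] that comm[of X Y]
    by (simp add: F_def sectional_curvature_def gram2_def power2_eq_square field_simps)
  have F0: "F X Y Y X = 0" for X Y
  proof -
    \<comment> \<open>Degenerate pairs are limits of nondegenerate ones: on the line towards a
      nondegenerate pair, \<open>gram2\<close> is a polynomial in \<open>t\<close> that is nonzero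
      at 1, so it has finitely many roots.\<close>
    obtain X1 Y1 where g1: "gram2 (g x) X1 Y1 \<noteq> 0"
      using gram2_nonzero_exists[OF symmetric invertible n] x by blast
    define P where "P t = X + t *\<^sub>R (X1 - X)" for t
    define Q where "Q t = Y + t *\<^sub>R (Y1 - Y)" for t
    obtain p1 where p1: "\<And>t. gprod (g x) (P t) (P t) = poly p1 t"
      using gprod_line_poly unfolding P_def by metis
    obtain p2 where p2: "\<And>t. gprod (g x) (Q t) (Q t) = poly p2 t"
      using gprod_line_poly unfolding Q_def by metis
    obtain p3 where p3: "\<And>t. gprod (g x) (P t) (Q t) = poly p3 t"
      using gprod_line_poly unfolding P_def Q_def by metis
    define p where "p = p1 * p2 - p3 ^ 2"
    have p: "gram2 (g x) (P t) (Q t) = poly p t" for t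
      by (simp add: gram2_def p1 p2 p3 p_def)
    have "poly p 1 \<noteq> 0" using g1 p[of 1] by (simp add: P_def Q_def)
    then have "finite {t. poly p t = 0}"
      by (intro poly_roots_finite) auto
    then have "eventually (\<lambda>t. t \<notin> {t. poly p t = 0}) (at 0)"
      using islimpt_finite islimpt_iff_eventually by blast
    then have ev: "eventually (\<lambda>t. F (P t) (Q t) (Q t) (P t) = 0) (at 0)"
      by (rule eventually_mono) (use F0 p in auto)
    have cont: "isCont (\<lambda>t. F (P t) (Q t) (Q t) (P t)) 0"
      unfolding F_def gprod_def curvature_op_def inner_vec_def matrix_vector_mult_def P_def Q_def
      by (simp add: continuous_intros)
    have "((\<lambda>t. F (P t) (Q t) (Q t) (P t)) \<longlongrightarrow> 0) (at 0)"
      by (rule tendsto_eventually[OF ev])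
    then have "F (P 0) (Q 0) (Q 0) (P 0) = 0"
      by (rule tendsto_unique[OF at_neq_bot isContD[OF cont]])
    then show ?thesis by (simp add: P_def Q_def)
  qed
  let ?L = "\<lambda>w k i j. \<Sum>l\<in>UNIV. g x $ w $ l * riemann g l k i j x"
  have gw: "gprod (g x) V (axis d 1) = (\<Sum>l\<in>UNIV. g x $ d $ l * V $ l)" for V d
    by (simp add: gprod_def inner_vec_def matrix_vector_mult_basis column_def nth_commute[OF x] mult.commute)
  have S: "F (axis a 1) (axis b 1) (axis c 1) (axis d 1) = ?L d c a b
      - \<kappa> * (g x $ b $ c * g x $ a $ d - g x $ a $ c * g x $ b $ d)" for a b c d
    unfolding F_def curvature_op_axis gprod_axis by (simp add: gw)
  have "F (axis i 1) (axis j 1) (axis k 1) (axis w 1) = 0" for i j k w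
  proof (rule curvature_like_eq_0)
    show "F X Y Y X = 0" for X Y by (rule F0)
    show "F (axis b 1) (axis a 1) (axis c 1) (axis d 1) = - F (axis a 1) (axis b 1) (axis c 1) (axis d 1)" for a b c d
      unfolding S riemann_eq_curvature_coeff curvature_coeff_antisym[of _ _ _ b a]
      by (simp add: sum_negf algebra_simps)
    show "F (axis a 1) (axis b 1) (axis d 1) (axis c 1) = - F (axis a 1) (axis b 1) (axis c 1) (axis d 1)" for a b c d
      unfolding S using riemann_lower_antisym[OF x, of c d a b] by (simp add: algebra_simps)
    show "F (axis a 1) (axis b 1) (axis c 1) (axis d 1) + F (axis b 1) (axis c 1) (axis a 1) (axis d 1)
        + F (axis c 1) (axis a 1) (axis b 1) (axis d 1) = 0" for a b c d
    proof -
      have "?L d c a b + ?L d a b c + ?L d b c a = 0"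
        unfolding sum.distrib[symmetric] distrib_left[symmetric] riemann_eq_curvature_coeff
        using curvature_coeff_bianchi[OF open_U x differentiable_christoffel[OF x] christoffel_commute]
        by simp
      then show ?thesis
        unfolding S nth_commute[OF x, of a b] nth_commute[OF x, of a c] nth_commute[OF x, of b c]
        by (simp add: algebra_simps)
    qed
  qed (simp_all add: F_def curvature_op_add gprod_add_left gprod_add_right algebra_simps)
  then have L: "?L w k i j = \<kappa> * (g x $ j $ k * g x $ i $ w - g x $ i $ k * g x $ j $ w)" for w k i j
    unfolding S by simp
  let ?M = "matrix_inv (g x)"
  have "riemann g l k i j x = (\<Sum>m\<in>UNIV. kron l m * riemann g m k i j x)"
    by (simp only: sum_kron)
  also have "\<dots> = (\<Sum>m\<in>UNIV. \<Sum>w\<in>UNIV. ?M $ l $ w * g x $ w $ m * riemann g m k i j x)"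
    by (simp only: sum_distrib_right[symmetric] matrix_inv_sums[OF invertible[OF x]])
  also have "\<dots> = (\<Sum>w\<in>UNIV. \<Sum>m\<in>UNIV. ?M $ l $ w * g x $ w $ m * riemann g m k i j x)"
    by (rule sum.swap)
  also have "\<dots> = (\<Sum>w\<in>UNIV. ?M $ l $ w * ?L w k i j)"
    by (simp add: sum_distrib_left mult.assoc)
  also have "\<dots> = (\<Sum>w\<in>UNIV. \<kappa> * (g x $ j $ k * (?M $ l $ w * g x $ w $ i) - g x $ i $ k * (?M $ l $ w * g x $ w $ j)))"
    unfolding L nth_commute[OF x, of _ i] nth_commute[OF x, of _ j]
    by (intro sum.cong refl) (simp add: nth_commute[OF x, of i] nth_commute[OF x, of j] algebra_simps)
  also have "\<dots> = \<kappa> * (g x $ j $ k * kron l i - g x $ i $ k * kron l j)"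
    by (simp only: sum_distrib_left[symmetric] sum_subtractf matrix_inv_sums[OF invertible[OF x]])
  finally show ?thesis by (simp add: mult.commute)
qed

section \<open>Geodesics and projective equivalence\<close>

lemma gprod_sums: "gprod G u v = (\<Sum>l\<in>UNIV. u $ l * (\<Sum>j\<in>UNIV. G $ l $ j * v $ j))"
  by (simp add: gprod_def inner_vec_def matrix_vector_mult_def)

lemma has_derivative_gprod:
  fixes G :: "'x::real_normed_vector \<Rightarrow> real^'n^'n::finite"
  assumes "(G has_derivative G') (at x)" "(u has_derivative u') (at x)" "(v has_derivative v') (at x)"
  shows "((\<lambda>y. gprod (G y) (u y) (v y)) has_derivative
    (\<lambda>z. gprod (G' z) (u x) (v x) + gprod (G x) (u' z) (v x) + gprod (G x) (u x) (v' z))) (at x)"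
proof -
  have nth: "((\<lambda>y. f y $ i) has_derivative (\<lambda>z. f' z $ i)) (at x)"
    if "(f has_derivative f') (at x)" for f :: "'x \<Rightarrow> 'c::real_normed_vector^'n" and f' i
    by (rule bounded_linear.has_derivative[OF bounded_linear_vec_nth that])
  have "((\<lambda>y. \<Sum>l\<in>UNIV. u y $ l * (\<Sum>j\<in>UNIV. G y $ l $ j * v y $ j)) has_derivative
    (\<lambda>z. \<Sum>l\<in>UNIV. u x $ l * (\<Sum>j\<in>UNIV. G x $ l $ j * v' z $ j + G' z $ l $ j * v x $ j)
      + u' z $ l * (\<Sum>j\<in>UNIV. G x $ l $ j * v x $ j))) (at x)"
    by (intro has_derivative_sum has_derivative_mult nth assms)
  moreover have "(\<Sum>l\<in>UNIV. u x $ l * (\<Sum>j\<in>UNIV. G x $ l $ j * v' z $ j + G' z $ l $ j * v x $ j)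
      + u' z $ l * (\<Sum>j\<in>UNIV. G x $ l $ j * v x $ j)) =
    gprod (G' z) (u x) (v x) + gprod (G x) (u' z) (v x) + gprod (G x) (u x) (v' z)" for z
    by (simp add: gprod_sums sum.distrib distrib_left)
  ultimately show ?thesis
    unfolding gprod_sums[of "G _" "u _" "v _"] by simp
qed

lemma linear_axis_expansion:
  fixes f :: "real^'n::finite \<Rightarrow> 'b::real_vector"
  assumes "linear f"
  shows "f z = (\<Sum>i\<in>UNIV. z $ i *\<^sub>R f (axis i 1))"
proof -
  have "z = (\<Sum>i\<in>UNIV. z $ i *\<^sub>R axis i 1)"
    using basis_expansion[of z] by (simp add: scalar_mult_eq_scaleR)
  then have "f z = f (\<Sum>i\<in>UNIV. z $ i *\<^sub>R axis i 1)" by simp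
  then show ?thesis by (simp only: linear_sum[OF assms] linear_scale[OF assms])
qed

text \<open>The quadratic term of the geodesic equation: the acceleration of a geodesic is minus
  this vector at its velocity.\<close>

definition christoffel_vec ::
  "(real^'n \<Rightarrow> real^'n^'n) \<Rightarrow> real^'n \<Rightarrow> real^'n \<Rightarrow> real^'n::finite" where
  "christoffel_vec g x v = (\<chi> k. \<Sum>i\<in>UNIV. \<Sum>j\<in>UNIV. christoffel g k i j x * v $ i * v $ j)"

context local_metric
begin

lemma smooth_has_derivative: "x \<in> U \<Longrightarrow> (g has_derivative frechet_derivative g (at x)) (at x)"
  by (rule differentiable_has_derivative[OF smooth_on_differentiable[OF smooth_g]])

lemma frechet_derivative_nth:
  assumes "x \<in> U"
  shows "frechet_derivative g (at x) z $ a $ b = (\<Sum>i\<in>UNIV. z $ i * partial i (\<lambda>y. g y $ a $ b) x)"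
proof -
  have *: "((\<lambda>y. g y $ a $ b) has_derivative (\<lambda>z. frechet_derivative g (at x) z $ a $ b)) (at x)"
    by (intro bounded_linear.has_derivative[OF bounded_linear_vec_nth] smooth_has_derivative assms)
  show ?thesis
    unfolding has_derivative_partial[OF *]
    using linear_axis_expansion[OF has_derivative_linear[OF *], of z] by simp
qed

text \<open>The Euler--Lagrange form of the geodesic equation. It is used to change charts, since it spares
  the transformation law of the Christoffel symbols.\<close>

lemma gprod_christoffel_vec:
  assumes "x \<in> U"
  shows "gprod (g x) u (christoffel_vec g x v) =
    gprod (frechet_derivative g (at x) v) u v - gprod (frechet_derivative g (at x) u) v v / 2"
proof -
  define P where "P i a b = partial i (\<lambda>y. g y $ a $ b) x" for i a b
  have Psym: "P i a b = P i b a" for i a b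
    unfolding P_def by (rule partial_nth_commute[OF assms])
  define A where "A = (\<Sum>l\<in>UNIV. \<Sum>i\<in>UNIV. \<Sum>j\<in>UNIV. u $ l * v $ i * v $ j * P i j l)"
  \<comment> \<open>Against the symmetric product of velocities, the first two derivative terms of
    the Christoffel symbol contribute equally.\<close>
  have A': "A = (\<Sum>l\<in>UNIV. \<Sum>i\<in>UNIV. \<Sum>j\<in>UNIV. u $ l * v $ i * v $ j * P j i l)"
    unfolding A_def by (rule sum.cong[OF refl], subst sum.swap) (simp add: mult_ac)
  define C where "C = (\<Sum>l\<in>UNIV. \<Sum>i\<in>UNIV. \<Sum>j\<in>UNIV. u $ l * v $ i * v $ j * P l i j)"
  have "(\<Sum>k\<in>UNIV. g x $ l $ k * (\<Sum>i\<in>UNIV. \<Sum>j\<in>UNIV. christoffel g k i j x * v $ i * v $ j)) =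
      (\<Sum>i\<in>UNIV. \<Sum>j\<in>UNIV. v $ i * v $ j * ((P i j l + P j i l - P l i j) / 2))" for l
  proof -
    have "(\<Sum>k\<in>UNIV. g x $ l $ k * (\<Sum>i\<in>UNIV. \<Sum>j\<in>UNIV. christoffel g k i j x * v $ i * v $ j)) =
        (\<Sum>k\<in>UNIV. \<Sum>i\<in>UNIV. \<Sum>j\<in>UNIV. v $ i * v $ j * (g x $ l $ k * christoffel g k i j x))"
      by (simp add: sum_distrib_left mult_ac)
    also have "\<dots> = (\<Sum>i\<in>UNIV. \<Sum>k\<in>UNIV. \<Sum>j\<in>UNIV. v $ i * v $ j * (g x $ l $ k * christoffel g k i j x))"
      by (rule sum.swap)
    also have "\<dots> = (\<Sum>i\<in>UNIV. \<Sum>j\<in>UNIV. \<Sum>k\<in>UNIV. v $ i * v $ j * (g x $ l $ k * christoffel g k i j x))"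
      by (rule sum.cong[OF refl], rule sum.swap)
    finally show ?thesis
      by (simp only: sum_distrib_left[symmetric] christoffel_lower[OF assms] P_def)
  qed
  then have "gprod (g x) u (christoffel_vec g x v) =
      (\<Sum>l\<in>UNIV. \<Sum>i\<in>UNIV. \<Sum>j\<in>UNIV. u $ l * (v $ i * v $ j * ((P i j l + P j i l - P l i j) / 2)))"
    by (simp add: gprod_sums christoffel_vec_def sum_distrib_left)
  also have "\<dots> = (\<Sum>l\<in>UNIV. \<Sum>i\<in>UNIV. \<Sum>j\<in>UNIV. (1 / 2) * (u $ l * v $ i * v $ j * P i j l)
      + (1 / 2) * (u $ l * v $ i * v $ j * P j i l) - (1 / 2) * (u $ l * v $ i * v $ j * P l i j))"
    by (intro sum.cong refl) (simp add: field_simps)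
  also have "\<dots> = (1 / 2) * A + (1 / 2) * A - (1 / 2) * C"
    by (subst (2) A') (simp only: A_def C_def sum.distrib sum_subtractf sum_distrib_left[symmetric])
  also have "\<dots> = A - C / 2" by simp
  also have "A = gprod (frechet_derivative g (at x) v) u v"
  proof -
    have "gprod (frechet_derivative g (at x) v) u v =
        (\<Sum>l\<in>UNIV. \<Sum>j\<in>UNIV. \<Sum>i\<in>UNIV. u $ l * v $ i * v $ j * P i j l)"
      unfolding gprod_sums frechet_derivative_nth[OF assms] P_def[symmetric]
      by (simp add: sum_distrib_left sum_distrib_right mult_ac Psym[of _ _ "_ :: 'n"])
    also have "\<dots> = A"
      unfolding A_def by (rule sum.cong[OF refl], rule sum.swap)
    finally show ?thesis by simp
  qed
  also have "C = gprod (frechet_derivative g (at x) u) v v"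
  proof -
    have "gprod (frechet_derivative g (at x) u) v v =
        (\<Sum>i\<in>UNIV. \<Sum>j\<in>UNIV. \<Sum>l\<in>UNIV. u $ l * v $ i * v $ j * P l i j)"
      unfolding gprod_sums frechet_derivative_nth[OF assms] P_def[symmetric]
      by (simp add: sum_distrib_left sum_distrib_right mult_ac)
    also have "\<dots> = (\<Sum>i\<in>UNIV. \<Sum>l\<in>UNIV. \<Sum>j\<in>UNIV. u $ l * v $ i * v $ j * P l i j)"
      by (rule sum.cong[OF refl], rule sum.swap)
    also have "\<dots> = C"
      unfolding C_def by (rule sum.swap)
    finally show ?thesis by simp
  qed
  finally show ?thesis .
qed

end

section \<open>Invariance of the geodesic equation under change of charts\<close>

lemma gprod_transpose: "gprod (transpose J ** H ** J) p q = gprod H (J *v p) (J *v q)"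
proof -
  have "gprod (transpose J ** H ** J) p q = p \<bullet> (transpose J *v (H *v (J *v q)))"
    by (simp add: gprod_def matrix_vector_mul_assoc matrix_mul_assoc)
  also have "\<dots> = gprod H (J *v p) (J *v q)"
    by (metis dot_lmul_matrix gprod_def vector_transpose_matrix inner_commute transpose_transpose)
  finally show ?thesis .
qed

lemma second_derivative_symmetric_vec:
  fixes f :: "'a::real_normed_vector \<Rightarrow> real^'n::finite"
  assumes "open S" "x \<in> S" "smooth_on S f"
  shows "frechet_derivative (\<lambda>y. frechet_derivative f (at y) u) (at x) v =
    frechet_derivative (\<lambda>y. frechet_derivative f (at y) v) (at x) u"
proof -
  have f: "(f has_derivative frechet_derivative f (at y)) (at y)" if "y \<in> S" for y
    by (rule differentiable_has_derivative[OF smooth_on_differentiable[OF assms(3) that]])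
  have f2: "((\<lambda>y. frechet_derivative f (at y) u) has_derivative
      frechet_derivative (\<lambda>y. frechet_derivative f (at y) u) (at x)) (at x)" for u
    using assms(3) Ck_on_SucD[of 0 S "\<lambda>y. frechet_derivative f (at y) u" x] assms(2)
    unfolding smooth_on_def by (metis Ck_on.simps(2))
  have nth: "frechet_derivative (\<lambda>y. f y $ k) (at y) u = frechet_derivative f (at y) u $ k" if "y \<in> S" for y u k
    using frechet_derivative_at[OF bounded_linear.has_derivative[OF bounded_linear_vec_nth f[OF that]], of k]
    by metis
  have nth2: "frechet_derivative (\<lambda>y. frechet_derivative (\<lambda>y. f y $ k) (at y) u) (at x) v =
      frechet_derivative (\<lambda>y. frechet_derivative f (at y) u) (at x) v $ k" for k u v
  proof -
    have "((\<lambda>y. frechet_derivative f (at y) u $ k) has_derivative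
        (\<lambda>v. frechet_derivative (\<lambda>y. frechet_derivative f (at y) u) (at x) v $ k)) (at x)"
      by (rule bounded_linear.has_derivative[OF bounded_linear_vec_nth f2])
    then have "((\<lambda>y. frechet_derivative (\<lambda>y. f y $ k) (at y) u) has_derivative
        (\<lambda>v. frechet_derivative (\<lambda>y. frechet_derivative f (at y) u) (at x) v $ k)) (at x)"
      by (rule has_derivative_transform_within_open[OF _ assms(1,2)]) (simp add: nth)
    then show ?thesis
      by (simp add: frechet_derivative_at[symmetric])
  qed
  have "Ck_on 2 S (\<lambda>y. f y $ k)" for k
    using smooth_on_vec_nth[OF assms(1,3)] by (simp add: smooth_on_def)
  then have "frechet_derivative (\<lambda>y. frechet_derivative f (at y) u) (at x) v $ k =
      frechet_derivative (\<lambda>y. frechet_derivative f (at y) v) (at x) u $ k" for k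
    using second_derivative_symmetric[OF assms(1,2), of "\<lambda>y. f y $ k" u v] unfolding nth2 by blast
  then show ?thesis by (simp add: vec_eq_iff)
qed

text \<open>Differentiating g(p, q) = h(Jp, Jq) expresses the derivative of \<open>g\<close> by that
  of \<open>h\<close> and by second derivatives of \<tau>. Inserted into the Euler-Lagrange form for
  \<open>g\<close>, these assemble to the form for \<open>h\<close>, tested against all vectors
  \<open>J u\<close>.\<close>

lemma geodesic_equation_transform:
  fixes \<tau> :: "real^'n::finite \<Rightarrow> real^'n"
  assumes "local_metric U g" "local_metric V h" "open W" "W \<subseteq> U" "smooth_on W \<tau>" "\<tau> ` W \<subseteq> V"
    and gh: "\<And>y. y \<in> W \<Longrightarrow> g y = transpose (jacobian \<tau> (at y)) ** h (\<tau> y) ** jacobian \<tau> (at y)"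
    and x: "(x has_vector_derivative v t) (at t)" "x t \<in> W"
    and v: "(v has_vector_derivative - christoffel_vec g (x t) (v t)) (at t)"
  shows "((\<lambda>s. frechet_derivative \<tau> (at (x s)) (v s)) has_vector_derivative
    - christoffel_vec h (\<tau> (x t)) (frechet_derivative \<tau> (at (x t)) (v t))) (at t)"
proof -
  interpret g: local_metric U g by fact
  interpret h: local_metric V h by fact
  let ?x = "x t" and ?v = "v t"
  let ?a = "- christoffel_vec g ?x ?v"
  let ?J = "frechet_derivative \<tau> (at ?x)"
  let ?H = "h (\<tau> ?x)"
  define D2 where "D2 p = frechet_derivative (\<lambda>y. frechet_derivative \<tau> (at y) p) (at ?x)" for p
  have xU: "?x \<in> U" and xV: "\<tau> ?x \<in> V" using x(2) assms(4,6) by auto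
  have d\<tau>: "(\<tau> has_derivative frechet_derivative \<tau> (at y)) (at y)" if "y \<in> W" for y
    by (rule differentiable_has_derivative[OF smooth_on_differentiable[OF assms(5) that]])
  have lin: "linear (frechet_derivative \<tau> (at y))" if "y \<in> W" for y
    by (rule has_derivative_linear[OF d\<tau>[OF that]])
  have J: "jacobian \<tau> (at y) *v p = frechet_derivative \<tau> (at y) p" if "y \<in> W" for y p
  proof -
    have "(\<tau> has_derivative (\<lambda>h. jacobian \<tau> (at y) *v h)) (at y)"
      using smooth_on_differentiable[OF assms(5) that] by (simp add: jacobian_works)
    then show ?thesis by (metis frechet_derivative_at)
  qed
  have D2: "((\<lambda>y. frechet_derivative \<tau> (at y) p) has_derivative D2 p) (at ?x)" for p
    unfolding D2_def using assms(5) Ck_on_SucD[of 0 W "\<lambda>y. frechet_derivative \<tau> (at y) p" ?x] x(2)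
    unfolding smooth_on_def by (metis Ck_on.simps(2))
  have D2_sym: "D2 p q = D2 q p" for p q
    unfolding D2_def by (rule second_derivative_symmetric_vec[OF assms(3) x(2) assms(5)])
  have pull: "gprod (g y) p q = gprod (h (\<tau> y)) (frechet_derivative \<tau> (at y) p) (frechet_derivative \<tau> (at y) q)"
    if "y \<in> W" for y p q
    unfolding gh[OF that] gprod_transpose J[OF that] ..
  let ?Dg = "frechet_derivative g (at ?x)" and ?Dh = "frechet_derivative h (at (\<tau> ?x))"
  have Dg: "gprod (?Dg z) p q = gprod (?Dh (?J z)) (?J p) (?J q) + gprod ?H (D2 p z) (?J q) + gprod ?H (?J p) (D2 q z)"
    for z p q
  proof -
    have "((\<lambda>y. h (\<tau> y)) has_derivative (\<lambda>z. ?Dh (?J z))) (at ?x)"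
      using diff_chain_at[OF d\<tau>[OF x(2)] h.smooth_has_derivative[OF xV]] by (simp add: o_def)
    from has_derivative_gprod[OF this D2 D2, of p q]
    have "((\<lambda>y. gprod (g y) p q) has_derivative (\<lambda>z. gprod (?Dh (?J z)) (?J p) (?J q)
        + gprod ?H (D2 p z) (?J q) + gprod ?H (?J p) (D2 q z))) (at ?x)"
      by (rule has_derivative_transform_within_open[OF _ assms(3) x(2)]) (simp add: pull)
    moreover have "((\<lambda>y. gprod (g y) p q) has_derivative (\<lambda>z. gprod (?Dg z) p q + gprod (g ?x) 0 q + gprod (g ?x) p 0)) (at ?x)"
      by (rule has_derivative_gprod[OF g.smooth_has_derivative[OF xU]]) (rule has_derivative_const)+
    ultimately have "(\<lambda>z. gprod (?Dg z) p q + gprod (g ?x) 0 q + gprod (g ?x) p 0) =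
        (\<lambda>z. gprod (?Dh (?J z)) (?J p) (?J q) + gprod ?H (D2 p z) (?J q) + gprod ?H (?J p) (D2 q z))"
      using has_derivative_unique by blast
    then show ?thesis
      by (simp add: fun_eq_iff gprod_sums)
  qed
  \<comment> \<open>The acceleration of the image curve, by the chain rule.\<close>
  define b where "b = D2 ?v ?v + ?J ?a"
  have lag: "gprod ?H (?J u) (b + christoffel_vec h (\<tau> ?x) (?J ?v)) = 0" for u
  proof -
    have "gprod ?H (?J u) (christoffel_vec h (\<tau> ?x) (?J ?v)) =
        gprod (?Dh (?J ?v)) (?J u) (?J ?v) - gprod (?Dh (?J u)) (?J ?v) (?J ?v) / 2"
      by (rule h.gprod_christoffel_vec[OF xV])
    moreover have "gprod (g ?x) u (christoffel_vec g ?x ?v) = gprod (?Dg ?v) u ?v - gprod (?Dg u) ?v ?v / 2"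
      by (rule g.gprod_christoffel_vec[OF xU])
    moreover have "gprod ?H (?J u) (?J ?a) = - gprod (g ?x) u (christoffel_vec g ?x ?v)"
      unfolding pull[OF x(2), symmetric]
      using gprod_scaleR_right[of "g ?x" u "-1" "christoffel_vec g ?x ?v"] by simp
    moreover have "gprod ?H (?J ?v) (D2 ?v u) = gprod ?H (D2 ?v u) (?J ?v)"
      by (rule gprod_commute[OF h.symmetric[OF xV]])
    ultimately show ?thesis
      unfolding b_def gprod_add_right using Dg[of ?v u ?v] Dg[of u ?v ?v] D2_sym[of u ?v]
      by (simp add: field_simps)
  qed
  have b: "b = - christoffel_vec h (\<tau> ?x) (?J ?v)"
  proof -
    let ?j = "jacobian \<tau> (at ?x)" and ?z = "b + christoffel_vec h (\<tau> ?x) (?J ?v)"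
    \<comment> \<open>The determinant of \<open>g\<close> contains that of
      \<open>transpose ?j ** ?H\<close> as a factor, so testing against the vectors
      \<open>J u\<close> detects every vector.\<close>
    have "det (g ?x) \<noteq> 0" using g.invertible[OF xU] by (simp add: invertible_det_nz)
    then have "det (transpose ?j ** ?H) \<noteq> 0"
      unfolding gh[OF x(2)] by (simp add: det_mul)
    then have inv: "invertible (transpose ?j ** ?H)" by (simp add: invertible_det_nz)
    have "u \<bullet> ((transpose ?j ** ?H) *v ?z) = 0" for u
    proof -
      have "u \<bullet> ((transpose ?j ** ?H) *v ?z) = gprod ?H (?j *v u) ?z"
        unfolding gprod_def matrix_vector_mul_assoc[symmetric]
        by (metis dot_lmul_matrix vector_transpose_matrix inner_commute transpose_transpose)
      then show ?thesis using lag[of u] J[OF x(2)] by simp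
    qed
    then have "(transpose ?j ** ?H) *v ?z = 0" using inner_eq_zero_iff by blast
    then have "matrix_inv (transpose ?j ** ?H) *v ((transpose ?j ** ?H) *v ?z) = 0" by simp
    then have "?z = 0"
      using matrix_inv_mul_matrix[OF inv] by (simp only: matrix_vector_mul_assoc matrix_vector_mul_lid)
    then show ?thesis by (simp add: eq_neg_iff_add_eq_0)
  qed
  \<comment> \<open>Base point and direction both depend on \<open>s\<close>; after expansion in the
    basis, derivatives of \<tau> are differentiated in fixed directions only.\<close>
  have "((\<lambda>s. \<Sum>i\<in>UNIV. v s $ i *\<^sub>R frechet_derivative \<tau> (at (x s)) (axis i 1)) has_vector_derivative
      (\<Sum>i\<in>UNIV. ?v $ i *\<^sub>R D2 (axis i 1) ?v + ?a $ i *\<^sub>R ?J (axis i 1))) (at t)"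
  proof (intro has_vector_derivative_sum has_vector_derivative_scaleR)
    fix i
    show "((\<lambda>s. v s $ i) has_real_derivative ?a $ i) (at t)"
      using bounded_linear.has_vector_derivative[OF bounded_linear_vec_nth v, of i]
      by (simp add: has_real_derivative_iff_has_vector_derivative)
    show "((\<lambda>s. frechet_derivative \<tau> (at (x s)) (axis i 1)) has_vector_derivative D2 (axis i 1) ?v) (at t)"
      using vector_derivative_diff_chain_within[OF x(1), of "\<lambda>y. frechet_derivative \<tau> (at y) (axis i 1)" "D2 (axis i 1)"]
        has_derivative_at_withinI[OF D2] by (simp add: o_def)
  qed
  moreover have "(\<Sum>i\<in>UNIV. ?v $ i *\<^sub>R D2 (axis i 1) ?v + ?a $ i *\<^sub>R ?J (axis i 1)) = b"
  proof -
    have "D2 ?v (axis i 1) = D2 (axis i 1) ?v" for i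
      by (rule D2_sym)
    then have "D2 ?v ?v = (\<Sum>i\<in>UNIV. ?v $ i *\<^sub>R D2 (axis i 1) ?v)"
      using linear_axis_expansion[OF has_derivative_linear[OF D2], of ?v ?v] by simp
    moreover have "?J ?a = (\<Sum>i\<in>UNIV. ?a $ i *\<^sub>R ?J (axis i 1))"
      by (rule linear_axis_expansion[OF lin[OF x(2)]])
    ultimately show ?thesis unfolding b_def by (simp only: sum.distrib)
  qed
  ultimately have main: "((\<lambda>s. \<Sum>i\<in>UNIV. v s $ i *\<^sub>R frechet_derivative \<tau> (at (x s)) (axis i 1)) has_vector_derivative b) (at t)"
    by simp
  have "isCont x t" using x(1) by (rule has_vector_derivative_continuous)
  then have "\<exists>T. open T \<and> t \<in> T \<and> (\<forall>s\<in>T. x s \<in> W)"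
    using assms(3) x(2) unfolding continuous_at_open by (elim allE[of _ W]) simp
  then obtain T where T: "open T" "t \<in> T" "\<And>s. s \<in> T \<Longrightarrow> x s \<in> W"
    by (elim exE conjE) simp
  have "((\<lambda>s. frechet_derivative \<tau> (at (x s)) (v s)) has_vector_derivative b) (at t)"
  proof (rule has_vector_derivative_transform_within_open[OF main T(1,2)])
    fix s assume "s \<in> T"
    from linear_axis_expansion[OF lin[OF T(3)[OF this]], of "v s"]
    show "(\<Sum>i\<in>UNIV. v s $ i *\<^sub>R frechet_derivative \<tau> (at (x s)) (axis i 1)) =
        frechet_derivative \<tau> (at (x s)) (v s)" by (rule sym)
  qed
  then show ?thesis by (simp only: b)
qed

section \<open>Geodesics on the manifold and the difference of two connections\<close>

lemma chart_facts:
  fixes c :: "('a, 'n::finite) chart"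
  assumes "is_chart X c"
  shows "openin X (chart_dom c)" "open (chart_img c)" "inj_on (chart_map c) (chart_dom c)"
    and "p \<in> chart_dom c \<Longrightarrow> chart_map c p \<in> chart_img c"
    and "p \<in> chart_dom c \<Longrightarrow> chart_inv c (chart_map c p) = p"
    and "y \<in> chart_img c \<Longrightarrow> chart_inv c y \<in> chart_dom c"
    and "y \<in> chart_img c \<Longrightarrow> chart_map c (chart_inv c y) = y"
    and "continuous_map (top_of_set (chart_img c)) X (chart_inv c)"
    and "openin X V \<Longrightarrow> open (chart_map c ` (chart_dom c \<inter> V))"
proof -
  have top: "topspace (subtopology X (chart_dom c)) = chart_dom c"
    using assms openin_subset by (fastforce simp: is_chart_def)
  have hom: "homeomorphic_map (subtopology X (chart_dom c)) (top_of_set (chart_img c)) (chart_map c)"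
    using assms by (simp add: is_chart_def)
  show 1: "openin X (chart_dom c)" and 2: "open (chart_img c)"
    using assms by (simp_all add: is_chart_def)
  show inj: "inj_on (chart_map c) (chart_dom c)"
    using homeomorphic_imp_injective_map[OF hom] unfolding top .
  show "p \<in> chart_dom c \<Longrightarrow> chart_map c p \<in> chart_img c"
    by (simp add: chart_img_def)
  show 3: "p \<in> chart_dom c \<Longrightarrow> chart_inv c (chart_map c p) = p" for p
    using inj by (simp add: chart_inv_def)
  show "y \<in> chart_img c \<Longrightarrow> chart_inv c y \<in> chart_dom c"
    by (auto simp: chart_inv_def chart_img_def inv_into_into)
  show "y \<in> chart_img c \<Longrightarrow> chart_map c (chart_inv c y) = y"
    by (auto simp: chart_inv_def chart_img_def f_inv_into_f)
  obtain k where k: "homeomorphic_maps (subtopology X (chart_dom c)) (top_of_set (chart_img c)) (chart_map c) k"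
    using hom homeomorphic_map_maps by blast
  have "k y = chart_inv c y" if "y \<in> chart_img c" for y
    using k that 3 unfolding homeomorphic_maps_def top by (auto simp: chart_img_def)
  moreover have "continuous_map (top_of_set (chart_img c)) X k"
    using k by (auto simp: homeomorphic_maps_def continuous_map_in_subtopology)
  ultimately show "continuous_map (top_of_set (chart_img c)) X (chart_inv c)"
    by (rule continuous_map_eq[rotated]) simp
  show "open (chart_map c ` (chart_dom c \<inter> V))" if "openin X V"
  proof -
    have "openin (subtopology X (chart_dom c)) (chart_dom c \<inter> V)"
      using that by (auto simp: openin_subtopology)
    then have "openin (top_of_set (chart_img c)) (chart_map c ` (chart_dom c \<inter> V))"
      using homeomorphic_map_openness_eq[OF hom] by blast
    then show ?thesis using 2 by (simp add: openin_open_eq)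
  qed
qed

lemma local_metric_chart:
  assumes "smooth_manifold X \<A>" "pseudo_riemannian_metric \<A> g" "c \<in> \<A>"
  shows "local_metric (chart_img c) (g c)"
  using assms unfolding local_metric_def smooth_manifold_def is_chart_def pseudo_riemannian_metric_def by blast

text \<open>The equation is solved inside the chart \<open>c\<close>, but \<open>geodesic\<close>
  demands smoothness and the equation in every chart that the curve meets; the transition maps carry
  both over.\<close>

lemma geodesic_exists:
  fixes g :: "('a, 'n::finite) bilinear_field"
  assumes M: "smooth_manifold X \<A>" and g: "pseudo_riemannian_metric \<A> g"
    and c: "c \<in> \<A>" and x0: "x0 \<in> chart_img c"
  shows "\<exists>\<tau>>0. \<exists>\<gamma> x v. geodesic X \<A> g {-\<tau><..<\<tau>} \<gamma> \<and> x 0 = x0 \<and> v 0 = v0 \<and>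
    (\<forall>t\<in>{-\<tau><..<\<tau>}. \<gamma> t \<in> chart_dom c \<and> chart_map c (\<gamma> t) = x t \<and>
      (x has_vector_derivative v t) (at t) \<and>
      (v has_vector_derivative - christoffel_vec (g c) (x t) (v t)) (at t))"
proof -
  have chart: "is_chart X d" if "d \<in> \<A>" for d
    using M that by (simp add: smooth_manifold_def)
  note cf = chart_facts[OF chart[OF c]]
  interpret g: local_metric "chart_img c" "g c"
    by (rule local_metric_chart[OF M g c])
  obtain \<tau> x v where \<tau>: "\<tau> > 0" and init: "x 0 = x0" "v 0 = v0" and sm: "smooth_on {-\<tau><..<\<tau>} x"
    and ode: "\<And>t. t \<in> {-\<tau><..<\<tau>} \<Longrightarrow> x t \<in> chart_img c \<and> (x has_vector_derivative v t) (at t) \<and>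
      (v has_vector_derivative (\<chi> k. - (\<Sum>i\<in>UNIV. \<Sum>j\<in>UNIV. christoffel (g c) k i j (x t) * v t $ i * v t $ j))) (at t)"
    using geodesic_ode_solution[OF g.open_U x0, of "christoffel (g c)" v0] g.christoffel_smooth by blast
  let ?I = "{-\<tau><..<\<tau>}"
  define \<gamma> where "\<gamma> t = chart_inv c (x t)" for t
  have neg: "(\<chi> k. - (\<Sum>i\<in>UNIV. \<Sum>j\<in>UNIV. christoffel (g c) k i j (x t) * v t $ i * v t $ j)) =
      - christoffel_vec (g c) (x t) (v t)" for t
    by (simp add: christoffel_vec_def vec_eq_iff)
  have x: "x t \<in> chart_img c" "(x has_vector_derivative v t) (at t)"
    "(v has_vector_derivative - christoffel_vec (g c) (x t) (v t)) (at t)" if "t \<in> ?I" for t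
    using ode[OF that] unfolding neg by blast+
  have \<gamma>: "\<gamma> t \<in> chart_dom c" "chart_map c (\<gamma> t) = x t" if "t \<in> ?I" for t
    using cf(6,7)[OF x(1)[OF that]] by (simp_all add: \<gamma>_def)
  have contx: "continuous_on ?I x"
    using sm unfolding smooth_on_def by (metis Ck_on.simps(1))
  have cont: "continuous_map (top_of_set ?I) X \<gamma>"
  proof -
    have "continuous_map (top_of_set ?I) (top_of_set (chart_img c)) x"
      using contx x(1) by auto
    from continuous_map_compose[OF this cf(8)] show ?thesis
      by (simp add: \<gamma>_def[abs_def] o_def)
  qed
  have open_pre: "open {t \<in> ?I. \<gamma> t \<in> chart_dom d}" if "d \<in> \<A>" for d
    using openin_continuous_map_preimage[OF cont chart_facts(1)[OF chart[OF that]]]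
    by (simp add: openin_open_eq)
  have tr: "x t \<in> overlap c d" "chart_map d (\<gamma> t) = transition c d (x t)"
    if "t \<in> ?I" "\<gamma> t \<in> chart_dom d" for t d
  proof -
    have "chart_map c (\<gamma> t) \<in> overlap c d"
      using \<gamma>(1)[OF that(1)] that(2) by (auto simp: overlap_def)
    then show "x t \<in> overlap c d" using \<gamma>(2)[OF that(1)] by simp
    show "chart_map d (\<gamma> t) = transition c d (x t)"
      by (simp add: transition_def \<gamma>_def)
  qed
  have open_ov: "open (overlap c d)" if "d \<in> \<A>" for d
    unfolding overlap_def by (rule cf(9)[OF chart_facts(1)[OF chart[OF that]]])
  have sm_tr: "smooth_on (overlap c d) (transition c d)" if "d \<in> \<A>" for d
    using M c that by (simp add: smooth_manifold_def)
  have smooth: "smooth_on {t \<in> ?I. \<gamma> t \<in> chart_dom d} (chart_map d \<circ> \<gamma>)" if "d \<in> \<A>" for d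
    unfolding smooth_on_def
  proof
    fix k
    have "Ck_on k {t \<in> ?I. \<gamma> t \<in> chart_dom d} (\<lambda>t. transition c d (x t))"
    proof (rule Ck_on_compose[where f = "transition c d" and y = x, OF open_ov[OF that] open_pre[OF that]])
      show "Ck_on k {t \<in> ?I. \<gamma> t \<in> chart_dom d} x"
        using sm by (auto simp: smooth_on_def intro: Ck_on_subset)
      show "Ck_on k (overlap c d) (transition c d)"
        using sm_tr[OF that] by (simp add: smooth_on_def)
    qed (use tr in auto)
    then show "Ck_on k {t \<in> ?I. \<gamma> t \<in> chart_dom d} (chart_map d \<circ> \<gamma>)"
      by (rule Ck_on_cong[OF open_pre[OF that]]) (simp add: tr)
  qed
  have "geodesic X \<A> g ?I \<gamma>"
    unfolding geodesic_def Let_def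
  proof (intro conjI ballI impI allI)
    show "smooth_curve X \<A> ?I \<gamma>"
      using cont smooth \<tau> by (simp add: smooth_curve_def open_interval_def is_interval_oo)
    fix d t k assume d: "d \<in> \<A>" and t: "t \<in> ?I" "\<gamma> t \<in> chart_dom d"
    let ?T = "{t \<in> ?I. \<gamma> t \<in> chart_dom d}"
    let ?\<phi> = "transition c d"
    let ?w = "\<lambda>s. frechet_derivative ?\<phi> (at (x s)) (v s)"
    have tT: "t \<in> ?T" using t by simp
    have dx: "((chart_map d \<circ> \<gamma>) has_vector_derivative ?w s) (at s)" if s: "s \<in> ?T" for s
    proof -
      have "(?\<phi> has_derivative frechet_derivative ?\<phi> (at (x s))) (at (x s))"
        using smooth_on_differentiable[OF sm_tr[OF d] tr(1)] s by (intro differentiable_has_derivative) auto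
      then have "((?\<phi> \<circ> x) has_vector_derivative ?w s) (at s)"
        using vector_derivative_diff_chain_within[OF x(2), of s ?\<phi> "frechet_derivative ?\<phi> (at (x s))"] s
        by (auto intro: has_derivative_at_withinI)
      then show ?thesis
        by (rule has_vector_derivative_transform_within_open[OF _ open_pre[OF d] s]) (simp add: tr)
    qed
    have "(?w has_vector_derivative - christoffel_vec (g d) (?\<phi> (x t)) (?w t)) (at t)"
    proof (rule geodesic_equation_transform[OF local_metric_chart[OF M g c] local_metric_chart[OF M g d]
            open_ov[OF d] _ sm_tr[OF d] _ _ x(2)[OF t(1)] tr(1)[OF t] x(3)[OF t(1)]])
      show "overlap c d \<subseteq> chart_img c"
        by (auto simp: overlap_def chart_img_def)
      show "transition c d ` overlap c d \<subseteq> chart_img d"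
        using cf(5) by (auto simp: overlap_def chart_img_def transition_def)
      show "g c y = transpose (jacobian ?\<phi> (at y)) ** g d (?\<phi> y) ** jacobian ?\<phi> (at y)"
        if "y \<in> overlap c d" for y
        using g c d that unfolding pseudo_riemannian_metric_def transition_jacobian_def by blast
    qed
    then have "((\<lambda>s. vector_derivative (chart_map d \<circ> \<gamma>) (at s)) has_vector_derivative
        - christoffel_vec (g d) (?\<phi> (x t)) (?w t)) (at t)"
      by (rule has_vector_derivative_transform_within_open[OF _ open_pre[OF d] tT])
        (rule vector_derivative_at[OF dx, symmetric])
    then have "vector_derivative (\<lambda>s. vector_derivative (chart_map d \<circ> \<gamma>) (at s)) (at t) =
        - christoffel_vec (g d) (?\<phi> (x t)) (?w t)"
      by (rule vector_derivative_at)
    moreover have "vector_derivative (chart_map d \<circ> \<gamma>) (at t) = ?w t"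
      by (rule vector_derivative_at[OF dx[OF tT]])
    moreover have "(chart_map d \<circ> \<gamma>) t = ?\<phi> (x t)"
      using tr(2)[OF t] by simp
    ultimately show "vector_derivative (\<lambda>s. vector_derivative (chart_map d \<circ> \<gamma>) (at s)) (at t) $ k +
        (\<Sum>i\<in>UNIV. \<Sum>j\<in>UNIV. christoffel (g d) k i j ((chart_map d \<circ> \<gamma>) t) *
          vector_derivative (chart_map d \<circ> \<gamma>) (at t) $ i * vector_derivative (chart_map d \<circ> \<gamma>) (at t) $ j) = 0"
      by (simp add: christoffel_vec_def)
  qed
  then show ?thesis
    using \<tau> init \<gamma> x(2,3) by blast
qed

text \<open>With \<open>p\<close>, \<open>q\<close> the first two derivatives of the parameter
  change, the acceleration of the new curve is \<open>p\<^sup>2 a + q v\<close>; the geodesic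
  equation for \<open>g'\<close> thus leaves the multiple \<open>- q / p\<^sup>2\<close> of
  \<open>v\<close>.\<close>

lemma reparametrized_geodesic:
  fixes g' :: "('a, 'n::finite) bilinear_field"
  assumes geo: "geodesic X \<A> g' J (\<gamma> \<circ> s)" and c: "c \<in> \<A>"
    and J: "open J" "smooth_on J s" "s ` J \<subseteq> I" and t0: "t0 \<in> J"
    and s': "vector_derivative s (at t0) \<noteq> (0::real)"
    and \<gamma>: "\<And>t. t \<in> I \<Longrightarrow> \<gamma> t \<in> chart_dom c \<and> chart_map c (\<gamma> t) = x t \<and>
      (x has_vector_derivative v t) (at t) \<and> (v has_vector_derivative a t) (at t)"
  shows "\<exists>r. a (s t0) + christoffel_vec (g' c) (x (s t0)) (v (s t0)) = r *\<^sub>R v (s t0)"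
proof -
  define p where "p t = frechet_derivative s (at t) 1" for t
  have Ck: "Ck_on (Suc (Suc 0)) J s" using J(2) unfolding smooth_on_def by blast
  have ds: "(s has_vector_derivative p t) (at t)" if "t \<in> J" for t
    using Ck_on_SucD[OF Ck that] frechet_derivative_eq_vector_derivative[of s t] Ck that
    unfolding has_vector_derivative_def p_def by auto
  have "Ck_on (Suc 0) J p" unfolding p_def[abs_def] using Ck by simp
  then obtain q where q: "(p has_vector_derivative q) (at t0)"
    using t0 by (auto simp: differentiable_iff_scaleR has_vector_derivative_def)
  have p0: "p t0 \<noteq> 0" using s' vector_derivative_at[OF ds[OF t0]] by simp
  let ?z = "chart_map c \<circ> (\<gamma> \<circ> s)"
  have sI: "s t \<in> I" if "t \<in> J" for t using J(3) that by blast
  have z: "?z t = x (s t)" if "t \<in> J" for t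
    using \<gamma>[OF sI[OF that]] by simp
  have chain: "((f \<circ> s) has_vector_derivative p t *\<^sub>R f') (at t)"
    if "t \<in> J" "(f has_vector_derivative f') (at (s t))" for f :: "real \<Rightarrow> real^'n" and f' t
    by (rule vector_diff_chain_at[OF ds[OF that(1)] that(2)])
  have dz: "(?z has_vector_derivative p t *\<^sub>R v (s t)) (at t)" if "t \<in> J" for t
  proof -
    have "((x \<circ> s) has_vector_derivative p t *\<^sub>R v (s t)) (at t)"
      using \<gamma>[OF sI[OF that]] by (intro chain that) blast
    then show ?thesis
      by (rule has_vector_derivative_transform_within_open[OF _ J(1) that]) (use z in simp)
  qed
  have "((\<lambda>t. p t *\<^sub>R (v \<circ> s) t) has_vector_derivative p t0 *\<^sub>R (p t0 *\<^sub>R a (s t0)) + q *\<^sub>R (v \<circ> s) t0) (at t0)"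
    using \<gamma>[OF sI[OF t0]] q
    by (intro has_vector_derivative_scaleR chain t0) (auto simp: has_real_derivative_iff_has_vector_derivative)
  then have "((\<lambda>t. p t *\<^sub>R v (s t)) has_vector_derivative
      p t0 *\<^sub>R (p t0 *\<^sub>R a (s t0)) + q *\<^sub>R v (s t0)) (at t0)"
    by (simp only: o_apply)
  then have "((\<lambda>t. vector_derivative ?z (at t)) has_vector_derivative
      p t0 *\<^sub>R (p t0 *\<^sub>R a (s t0)) + q *\<^sub>R v (s t0)) (at t0)"
    by (rule has_vector_derivative_transform_within_open[OF _ J(1) t0])
      (rule vector_derivative_at[OF dz, symmetric])
  from vector_derivative_at[OF this]
  have acc: "vector_derivative (\<lambda>t. vector_derivative ?z (at t)) (at t0) =
      p t0 *\<^sub>R (p t0 *\<^sub>R a (s t0)) + q *\<^sub>R v (s t0)" .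
  have "(\<gamma> \<circ> s) t0 \<in> chart_dom c" using \<gamma>[OF sI[OF t0]] by simp
  then have eq: "vector_derivative (\<lambda>t. vector_derivative ?z (at t)) (at t0) $ k +
      (\<Sum>i\<in>UNIV. \<Sum>j\<in>UNIV. christoffel (g' c) k i j (?z t0) * vector_derivative ?z (at t0) $ i * vector_derivative ?z (at t0) $ j) = 0" for k
    using geo c t0 unfolding geodesic_def Let_def by blast
  let ?w = "christoffel_vec (g' c) (x (s t0)) (v (s t0))"
  have eq2: "p t0 * (p t0 * a (s t0) $ k) + q * v (s t0) $ k + p t0 * (p t0 * ?w $ k) = 0" for k
    using eq[of k] unfolding acc vector_derivative_at[OF dz[OF t0]] z[OF t0]
    by (simp add: christoffel_vec_def sum_distrib_left mult_ac)
  have "a (s t0) + ?w = (- q / (p t0)\<^sup>2) *\<^sub>R v (s t0)"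
  proof (rule vec_eq_iff[THEN iffD2], rule allI)
    fix k
    have "(p t0)\<^sup>2 * (a (s t0) $ k + ?w $ k) = - q * v (s t0) $ k"
      using eq2[of k] by (simp add: power2_eq_square algebra_simps)
    then show "(a (s t0) + ?w) $ k = ((- q / (p t0)\<^sup>2) *\<^sub>R v (s t0)) $ k"
      using p0 by (simp add: field_simps)
  qed
  then show ?thesis by blast
qed

text \<open>A geodesic of \<open>g\<close> with the prescribed initial point and velocity is, up to
  parameter, one of \<open>g'\<close>; comparing the two equations at time 0 leaves a multiple of
  the velocity.\<close>

lemma projective_class_christoffel_vec:
  fixes g g' :: "('a, 'n::finite) bilinear_field"
  assumes M: "smooth_manifold X \<A>" and g: "pseudo_riemannian_metric \<A> g"
    and g': "g' \<in> projective_class X \<A> g" and c: "c \<in> \<A>" and x0: "x0 \<in> chart_img c"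
  shows "\<exists>r. christoffel_vec (g' c) x0 v0 - christoffel_vec (g c) x0 v0 = r *\<^sub>R v0"
proof -
  obtain \<tau> \<gamma> x v where \<tau>: "\<tau> > 0" and geo: "geodesic X \<A> g {-\<tau><..<\<tau>} \<gamma>" and init: "x 0 = x0" "v 0 = v0"
    and \<gamma>: "\<And>t. t \<in> {-\<tau><..<\<tau>} \<Longrightarrow> \<gamma> t \<in> chart_dom c \<and> chart_map c (\<gamma> t) = x t \<and>
      (x has_vector_derivative v t) (at t) \<and>
      (v has_vector_derivative - christoffel_vec (g c) (x t) (v t)) (at t)"
    using geodesic_exists[OF M g c x0] by blast
  let ?I = "{-\<tau><..<\<tau>}"
  have I: "open_interval ?I" using geo by (simp add: geodesic_def smooth_curve_def)
  have "nonparametrized_geodesic X \<A> g ?I \<gamma>"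
    unfolding nonparametrized_geodesic_def
  proof (intro conjI exI[of _ ?I] exI[of _ "\<lambda>t. t"] ballI)
    show "smooth_on ?I (\<lambda>t. t)" by (simp add: smooth_on_def Ck_on_ident)
  qed (use I geo in \<open>simp_all add: o_def bij_betw_def\<close>)
  then have "nonparametrized_geodesic X \<A> g' ?I \<gamma>"
    using g' by (simp add: projective_class_def)
  then obtain J s where J: "open_interval J" "bij_betw s J ?I" "smooth_on J s"
    "\<And>t. t \<in> J \<Longrightarrow> vector_derivative s (at t) \<noteq> 0" "geodesic X \<A> g' J (\<gamma> \<circ> s)"
    unfolding nonparametrized_geodesic_def by blast
  have im: "s ` J = ?I" using J(2) by (simp add: bij_betw_def)
  then obtain t0 where t0: "t0 \<in> J" "s t0 = 0"
    using \<tau> by (metis (no_types, lifting) greaterThanLessThan_iff imageE neg_less_0_iff_less)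
  have oJ: "open J" using J(1) by (simp add: open_interval_def)
  have "\<exists>r. - christoffel_vec (g c) (x (s t0)) (v (s t0)) + christoffel_vec (g' c) (x (s t0)) (v (s t0)) = r *\<^sub>R v (s t0)"
    by (rule reparametrized_geodesic[OF J(5) c oJ J(3) _ t0(1) J(4)[OF t0(1)] \<gamma>]) (use im in auto)
  then show ?thesis by (simp add: t0(2) init)
qed

text \<open>It suffices to test the hypothesis on \<open>e\<^sub>a\<close> and \<open>e\<^sub>a \<plusminus> e\<^sub>b\<close>.\<close>

lemma symmetric_bilinear_proportional:
  fixes S :: "'n::finite \<Rightarrow> 'n \<Rightarrow> 'n \<Rightarrow> real"
  assumes sym: "\<And>k i j. S k i j = S k j i"
    and par: "\<And>v :: real^'n. \<exists>r. \<forall>k. (\<Sum>i\<in>UNIV. \<Sum>j\<in>UNIV. S k i j * v $ i * v $ j) = r * v $ k"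
  shows "S k i j = kron k i * (S j j j / 2) + kron k j * (S i i i / 2)"
proof -
  have ax: "axis a (1::real) $ i = kron a i" for a i :: 'n
    by (simp add: axis_def kron_def eq_commute)
  have ev: "\<exists>r. \<forall>k. S k a a + 2 * t * S k a b + t * t * S k b b = r * (kron a k + t * kron b k)" for a b t
  proof -
    have "(\<Sum>i\<in>UNIV. \<Sum>j\<in>UNIV. S k i j * (axis a 1 + t *\<^sub>R axis b 1 :: real^'n) $ i * (axis a 1 + t *\<^sub>R axis b 1 :: real^'n) $ j) =
        S k a a + 2 * t * S k a b + t * t * S k b b" for k
    proof -
      have "S k i j * (axis a 1 + t *\<^sub>R axis b 1 :: real^'n) $ i * (axis a 1 + t *\<^sub>R axis b 1 :: real^'n) $ j =
          kron a i * (kron a j * S k i j) + t * (kron a i * (kron b j * S k i j))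
          + t * (kron b i * (kron a j * S k i j)) + t * t * (kron b i * (kron b j * S k i j))" for i j
        by (simp add: ax algebra_simps)
      then show ?thesis
        by (simp only: sum.distrib sum_distrib_left[symmetric] sum_kron sym[of k b a])
    qed
    then show ?thesis using par[of "axis a 1 + t *\<^sub>R axis b 1"] by (simp add: ax)
  qed
  have diag: "S k a a = 0" if "k \<noteq> a" for k a
    using ev[of a 0 a] that by (auto simp: kron_def)
  have off: "S k a b = 0" if "k \<noteq> a" "k \<noteq> b" for k a b
  proof -
    obtain r where r: "\<And>k. S k a a + 2 * S k a b + S k b b = r * (kron a k + kron b k)"
      using ev[of a 1 b] by auto
    show ?thesis
      using r[of k] that diag[of k a] diag[of k b] by (simp add: kron_def)
  qed
  \<comment> \<open>Adding the relations for e_a + e_b and e_a - e_b expresses r + q as 2 S a a a in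
    component \<open>a\<close>, and as 4 S b a b in component \<open>b\<close>.\<close>
  have half: "S b a b = S a a a / 2" if "a \<noteq> b" for a b
  proof -
    obtain r where r: "\<And>k. S k a a + 2 * S k a b + S k b b = r * (kron a k + kron b k)"
      using ev[of a 1 b] by auto
    obtain q where q: "\<And>k. S k a a - 2 * S k a b + S k b b = q * (kron a k - kron b k)"
      using ev[of a "-1" b] by auto
    show ?thesis
      using r[of a] r[of b] q[of a] q[of b] diag[of a b] diag[of b a] that by (simp add: kron_def)
  qed
  show ?thesis
  proof (cases "k = i")
    case True
    show ?thesis
    proof (cases "k = j")
      case True
      then show ?thesis using \<open>k = i\<close> by simp
    next
      case False
      then show ?thesis using True half[of j k] sym[of k i j] by (simp add: kron_def)
    qed
  next
    case False
    then show ?thesis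
      using half[of i k] off[of k i j] by (cases "k = j") (auto simp: kron_def)
  qed
qed

section \<open>Contact tensor fields\<close>

text \<open>Writing the derivative with a factor 1/u covers both signs of \<open>u\<close> and
  yields logarithmic derivatives.\<close>

lemma has_real_derivative_abs_powr:
  assumes "u \<noteq> 0"
  shows "((\<lambda>u. \<bar>u\<bar> powr w) has_real_derivative w * \<bar>u\<bar> powr w / u) (at u)"
proof (cases "u > 0")
  case True
  have "((\<lambda>u. u powr w) has_real_derivative w * u powr (w - 1)) (at u)"
    using True by (rule has_real_derivative_powr)
  moreover have "w * u powr (w - 1) = w * \<bar>u\<bar> powr w / u"
    using True by (simp add: powr_diff)
  ultimately have "((\<lambda>u. u powr w) has_real_derivative w * \<bar>u\<bar> powr w / u) (at u)"
    by (simp only:)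
  then show ?thesis
    by (rule has_field_derivative_transform_within_open[OF _ open_greaterThan[of 0]]) (use True in auto)
next
  case False
  then have u: "- u > 0" using assms by simp
  have "((\<lambda>u. (- u) powr w) has_real_derivative w * (- u) powr (w - 1) * (- 1)) (at u)"
    by (rule DERIV_chain2[where f = "\<lambda>z. z powr w" and g = uminus, OF has_real_derivative_powr[OF u]])
      (auto intro!: derivative_eq_intros)
  moreover have "w * (- u) powr (w - 1) * (- 1) = w * \<bar>u\<bar> powr w / u"
    using u by (simp add: powr_diff abs_if)
  ultimately have "((\<lambda>u. (- u) powr w) has_real_derivative w * \<bar>u\<bar> powr w / u) (at u)"
    by (simp only:)
  then show ?thesis
    by (rule has_field_derivative_transform_within_open[OF _ open_lessThan[of 0]]) (use u in auto)
qed

lemma partial_abs_powr: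
  assumes "f differentiable (at x)" "f x \<noteq> 0"
  shows "(\<lambda>y. \<bar>f y\<bar> powr w) differentiable (at x)"
    and "partial i (\<lambda>y. \<bar>f y\<bar> powr w) x = w * \<bar>f x\<bar> powr w / f x * partial i f x"
proof -
  have d: "((\<lambda>y. \<bar>f y\<bar> powr w) has_derivative
      (\<lambda>h. w * \<bar>f x\<bar> powr w / f x * frechet_derivative f (at x) h)) (at x)"
    using has_derivative_compose[OF differentiable_has_derivative[OF assms(1)]
        has_real_derivative_abs_powr[OF assms(2), unfolded has_field_derivative_def]] .
  then show "(\<lambda>y. \<bar>f y\<bar> powr w) differentiable (at x)"
    unfolding differentiable_def by blast
  show "partial i (\<lambda>y. \<bar>f y\<bar> powr w) x = w * \<bar>f x\<bar> powr w / f x * partial i f x"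
    unfolding has_derivative_partial[OF d] by (simp add: partial_def)
qed

text \<open>The part of \<open>b\<close> orthogonal to \<open>a\<close> lies in the kernel of
  \<open>a\<close>, hence in that of \<open>b\<close>, and is therefore orthogonal to
  itself.\<close>

lemma same_kernel_proportional:
  fixes a b :: "'v::real_inner"
  assumes "{v. b \<bullet> v = 0} = {v. a \<bullet> v = 0}"
  shows "\<exists>r. b = r *\<^sub>R a"
proof (cases "a = 0")
  case True
  then have "b \<in> {v. b \<bullet> v = 0}" unfolding assms by simp
  then show ?thesis by simp
next
  case False
  define r where "r = (a \<bullet> b) / (a \<bullet> a)"
  have "a \<bullet> (b - r *\<^sub>R a) = 0"
    using False by (simp add: r_def inner_diff_right)
  moreover from this have "b \<bullet> (b - r *\<^sub>R a) = 0"
    using assms by blast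
  ultimately have "(b - r *\<^sub>R a) \<bullet> (b - r *\<^sub>R a) = 0"
    by (simp add: inner_diff_left)
  then show ?thesis by auto
qed

text \<open>d(f\<theta>) = f d\<theta> + df \<and> \<theta>, and the second summand is of the kind
  that \<open>alt_sum_contact_term_scale\<close> absorbs.\<close>

lemma contact_sum_rescale:
  fixes \<theta> :: "(real, 'n::{finite,linorder}) vec \<Rightarrow> (real, 'n) vec"
  assumes "open W" "x \<in> W" "\<theta> differentiable (at x)" "f differentiable (at x)" "\<eta> differentiable (at x)"
    and \<eta>: "\<And>y. y \<in> W \<Longrightarrow> \<eta> y = f y *\<^sub>R \<theta> y"
  shows "contact_sum l (form_coeffs \<eta> x) (ext_deriv_coeffs \<eta> x) =
    f x ^ (l + 1) * contact_sum l (form_coeffs \<theta> x) (ext_deriv_coeffs \<theta> x)"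
proof -
  have nth: "(\<lambda>y. \<xi> y $ v) differentiable (at x)" if "\<xi> differentiable (at x)" for \<xi> :: "(real, 'n) vec \<Rightarrow> (real, 'n) vec" and v
    using bounded_linear.has_derivative[OF bounded_linear_vec_nth differentiable_has_derivative[OF that]]
    unfolding differentiable_def by blast
  have p: "partial u (\<lambda>y. \<eta> y $ v) x = partial u f x * \<theta> x $ v + f x * partial u (\<lambda>y. \<theta> y $ v) x" for u v
  proof -
    have "partial u (\<lambda>y. \<eta> y $ v) x = partial u (\<lambda>y. f y * \<theta> y $ v) x"
      by (rule partial_cong[OF assms(1,2) nth[OF assms(5)]]) (simp add: \<eta>)
    also have "\<dots> = partial u f x * \<theta> x $ v + f x * partial u (\<lambda>y. \<theta> y $ v) x"
      by (rule partial_mult[OF assms(4) nth[OF assms(3)]])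
    finally show ?thesis .
  qed
  let ?a = "form_coeffs \<theta> x" and ?B = "ext_deriv_coeffs \<theta> x"
  have "form_coeffs \<eta> x = (\<lambda>u. f x * ?a u)"
    by (simp add: form_coeffs_def \<eta>[OF assms(2)] fun_eq_iff)
  moreover have "ext_deriv_coeffs \<eta> x =
      (\<lambda>u v. f x * ?B u v + (?a u * (- partial v f x) - ?a v * (- partial u f x)))"
    by (simp add: ext_deriv_coeffs_def form_coeffs_def p fun_eq_iff algebra_simps)
  ultimately show ?thesis
    unfolding contact_sum_def using alt_sum_contact_term_scale[of l _ "f x" ?a ?B "\<lambda>v. - partial v f x"] by simp
qed

lemma contact_sum_nonzero:
  fixes \<theta> :: "(real, 'n::{finite,linorder}) vec \<Rightarrow> (real, 'n) vec"
  assumes "contact_sum l (form_coeffs \<theta> x) B \<noteq> 0"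
  shows "\<theta> x \<noteq> 0"
proof
  assume "\<theta> x = 0"
  then have "contact_term l (form_coeffs \<theta> x) (\<lambda>_. B) = (\<lambda>_. 0)"
    by (simp add: contact_term_def form_coeffs_def fun_eq_iff)
  then show False using assms by (simp add: contact_sum_def alt_sum_def)
qed

text \<open>Rescaling \<open>\<theta>\<close> by \<open>f\<close> rescales \<open>vol\<close> by \<open>f\<close> to the power \<open>l + 1\<close>, which is compensated, up to the
  sign of \<open>f\<close>, by the weight.\<close>

lemma contact_tensor_local_form:
  fixes \<theta> \<eta> :: "(real, 'n::{finite,linorder}) vec \<Rightarrow> (real, 'n) vec"
  assumes n: "CARD('n) = 2 * l + 1"
    and \<theta>: "defining_contact_form_on l U D \<theta>" and \<eta>: "defining_contact_form_on l W D \<eta>"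
    and W: "W \<subseteq> U" "x \<in> W"
  shows "\<exists>N \<epsilon>. open N \<and> x \<in> N \<and> N \<subseteq> W \<and>
    (\<forall>y\<in>N. (\<bar>contact_vol l \<eta> y\<bar> powr contact_weight l) *\<^sub>R \<eta> y =
      (\<epsilon> * \<bar>contact_vol l \<theta> y\<bar> powr contact_weight l) *\<^sub>R \<theta> y)"
proof -
  have oW: "open W" and s\<eta>: "smooth_on W \<eta>" and s\<theta>: "smooth_on U \<theta>"
    using \<theta> \<eta> by (simp_all add: defining_contact_form_on_def)
  have d\<theta>: "\<theta> differentiable (at y)" and d\<eta>: "\<eta> differentiable (at y)" if "y \<in> W" for y
    using smooth_on_differentiable[OF s\<theta>] smooth_on_differentiable[OF s\<eta>] that W(1) by blast+
  obtain C where C: "\<And>\<xi> y. \<xi> differentiable (at y) \<Longrightarrow> contact_vol l \<xi> (y :: (real, 'n) vec) =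
      C * contact_sum l (form_coeffs \<xi> y) (ext_deriv_coeffs \<xi> y)"
    using contact_vol_eq[OF n] by blast
  have vol: "contact_vol l \<theta> y \<noteq> 0" "contact_vol l \<eta> y \<noteq> 0" "{v. \<eta> y \<bullet> v = 0} = {v. \<theta> y \<bullet> v = 0}" if "y \<in> W" for y
    using \<theta> \<eta> that W(1) unfolding defining_contact_form_on_def by blast+
  have "\<theta> x \<noteq> 0"
    using vol(1)[OF W(2)] C[OF d\<theta>[OF W(2)]] by (intro contact_sum_nonzero) auto
  then obtain j where j: "\<theta> x $ j \<noteq> 0"
    by (auto simp: vec_eq_iff)
  \<comment> \<open>The ratio of the two forms, read off from a component of \<theta> that is
    nonzero near \<open>x\<close>; as a quotient it is differentiable there.\<close>
  define f where "f y = \<eta> y $ j / \<theta> y $ j" for y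
  have nth: "(\<lambda>y. \<xi> y $ v) differentiable (at y)" if "\<xi> differentiable (at y)" for \<xi> :: "(real, 'n) vec \<Rightarrow> (real, 'n) vec" and v y
    using bounded_linear.has_derivative[OF bounded_linear_vec_nth differentiable_has_derivative[OF that]]
    unfolding differentiable_def by blast
  define W' where "W' = {y \<in> W. \<theta> y $ j \<noteq> 0}"
  have cont_nth: "continuous_on W (\<lambda>y. \<theta> y $ j)"
    using nth[OF d\<theta>] by (intro continuous_at_imp_continuous_on ballI differentiable_imp_continuous_within)
  have oW': "open W'"
    unfolding W'_def using continuous_on_open_vimage[OF oW, THEN iffD1, OF cont_nth, rule_format, of "- {0}"]
    by (simp add: vimage_def Int_def conj_commute open_Compl)
  have xW': "x \<in> W'" using W(2) j by (simp add: W'_def)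
  have df: "f differentiable (at y)" if "y \<in> W'" for y
    unfolding f_def[abs_def] using that nth[OF d\<theta>, of y j] nth[OF d\<eta>, of y j]
    by (intro differentiable_divide) (auto simp: W'_def)
  have \<eta>f: "\<eta> y = f y *\<^sub>R \<theta> y" if y: "y \<in> W'" for y
  proof -
    obtain r where "\<eta> y = r *\<^sub>R \<theta> y"
      using same_kernel_proportional[OF vol(3)] y by (auto simp: W'_def)
    then show ?thesis using y by (simp add: W'_def f_def)
  qed
  have volf: "contact_vol l \<eta> y = f y ^ (l + 1) * contact_vol l \<theta> y" if y: "y \<in> W'" for y
  proof -
    have yW: "y \<in> W" using y by (simp add: W'_def)
    have "contact_sum l (form_coeffs \<eta> y) (ext_deriv_coeffs \<eta> y) =
        f y ^ (l + 1) * contact_sum l (form_coeffs \<theta> y) (ext_deriv_coeffs \<theta> y)"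
      by (rule contact_sum_rescale[OF oW' y d\<theta>[OF yW] df[OF y] d\<eta>[OF yW] \<eta>f])
    then show ?thesis
      unfolding C[OF d\<theta>[OF yW]] C[OF d\<eta>[OF yW]] by (simp only: mult.left_commute)
  qed
  have f0: "f y \<noteq> 0" if "y \<in> W'" for y
    using vol(2)[of y] volf[OF that] that by (auto simp: W'_def)
  \<comment> \<open>On \<open>N\<close> the ratio keeps its sign at \<open>x\<close>, so
    \<open>\<epsilon>\<close> can be taken constant.\<close>
  define N where "N = {y \<in> W'. f y * f x > 0}"
  have "continuous_on W' (\<lambda>y. f y * f x)"
    using df by (intro continuous_intros continuous_at_imp_continuous_on ballI differentiable_imp_continuous_within)
  then have "open (W' \<inter> (\<lambda>y. f y * f x) -` {0<..})"
    by (rule continuous_open_preimage[OF _ oW' open_greaterThan])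
  moreover have "W' \<inter> (\<lambda>y. f y * f x) -` {0<..} = N"
    by (auto simp: N_def)
  ultimately have oN: "open N" by simp
  have xN: "x \<in> N" using xW' f0[OF xW'] by (simp add: N_def zero_less_mult_iff) linarith
  have "(\<bar>contact_vol l \<eta> y\<bar> powr contact_weight l) *\<^sub>R \<eta> y =
      (sgn (f x) * \<bar>contact_vol l \<theta> y\<bar> powr contact_weight l) *\<^sub>R \<theta> y" if y: "y \<in> N" for y
  proof -
    have yW': "y \<in> W'" and sg: "sgn (f y) = sgn (f x)"
      using y by (auto simp: N_def zero_less_mult_iff)
    \<comment> \<open>The exponent l + 1 of the volume times the weight is -1, so the absolute value
      of the ratio cancels and its sign remains.\<close>
    have "\<bar>f y\<bar> ^ (l + 1) = \<bar>f y\<bar> powr real (l + 1)"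
      using f0[OF yW'] by (subst powr_realpow) auto
    then have "(\<bar>f y\<bar> ^ (l + 1)) powr contact_weight l = \<bar>f y\<bar> powr (real (l + 1) * contact_weight l)"
      by (simp only: powr_powr)
    also have "real (l + 1) * contact_weight l = - 1"
      by (simp add: contact_weight_def field_simps)
    also have "\<bar>f y\<bar> powr (- 1) = inverse \<bar>f y\<bar>"
      using f0[OF yW'] by (simp add: powr_minus)
    finally have "\<bar>contact_vol l \<eta> y\<bar> powr contact_weight l =
        inverse \<bar>f y\<bar> * \<bar>contact_vol l \<theta> y\<bar> powr contact_weight l"
      unfolding volf[OF yW'] abs_mult power_abs by (simp only: powr_mult abs_ge_zero zero_le_power)
    moreover have "inverse \<bar>f y\<bar> * f y = sgn (f x)"
      using f0[OF yW'] unfolding sg[symmetric] by (simp add: sgn_real_def abs_if)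
    ultimately show ?thesis
      unfolding \<eta>f[OF yW'] scaleR_scaleR by (simp add: mult.assoc mult.commute[of _ "f y"] mult.left_commute)
  qed
  then show ?thesis
    using oN xN unfolding N_def W'_def by blast
qed

text \<open>The difference of the Christoffel symbols sends every vector to a multiple of itself, so
  it is pure trace. Half its diagonal entries serve as \<psi>, an explicit formula that makes
  smoothness immediate.\<close>

lemma projective_class_covector:
  fixes g g' :: "('a, 'n::finite) bilinear_field"
  assumes M: "smooth_manifold X \<A>" and g: "pseudo_riemannian_metric \<A> g"
    and g': "g' \<in> projective_class X \<A> g" and c: "c \<in> \<A>"
  shows "\<exists>\<psi>. (\<forall>i. smooth_on (chart_img c) (\<psi> i)) \<and> (\<forall>y\<in>chart_img c. \<forall>k i j.
    christoffel (g' c) k i j y = christoffel (g c) k i j y + (kron k i * \<psi> j y + kron k j * \<psi> i y))"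
proof -
  have pr': "pseudo_riemannian_metric \<A> g'"
    using g' by (simp add: projective_class_def)
  interpret g: local_metric "chart_img c" "g c" by (rule local_metric_chart[OF M g c])
  interpret g': local_metric "chart_img c" "g' c" by (rule local_metric_chart[OF M pr' c])
  define \<psi> where "\<psi> i y = (1 / 2) * (christoffel (g' c) i i i y - christoffel (g c) i i i y)" for i y
  have "Ck_on q (chart_img c) (\<psi> i)" for q i
    unfolding \<psi>_def[abs_def] using g.christoffel_smooth g'.christoffel_smooth
    by (intro Ck_on_mult Ck_on_minus Ck_on_const g.open_U) (simp_all add: smooth_on_def)
  moreover have "christoffel (g' c) k i j y = christoffel (g c) k i j y + (kron k i * \<psi> j y + kron k j * \<psi> i y)"
    if y: "y \<in> chart_img c" for y k i j
  proof -
    define S where "S k i j = christoffel (g' c) k i j y - christoffel (g c) k i j y" for k i j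
    have "\<exists>r. \<forall>k. (\<Sum>i\<in>UNIV. \<Sum>j\<in>UNIV. S k i j * v $ i * v $ j) = r * v $ k" for v :: "real^'n"
    proof -
      obtain r where r: "christoffel_vec (g' c) y v - christoffel_vec (g c) y v = r *\<^sub>R v"
        using projective_class_christoffel_vec[OF M g g' c y] by blast
      have "(\<Sum>i\<in>UNIV. \<Sum>j\<in>UNIV. S k i j * v $ i * v $ j) = r * v $ k" for k
        using arg_cong[OF r, of "\<lambda>w. w $ k"]
        by (simp add: christoffel_vec_def S_def left_diff_distrib sum_subtractf)
      then show ?thesis by blast
    qed
    then have "S k i j = kron k i * (S j j j / 2) + kron k j * (S i i i / 2)"
      by (intro symmetric_bilinear_proportional)
        (simp_all add: S_def g.christoffel_commute[OF y] g'.christoffel_commute[OF y])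
    then show ?thesis by (simp add: S_def \<psi>_def)
  qed
  ultimately show ?thesis unfolding smooth_on_def by blast
qed

text \<open>The claim is pointwise, so the computation stays in one chart; the other charts enter
  through the geodesics that define the projective class.\<close>

theorem corollary3p4p1:
  fixes X :: "'a topology"
    and \<A> :: "('a, 'n::{finite,linorder}) chart set"
    and l :: nat
    and D :: "('a, 'n) distribution"
    and \<Theta> \<theta> :: "('a, 'n) covector_field"
    and g g' :: "('a, 'n) bilinear_field"
  assumes "l \<ge> 1"
    and "contact_manifold X \<A> l D"
    and "contact_tensor_field \<A> l D \<Theta>"
    and "pseudo_riemannian_metric \<A> g"
    and "constant_sectional_curvature \<A> g"
    and "contact_form_of \<A> l D \<theta>"
    and "g' \<in> projective_class X \<A> g"
    and "killing_form \<A> g' \<theta>"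
  shows "\<forall>c\<in>\<A>. \<forall>x\<in>chart_img c. A_density l g \<Theta> c x = 0"
proof (intro ballI)
  fix c x assume c: "c \<in> \<A>" and x: "x \<in> chart_img c"
  let ?U = "chart_img c"
  let ?w = "contact_weight l"
  let ?\<Gamma> = "christoffel (g c)" and ?\<Gamma>' = "christoffel (g' c)"
  have M: "smooth_manifold X \<A>" and n: "CARD('n) = 2 * l + 1"
    using assms(2) by (simp_all add: contact_manifold_def)
  have pr': "pseudo_riemannian_metric \<A> g'"
    using assms(7) by (simp add: projective_class_def)
  have lm: "local_metric ?U (g c)" by (rule local_metric_chart[OF M assms(4) c])
  interpret g: local_metric ?U "g c" by (rule lm)
  interpret g': local_metric ?U "g' c" by (rule local_metric_chart[OF M pr' c])
  obtain \<psi> where \<psi>: "\<And>i. smooth_on ?U (\<psi> i)"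
    and proj: "\<And>k i j y. y \<in> ?U \<Longrightarrow> ?\<Gamma>' k i j y = ?\<Gamma> k i j y + (kron k i * \<psi> j y + kron k j * \<psi> i y)"
    using projective_class_covector[OF M assms(4,7) c] by blast
  have d\<psi>: "\<psi> i differentiable (at x)" for i
    by (rule smooth_on_differentiable[OF \<psi> x])
  have closed: "partial i (\<psi> j) x - partial j (\<psi> i) x = 0" for i j
  proof -
    have "(\<Sum>m\<in>UNIV. curvature_coeff ?\<Gamma>' m m i j x) = (\<Sum>m\<in>UNIV. curvature_coeff ?\<Gamma> m m i j x)
        + (real CARD('n) + 1) * (partial i (\<psi> j) x - partial j (\<psi> i) x)"
      by (rule curvature_coeff_trace_projective[OF g.open_U x g.differentiable_christoffel[OF x]
            g.christoffel_commute d\<psi> proj])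
    then have "(real CARD('n) + 1) * (partial i (\<psi> j) x - partial j (\<psi> i) x) = 0"
      using g.riemann_trace_eq_0[OF x] g'.riemann_trace_eq_0[OF x]
      unfolding riemann_eq_curvature_coeff by simp
    moreover have "real CARD('n) + 1 \<noteq> 0" by linarith
    ultimately show ?thesis by (simp only: mult_eq_0_iff) blast
  qed
  from assms(5)[unfolded constant_sectional_curvature_def] obtain \<kappa>
    where "\<forall>c\<in>\<A>. \<forall>x\<in>chart_img c. \<forall>Y Z. gram2 (g c x) Y Z \<noteq> 0 \<longrightarrow> sectional_curvature (g c) x Y Z = \<kappa>"
    by (elim exE)
  then have \<kappa>: "sectional_curvature (g c) x Y Z = \<kappa>" if "gram2 (g c x) Y Z \<noteq> 0" for Y Z
    using c x that by simp
  \<comment> \<open>\<open>1 \<le> l\<close> makes the dimension at least 3, so there are planes on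
    which sectional curvature determines the tensor.\<close>
  have curv: "curvature_coeff ?\<Gamma> m k i j x = \<kappa> * (kron m i * g c x $ j $ k - kron m j * g c x $ i $ k)" for m k i j
    using constant_curvature_riemann[OF lm x _ \<kappa>] n assms(1) unfolding riemann_eq_curvature_coeff by simp

  define a where "a i y = \<theta> c y $ i" for i y
  have \<theta>: "defining_contact_form_on l ?U (D c) (\<theta> c)"
    using assms(6) c by (simp add: contact_form_of_def)
  then have smooth_\<theta>: "smooth_on ?U (\<theta> c)" by (simp add: defining_contact_form_on_def)
  have smooth_a: "smooth_on ?U (a i)" for i
    unfolding a_def[abs_def] by (rule smooth_on_vec_nth[OF g.open_U smooth_\<theta>])
  have da: "a i differentiable (at x)" for i
    by (rule smooth_on_differentiable[OF smooth_a x])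
  have killing: "partial i (a j) y + partial j (a i) y = 2 * (\<Sum>m\<in>UNIV. ?\<Gamma>' m i j y * a m y)"
    if y: "y \<in> ?U" for i j y
  proof -
    have "nabla_form (g' c) (\<theta> c) i j y + nabla_form (g' c) (\<theta> c) j i y = 0"
      using assms(8) c y unfolding killing_form_def by blast
    then show ?thesis
      unfolding nabla_form_def g'.christoffel_commute[OF y, of _ j i] a_def[abs_def] by simp
  qed

  define h where "h y = contact_sum l (\<lambda>i. a i y) (\<lambda>i j. antisym_deriv a i j y)" for y
  have h: "h differentiable (at x)" "partial k h x = (\<Sum>m\<in>UNIV. ?\<Gamma>' m k m x) * h x" for k
  proof -
    \<comment> \<open>As \<psi> is closed, the curvature of \<open>g'\<close> has the shape that
      \<open>contact_sum_deriv\<close> asks for, with \<kappa>g - Q in the role of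
      \<open>P\<close>.\<close>
    define Q where "Q i = partial i (\<psi> k) x - (\<Sum>m\<in>UNIV. ?\<Gamma> m i k x * \<psi> m x) - \<psi> i x * \<psi> k x" for i
    have "(\<Sum>m\<in>UNIV. curvature_coeff ?\<Gamma>' m k i j x * a m x) =
        a i x * (\<kappa> * g c x $ j $ k - Q j) - a j x * (\<kappa> * g c x $ i $ k - Q i)" for i j
    proof -
      have "curvature_coeff ?\<Gamma>' m k i j x =
          kron m i * (\<kappa> * g c x $ j $ k - Q j) - kron m j * (\<kappa> * g c x $ i $ k - Q i)" for m
        using curvature_coeff_projective[OF g.open_U x g.differentiable_christoffel[OF x]
            g.christoffel_commute d\<psi> proj, of m k i j]
        unfolding closed curv Q_def[symmetric] by (simp add: algebra_simps)
      then have "curvature_coeff ?\<Gamma>' m k i j x * a m x = kron m i * ((\<kappa> * g c x $ j $ k - Q j) * a m x)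
          - kron m j * ((\<kappa> * g c x $ i $ k - Q i) * a m x)" for m
        by (simp only: left_diff_distrib mult.assoc)
      then show ?thesis
        by (simp only: sum_subtractf sum_kron) (simp add: mult.commute)
    qed
    note R = this
    note cd = contact_sum_deriv[OF n g.open_U x g'.differentiable_christoffel[OF x]
        g'.christoffel_commute smooth_a killing R]
    show "h differentiable (at x)" unfolding h_def[abs_def] by (rule cd(1))
    show "partial k h x = (\<Sum>m\<in>UNIV. ?\<Gamma>' m k m x) * h x" unfolding h_def[abs_def] by (rule cd(2))
  qed
  obtain C where C: "\<And>y. \<theta> c differentiable (at y) \<Longrightarrow> contact_vol l (\<theta> c) y =
      C * contact_sum l (form_coeffs (\<theta> c) y) (ext_deriv_coeffs (\<theta> c) y)"
    using contact_vol_eq[OF n] by blast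
  define H where "H y = C * h y" for y
  have vol: "contact_vol l (\<theta> c) y = H y" if "y \<in> ?U" for y
  proof -
    have "form_coeffs (\<theta> c) y = (\<lambda>i. a i y)" "ext_deriv_coeffs (\<theta> c) y = (\<lambda>i j. antisym_deriv a i j y)"
      by (simp_all add: fun_eq_iff form_coeffs_def ext_deriv_coeffs_def antisym_deriv_def a_def[abs_def])
    then show ?thesis
      using C[OF smooth_on_differentiable[OF smooth_\<theta> that]] by (simp add: H_def h_def)
  qed
  have H: "H differentiable (at x)" "H x \<noteq> 0" "partial k H x = (\<Sum>m\<in>UNIV. ?\<Gamma>' m k m x) * H x" for k
  proof -
    show "H differentiable (at x)" unfolding H_def[abs_def] using h(1) by simp
    show "H x \<noteq> 0" using \<theta> x vol[OF x] unfolding defining_contact_form_on_def by auto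
    show "partial k H x = (\<Sum>m\<in>UNIV. ?\<Gamma>' m k m x) * H x"
      unfolding H_def[abs_def] by (simp add: partial_cmult h)
  qed
  let ?E = "\<lambda>y. \<bar>H y\<bar> powr ?w"
  \<comment> \<open>The logarithmic derivative is the weight times the trace of the connection, so
    this density is parallel for the connection of \<open>g'\<close>.\<close>
  have dE: "?E differentiable (at x)" "partial i ?E x = ?w * (\<Sum>m\<in>UNIV. ?\<Gamma>' m i m x) * ?E x" for i
    using partial_abs_powr[where w = ?w, OF H(1,2)] H(2) by (simp_all add: H(3))

  obtain W \<eta> where W: "x \<in> W" "W \<subseteq> ?U" "defining_contact_form_on l W (D c) \<eta>"
    and \<Theta>W: "\<And>y. y \<in> W \<Longrightarrow> \<Theta> c y = (\<bar>contact_vol l \<eta> y\<bar> powr ?w) *\<^sub>R \<eta> y"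
    using assms(3) c x unfolding contact_tensor_field_def by blast
  obtain N \<epsilon> where N: "open N" "x \<in> N" "N \<subseteq> W"
    and \<Theta>\<eta>: "\<And>y. y \<in> N \<Longrightarrow> (\<bar>contact_vol l \<eta> y\<bar> powr ?w) *\<^sub>R \<eta> y =
      (\<epsilon> * \<bar>contact_vol l (\<theta> c) y\<bar> powr ?w) *\<^sub>R \<theta> c y"
    using contact_tensor_local_form[OF n \<theta> W(3,2,1)] by blast
  \<comment> \<open>Near \<open>x\<close> the form \<eta> supplied by the definition of \<Theta> is
    traded for the Killing form, at the price of the constant factor
    \<open>\<epsilon>\<close>.\<close>
  have \<Theta>: "\<Theta> c y $ j = \<epsilon> * (?E y * a j y)" if "y \<in> N" for y j
  proof -
    have "y \<in> W" "y \<in> ?U" using that N(3) W(2) by auto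
    then show ?thesis
      using \<Theta>W[of y] \<Theta>\<eta>[OF that] by (simp add: vol a_def mult.assoc)
  qed
  have p\<Theta>: "partial i (\<lambda>y. \<Theta> c y $ j) x =
      \<epsilon> * (?w * (\<Sum>m\<in>UNIV. ?\<Gamma>' m i m x) * ?E x * a j x + ?E x * partial i (a j) x)" for i j
  proof -
    have "partial i (\<lambda>y. \<Theta> c y $ j) x = partial i (\<lambda>y. \<epsilon> * (?E y * a j y)) x"
      by (rule partial_cong[OF N(1,2), symmetric]) (simp_all add: \<Theta> dE da)
    then show ?thesis
      using dE da by (simp add: partial_cmult partial_mult)
  qed
  \<comment> \<open>The deltas contribute n + 1 copies of \<open>\<psi> i\<close>, and n + 1 is 2l +
    2.\<close>
  have trace: "(\<Sum>m\<in>UNIV. ?\<Gamma>' m i m x) = (\<Sum>m\<in>UNIV. ?\<Gamma> m i m x) + (2 * real l + 2) * \<psi> i x" for i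
    by (simp add: proj[OF x] sum.distrib sum_kron n algebra_simps)
  \<comment> \<open>The coefficient -2 of \<psi>_i a_j meets the +1 coming from the 1-form; the
    remaining -1 balances \<psi>_j a_i, which makes the \<psi> terms antisymmetric.\<close>
  have weight: "?w * ((2 * real l + 2) * r) = - 2 * r" for r
    by (simp add: contact_weight_def field_simps)
  define T where "T i j = nabla_weighted_form (g c) ?w (\<Theta> c) i j x" for i j
  have T: "T i j = \<epsilon> * ?E x * (antisym_deriv a i j x / 2 + a i x * \<psi> j x - a j x * \<psi> i x)" for i j
  proof -
    have pa: "partial i (a j) x = antisym_deriv a i j x / 2 + (\<Sum>m\<in>UNIV. ?\<Gamma>' m i j x * a m x)"
      using killing[OF x, of i j] unfolding antisym_deriv_def by (rule half_diff_half_sum)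
    have "(\<Sum>m\<in>UNIV. ?\<Gamma>' m i j x * a m x) = (\<Sum>m\<in>UNIV. ?\<Gamma> m i j x * a m x
        + kron m i * (\<psi> j x * a m x) + kron m j * (\<psi> i x * a m x))"
      by (rule sum.cong[OF refl]) (simp add: proj[OF x] algebra_simps)
    also have "\<dots> = (\<Sum>m\<in>UNIV. ?\<Gamma> m i j x * a m x) + \<psi> j x * a i x + \<psi> i x * a j x"
      by (simp only: sum.distrib sum_kron)
    finally have \<Gamma>': "(\<Sum>m\<in>UNIV. ?\<Gamma>' m i j x * a m x) = (\<Sum>m\<in>UNIV. ?\<Gamma> m i j x * a m x) + \<psi> j x * a i x + \<psi> i x * a j x" .
    have \<Gamma>\<Theta>: "(\<Sum>k\<in>UNIV. ?\<Gamma> k i j x * \<Theta> c x $ k) = \<epsilon> * (?E x * (\<Sum>m\<in>UNIV. ?\<Gamma> m i j x * a m x))"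
      unfolding \<Theta>[OF N(2)] sum_distrib_left by (rule sum.cong[OF refl]) (simp only: mult_ac)
    have "T i j = \<epsilon> * ?E x * (?w * ((2 * real l + 2) * \<psi> i x) * a j x + partial i (a j) x - (\<Sum>m\<in>UNIV. ?\<Gamma> m i j x * a m x))"
      unfolding T_def nabla_weighted_form_def nabla_form_def nabla_density_def p\<Theta> \<Gamma>\<Theta>
      unfolding \<Theta>[OF N(2)] trace
      by (simp add: partial_def algebra_simps)
    then show ?thesis
      unfolding weight pa \<Gamma>' by (simp add: algebra_simps)
  qed
  have anti: "T j i = - T i j" for i j
  proof -
    have "antisym_deriv a j i x = - antisym_deriv a i j x"
      by (simp add: antisym_deriv_def)
    then show ?thesis
      unfolding T by (simp add: algebra_simps)
  qed
  let ?M = "matrix_inv (g c x)"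
  let ?S = "\<Sum>i\<in>UNIV. \<Sum>j\<in>UNIV. ?M $ i $ j * T i j"
  have "?S = (\<Sum>j\<in>UNIV. \<Sum>i\<in>UNIV. ?M $ i $ j * T i j)"
    by (rule sum.swap)
  also have "\<dots> = (\<Sum>j\<in>UNIV. \<Sum>i\<in>UNIV. - (?M $ j $ i * T j i))"
  proof (intro sum.cong refl)
    fix i j
    show "?M $ i $ j * T i j = - (?M $ j $ i * T j i)"
      using anti[of i j] g.matrix_inv_nth_commute[OF x, of i j] by simp
  qed
  also have "\<dots> = - ?S"
    by (simp only: sum_negf)
  finally have "?S = 0" by simp
  then show "A_density l g \<Theta> c x = 0"
    by (simp add: A_density_def T_def)
qed

end
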